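(* Let $d\ge 2$ and let $\sigma$ denote the surface measure on $S^{d-1}\subset\mathbb{R}^d$. Suppose $w$ is a non-negative weight on a ball $B_R\subset\mathbb{R}^d$ of radius $R$, $0<\delta\ll 1/2$ is a constant, and $$R^{\delta}=r_0<r_1<\cdots<r_M=R$$ is a sequence with $r_{j+1}\le r_j^2$ for all $0\le j\le M-1$. Then for every $f\in L^2(S^{d-1})$, $$w(B_R)^{-1}\int_{B_R}|\widehat{f\,d\sigma}|^2\,w\;\lesssim_{d,\delta,M}\;R^{C\delta}\left(\prod_{j=0}^{M-1}\ \sup_{\substack{Q_{j+1}\in\mathcal{D}_{r_{j+1}}\\ T_j\in\mathbb{T}_{r_j,r_{j+1}}}} w_{Q_{j+1}}(T_j)\right)\|f\|_{L^2(S^{d-1})}^2,$$ where $C>0$ is a constant independent of $R$, $M$ and $\delta$.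
   Context: $\widehat{f\,d\sigma}(x)=\int_{S^{d-1}}e^{-2\pi i x\cdot\omega}f(\omega)\,d\sigma(\omega)$. For $r>0$, $\mathcal{D}_r$ denotes the collection of almost disjoint half-open-half-closed (dyadic) cubes of side length $r$ that cover $\mathbb{R}^d$. $\mathbb{T}_{r_j,r_{j+1}}$ denotes the collection of all $r_j\times\cdots\times r_j\times r_{j+1}$ tubes in $\mathbb{R}^d$ (any position, any direction). Write $w(A):=\int_A w$ (with $w$ extended by $0$ outside $B_R$), and, for a cube $Q$, $w_Q(T):=w(Q)^{-1}\int_{T\cap Q}w$; only cubes $Q$ with $w(Q)\neq0$ are considered. The notation $X\lesssim_{d,\delta,M}Y$ means $X\le C'Y$ with a constant $C'>0$ depending only on $d,\delta,M$. *)

theory Defs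
  imports "HOL-Analysis.Analysis"
begin

(* The usual polar-coordinates definition of the (unnormalised) surface measure:
   sigma(A) is d times the Lebesgue measure of the cone {t w | 0 < t <= 1, w in A};
   see emeasure_sphere_measure. *)
definition sphere_measure :: "(real ^ 'n) measure" where
  "sphere_measure =
     scale_measure (of_nat CARD('n))
       (distr (restrict_space lborel (cball 0 1 - {0})) (restrict_space borel (sphere 0 1))
          (\<lambda>x. x /\<^sub>R norm x))"

lemma emeasure_sphere_measure:
  fixes A :: "(real ^ 'n) set"
  assumes A: "A \<in> sets borel" "A \<subseteq> sphere 0 1"
  shows "emeasure sphere_measure A =
    of_nat CARD('n) * emeasure lborel {t *\<^sub>R \<omega> | t \<omega>. 0 < t \<and> t \<le> 1 \<and> \<omega> \<in> A}"
proof -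
  let ?B = "cball 0 1 - {0::real ^ 'n}"
  have B: "?B \<in> sets lborel" by simp
  have "(\<lambda>x. x /\<^sub>R norm x) \<in> borel_measurable (restrict_space lborel ?B)"
    by (intro measurable_restrict_space1) measurable
  then have m: "(\<lambda>x. x /\<^sub>R norm x) \<in>
      restrict_space lborel ?B \<rightarrow>\<^sub>M restrict_space borel (sphere 0 1)"
    by (rule measurable_restrict_space2[rotated]) (auto simp: space_restrict_space)
  have A': "A \<in> sets (restrict_space borel (sphere 0 1))"
    using A by (subst sets_restrict_space_iff) auto
  have eq: "(\<lambda>x. x /\<^sub>R norm x) -` A \<inter> ?B =
      {t *\<^sub>R \<omega> | t \<omega>. 0 < t \<and> t \<le> 1 \<and> \<omega> \<in> A}" (is "?L = ?R")
  proof
    show "?L \<subseteq> ?R"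
    proof
      fix x assume "x \<in> ?L"
      then show "x \<in> ?R"
        by (intro CollectI exI[of _ "norm x"] exI[of _ "x /\<^sub>R norm x"]) auto
    qed
    show "?R \<subseteq> ?L"
    proof
      fix x assume "x \<in> ?R"
      then obtain t \<omega> where x: "x = t *\<^sub>R \<omega>" "0 < t" "t \<le> 1" "\<omega> \<in> A" by blast
      moreover have "norm \<omega> = 1" using x A by auto
      ultimately show "x \<in> ?L" by auto
    qed
  qed
  show ?thesis
    unfolding sphere_measure_def
    by (simp add: emeasure_distr[OF m A'] space_restrict_space eq emeasure_restrict_space B
        flip: eq)
qed

definition L2_sphere :: "(real ^ 'n \<Rightarrow> complex) set" where
  "L2_sphere = {f. f \<in> borel_measurable sphere_measure \<and>
                   integrable sphere_measure (\<lambda>\<omega>. (cmod (f \<omega>))\<^sup>2)}"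

definition L2_norm_sphere :: "(real ^ 'n \<Rightarrow> complex) \<Rightarrow> real" where
  "L2_norm_sphere f = sqrt (\<integral>\<omega>. (cmod (f \<omega>))\<^sup>2 \<partial>sphere_measure)"

definition extension_op :: "(real ^ 'n \<Rightarrow> complex) \<Rightarrow> real ^ 'n \<Rightarrow> complex" where
  "extension_op f x =
     (\<integral>\<omega>. exp (- 2 * of_real pi * \<i> * of_real (x \<bullet> \<omega>)) * f \<omega> \<partial>sphere_measure)"

definition dyadic_cubes :: "real \<Rightarrow> (real ^ 'n) set set" where
  "dyadic_cubes s =
     {{x. \<forall>i. s * of_int (k i) \<le> x $ i \<and> x $ i < s * (of_int (k i) + 1)} | k :: 'n \<Rightarrow> int. True}"

(* Images under arbitrary rigid motions of a box with one side of length l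
   and all other sides of length s. *)
definition tubes :: "real \<Rightarrow> real \<Rightarrow> (real ^ 'n) set set" where
  "tubes s l =
     {(\<lambda>x. a + U x) ` cbox 0 (\<chi> i. if i = k then l else s) | a (U :: real ^ 'n \<Rightarrow> real ^ 'n) k. orthogonal_transformation U}"

definition mass :: "(real ^ 'n \<Rightarrow> real) \<Rightarrow> (real ^ 'n) set \<Rightarrow> real" where
  "mass w A = (LINT x:A|lebesgue. w x)"

definition rel_mass :: "(real ^ 'n \<Rightarrow> real) \<Rightarrow> (real ^ 'n) set \<Rightarrow> (real ^ 'n) set \<Rightarrow> real" where
  "rel_mass w Q T = mass w (T \<inter> Q) / mass w Q"

end

theory Submission
  imports Defs "HOL-Probability.Probability" "HOL-Real_Asymp.Real_Asymp"
begin

text \<open>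
  Write \<open>E f\<close> for the Fourier transform of \<open>f d\<sigma>\<close> and \<open>P a z\<close> for the local energy, the integral of
  \<open>\<bar>E f\<bar>\<^sup>2\<close> against the Gaussian \<open>exp (-\<pi> \<bar>x - z\<bar>\<^sup>2 / a)\<close>.  The estimate comes from climbing through the scales
  \<open>r 0 < r 1 < \<dots>\<close> with the quantity \<open>I s = (1/s) \<integral> P (l s\<^sup>2) w\<close>, where \<open>l\<close> is a constant.

  At the bottom, a Gaussian is constant on the sphere, so \<open>E f\<close> is a multiple of its own convolution with a Gaussian
  of width one and \<open>\<bar>E f\<bar>\<^sup>2 \<le> C P 1 \<le> C P (l (r 0)\<^sup>2)\<close> (\<open>pointwise_le_energy\<close>).  Hence \<open>\<integral> \<bar>E f\<bar>\<^sup>2 w \<le> C r 0 I (r 0)\<close>, and this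
  \<open>r 0 = R powr \<delta>\<close> is the only power of \<open>R\<close> that is lost.  At the top, Schur's test gives
  \<open>P a \<le> C sqrt a \<parallel>f\<parallel>\<^sup>2\<close>, because a spherical cap of radius \<open>a powr (-1/2)\<close> has measure of order
  \<open>a powr (-(d-1)/2)\<close> (\<open>local_energy_le_norm\<close>, \<open>gaussian_cap_bound\<close>).

  The heart is the step from \<open>s = r j\<close> to \<open>\<rho> = r (j+1) \<le> s\<^sup>2\<close>, namely \<open>I s \<le> C (sup w_Q(T)) I \<rho>\<close>.
  For \<open>\<tau> = 2 l s\<^sup>2\<close> and \<open>v\<close> in the whole space put \<open>f_v \<omega> = exp (-\<pi> \<tau> \<bar>\<omega> - v\<bar>\<^sup>2) f \<omega>\<close>.  These packets satisfy the exact identity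
  \<open>P (\<tau>/2) z = \<tau>^d \<integral> \<bar>E f_v z\<bar>\<^sup>2 dv\<close> (\<open>frame_eq_energy\<close>), which takes the place of almost orthogonality of wave packets: it is
  used once to split the energy at scale \<open>s\<close> into packets and once, for the packets with parameter \<open>\<tau>/2\<close>, to put it
  together again at scale \<open>\<rho>\<close>.  For a single packet, \<open>\<bar>E f_v\<bar>\<^sup>2\<close> is controlled by its averages over tubes of width \<open>s\<close> and length \<open>\<rho>\<close>
  in the direction of \<open>v\<close> (\<open>packet_le_line_average\<close>).  Here the curvature of the sphere enters: for unit \<open>\<omega>\<close>, the function \<open>\<bar>\<omega> - v\<bar>\<^sup>2\<close>
  is affine in \<open>\<omega>\<close>, so the phase \<open>exp (\<i> t \<bar>\<omega> - v\<bar>\<^sup>2)\<close> is a translation of \<open>E f_v\<close> along \<open>v\<close>, while the derivative in \<open>t\<close>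
  costs a factor \<open>\<tau> \<bar>\<omega> - v\<bar>\<^sup>2\<close> that half of the Gaussian absorbs, as long as \<open>\<rho> \<le> \<tau>\<close>.  Integrating a tube average
  against \<open>w\<close> over a cube \<open>Q\<close> produces \<open>w (Q \<inter> T)\<close>, which is at most \<open>w Q\<close> times the supremum.  The direction of \<open>v\<close> is
  useless for small \<open>v\<close>, but the packets with \<open>\<bar>v\<bar> < 1/2\<close> carry only an exponentially small part of the energy
  (\<open>outer_packets_dominate\<close>).

  All localisations are Gaussian, so there are no rapidly decaying tails to control; the price is that the constant \<open>l\<close>
  grows by the factor \<open>16\<close> at each of the \<open>M\<close> steps.
\<close>

section \<open>Gaussian integrals and their Fourier transforms\<close>

lemma measurable_cis [measurable (raw)]:
  "f \<in> borel_measurable M \<Longrightarrow> (\<lambda>x. cis (f x)) \<in> borel_measurable M"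
  by (rule measurable_compose[where g = cis]) (auto intro!: borel_measurable_continuous_onI continuous_intros)

lemma integral_lborel_prod:
  fixes \<phi> :: "'a::euclidean_space \<Rightarrow> real \<Rightarrow> complex"
  assumes int: "\<And>b. b \<in> Basis \<Longrightarrow> integrable lborel (\<phi> b)"
  shows "integrable lborel (\<lambda>x::'a. \<Prod>b\<in>Basis. \<phi> b (x \<bullet> b))" (is ?A)
    and "(\<integral>x. (\<Prod>b\<in>Basis. \<phi> b (x \<bullet> b)) \<partial>(lborel::'a measure)) = (\<Prod>b\<in>Basis. \<integral>x. \<phi> b x \<partial>lborel)" (is ?B)
proof -
  interpret product_sigma_finite "\<lambda>_::'a. lborel::real measure" ..
  have lb: "(lborel::'a measure) = distr (\<Pi>\<^sub>M b\<in>(Basis::'a set). lborel) borel (\<lambda>f. \<Sum>b\<in>Basis. f b *\<^sub>R b)"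
    by (subst lborel_def) (simp only: lborel_eq_real)
  have [measurable]: "\<And>b. b \<in> Basis \<Longrightarrow> \<phi> b \<in> borel_measurable borel"
    using int by (auto dest: borel_measurable_integrable)
  have m[measurable]: "(\<lambda>x::'a. \<Prod>b\<in>Basis. \<phi> b (x \<bullet> b)) \<in> borel_measurable borel"
    by (intro borel_measurable_prod) measurable
  have s: "(\<Prod>b\<in>Basis. \<phi> b ((\<Sum>c\<in>Basis. f c *\<^sub>R c) \<bullet> b)) = (\<Prod>b\<in>Basis. \<phi> b (f b))" for f :: "'a \<Rightarrow> real"
    by (intro prod.cong) simp_all
  have T: "(\<lambda>f. \<Sum>b\<in>Basis. f b *\<^sub>R b) \<in> (\<Pi>\<^sub>M b\<in>(Basis::'a set). lborel) \<rightarrow>\<^sub>M borel"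
    by measurable
  show ?A unfolding lb
    by (subst integrable_distr_eq[OF T m]) (simp only: s product_integrable_prod[OF finite_Basis int])
  show ?B unfolding lb
    by (subst integral_distr[OF T m]) (simp only: s product_integral_prod[OF finite_Basis int])
qed

lemma gaussian_integral_1d:
  fixes a \<xi> :: real assumes "a > 0"
  shows "integrable lborel (\<lambda>x. cis (-2*pi*\<xi>*x) * exp (-pi * x\<^sup>2 / a))" (is ?A)
    and "(\<integral>x. cis (-2*pi*\<xi>*x) * exp (-pi * x\<^sup>2 / a) \<partial>lborel) = sqrt a * exp (-pi * a * \<xi>\<^sup>2)" (is ?B)
proof -
  define c where "c = sqrt (2*pi/a)"
  have c: "c > 0" "c\<^sup>2 = 2*pi/a" using assms by (auto simp: c_def)
  define t where "t = -2*pi*\<xi>/c"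
  have ch: "(CLINT x|std_normal_distribution. iexp (t * x)) = exp (- (t^2) / 2)"
    using fun_cong[OF char_std_normal_distribution, of t] unfolding char_def by simp
  have i1: "integrable lborel (\<lambda>x. std_normal_density x *\<^sub>R iexp (t * x))"
  proof (rule Bochner_Integration.integrable_bound[OF integrable_normal_moment[of 1 0 0]])
    show "AE x in lborel. norm (std_normal_density x *\<^sub>R iexp (t * x)) \<le> norm (std_normal_density x * (x - 0) ^ 0)"
      by simp
  qed auto
  have i2: "(\<integral>x. std_normal_density x *\<^sub>R iexp (t * x) \<partial>lborel) = exp (- (t^2) / 2)"
    using ch by (subst (asm) integral_density) auto
  have eq: "sqrt (2*pi) * (std_normal_density (0 + c*x) *\<^sub>R iexp (t * (0 + c*x))) = cis (-2*pi*\<xi>*x) * exp (-pi * x\<^sup>2 / a)" for x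
  proof -
    have "t * (c*x) = -2*pi*\<xi>*x" using c by (simp add: t_def)
    moreover have "(c*x)\<^sup>2/2 = pi * x\<^sup>2 / a" using c by (simp add: power_mult_distrib)
    ultimately show ?thesis by (simp add: std_normal_density_def cis_conv_exp mult_ac scaleR_conv_of_real real_sqrt_mult flip: of_real_mult)
  qed
  have "integrable lborel (\<lambda>x. sqrt (2*pi) * (std_normal_density (0 + c*x) *\<^sub>R iexp (t * (0 + c*x))))"
    by (intro integrable_mult_right, subst lborel_integrable_real_affine_iff[of c "\<lambda>x. std_normal_density x *\<^sub>R iexp (t * x)" 0])
       (use c i1 in auto)
  then show ?A by (simp only: eq)
  have "(\<integral>x. cis (-2*pi*\<xi>*x) * exp (-pi * x\<^sup>2 / a) \<partial>lborel) = (\<integral>x. sqrt (2*pi) * (std_normal_density (0 + c*x) *\<^sub>R iexp (t * (0 + c*x))) \<partial>lborel)"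
    by (simp only: eq)
  also have "\<dots> = sqrt (2*pi) * (\<integral>x. std_normal_density (0 + c*x) *\<^sub>R iexp (t * (0 + c*x)) \<partial>lborel)"
    by (rule integral_mult_right_zero)
  also have "(\<integral>x. std_normal_density (0 + c*x) *\<^sub>R iexp (t * (0 + c*x)) \<partial>lborel) = (1/c) *\<^sub>R exp (- (t^2) / 2)"
    using lborel_integral_real_affine[of c "\<lambda>x. std_normal_density x *\<^sub>R iexp (t * x)" 0] c unfolding i2
    by (simp add: field_simps scaleR_conv_of_real)
  also have "- (t^2)/2 = -pi * a * \<xi>\<^sup>2"
    using c assms by (simp add: t_def power_divide power_mult_distrib field_simps power2_eq_square)
  also have "complex_of_real (sqrt (2*pi)) * complex_of_real ((1/c) *\<^sub>R exp (-pi * a * \<xi>\<^sup>2)) = sqrt a * exp (-pi * a * \<xi>\<^sup>2)"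
    using c assms by (simp add: c_def real_sqrt_divide scaleR_conv_of_real)
  finally show ?B by simp
qed

text \<open>
  The integrand and a multiple of the Gaussian itself differ by the derivative of \<open>(x - \<i> a \<xi>) exp (-\<pi> x\<^sup>2/a - 2 \<pi> \<i> \<xi> x)\<close>.
\<close>

lemma gaussian_second_moment_1d:
  fixes a \<xi> :: real assumes a: "a > 0"
  shows "integrable lborel (\<lambda>x. (1 - 2*pi*x\<^sup>2/a) * cis (-2*pi*\<xi>*x) * exp (-pi * x\<^sup>2 / a))" (is ?A)
    and "(\<integral>x. (1 - 2*pi*x\<^sup>2/a) * cis (-2*pi*\<xi>*x) * exp (-pi * x\<^sup>2 / a) \<partial>lborel)
      = 2*pi*a*\<xi>\<^sup>2 * (sqrt a * exp (-pi * a * \<xi>\<^sup>2))" (is ?B)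
proof -
  let ?e = "\<lambda>x. cis (-2*pi*\<xi>*x) * exp (-pi * x\<^sup>2 / a)"
  \<comment> \<open>\<open>F\<close> is chosen so that the mixed terms in its derivative \<open>g\<close> cancel.\<close>
  define F where "F = (\<lambda>x. (of_real x - \<i> * (a * \<xi>)) * ?e x)"
  define g where "g = (\<lambda>x. (1 - 2*pi*x\<^sup>2/a - 2*pi*a*\<xi>\<^sup>2) * ?e x)"
  have e1: "1 + y \<le> exp y" for y :: real by (rule exp_ge_add_one_self)
  have bnd: "x\<^sup>2 * exp (-pi * x\<^sup>2 / a) \<le> a * exp (-pi * x\<^sup>2 / (2*a))" for x
  proof -
    have "x\<^sup>2 \<le> a * exp (pi * x\<^sup>2 / (2*a))"
    proof -
      have "x\<^sup>2 = a * (2/pi) * (pi * x\<^sup>2 / (2*a))" using a by (simp add: field_simps)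
      also have "\<dots> \<le> a * 1 * exp (pi * x\<^sup>2 / (2*a))"
        using a pi_gt3 e1[of "pi * x\<^sup>2 / (2*a)"] by (intro mult_mono) (auto simp: field_simps)
      finally show ?thesis by simp
    qed
    then have "x\<^sup>2 * exp (-pi * x\<^sup>2 / a) \<le> (a * exp (pi * x\<^sup>2 / (2*a))) * exp (-pi * x\<^sup>2 / a)"
      by (intro mult_right_mono) auto
    also have "\<dots> = a * exp (pi * x\<^sup>2 / (2*a) + -pi * x\<^sup>2 / a)" by (simp only: exp_add mult.assoc)
    also have "pi * x\<^sup>2 / (2*a) + -pi * x\<^sup>2 / a = -pi * x\<^sup>2 / (2*a)" using a by (simp add: field_simps)
    finally show ?thesis .
  qed
  have re: "integrable lborel (\<lambda>x::real. a * exp (-pi * x\<^sup>2 / (2*a)))" 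
    using gaussian_integral_1d(1)[of "2*a" 0] a
    by (intro integrable_mult_right) (simp add: complex_of_real_integrable_eq del: of_real_exp flip: of_real_power of_real_divide of_real_mult of_real_minus)
  have i2: "integrable lborel (\<lambda>x. of_real (x\<^sup>2) * ?e x)"
    by (rule Bochner_Integration.integrable_bound[OF re])
       (use bnd a in \<open>auto simp: norm_mult simp del: of_real_power of_real_exp\<close>)
  have i0: "integrable lborel ?e" using gaussian_integral_1d(1)[OF a] .
  show ?A
    by (rule Bochner_Integration.integrable_cong[THEN iffD1, OF _ _ Bochner_Integration.integrable_diff[OF i0 integrable_mult_right[OF i2, of "2*pi/a"]]])
       (auto simp: algebra_simps)
  have gi: "integrable lborel g"
    by (rule Bochner_Integration.integrable_cong[THEN iffD1, OF _ _ Bochner_Integration.integrable_diff[OF \<open>?A\<close> integrable_mult_right[OF i0, of "2*pi*a*\<xi>\<^sup>2"]]])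
       (auto simp: g_def algebra_simps)
  have "(LBINT x=-\<infinity>..\<infinity>. g x) = 0 - 0"
  proof (rule interval_integral_FTC_integrable)
    show "(F has_vector_derivative g x) (at x)" for x
    proof -
      have "((\<lambda>z. (z - \<i> * (a * \<xi>)) * (exp (\<i> * (-2*pi*\<xi>*z)) * exp (-pi * z\<^sup>2 / a))) has_field_derivative g x) (at (of_real x))"
        unfolding g_def cis_conv_exp
        apply (rule derivative_eq_intros refl | simp add: a[THEN less_imp_neq, symmetric])+
        using a by (simp add: field_simps power2_eq_square exp_of_real[symmetric])
      from has_vector_derivative_real_field[OF this] show ?thesis
        by (simp add: F_def cis_conv_exp exp_of_real[symmetric] o_def)
    qed
    have "continuous_on UNIV g" unfolding g_def using a by (intro continuous_intros) auto
    then show "isCont g x" for x by (simp add: continuous_on_eq_continuous_at)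
    show "set_integrable lborel (einterval (-\<infinity>) \<infinity>) g" using gi by (simp add: set_integrable_def)
    have lim: "(F \<longlongrightarrow> 0) at_top" "(F \<longlongrightarrow> 0) at_bot"
    proof -
      have n: "norm (F x) \<le> (\<bar>x\<bar> + a * \<bar>\<xi>\<bar>) * exp (-pi * x\<^sup>2 / a)" for x
      proof -
        have "norm (of_real x - \<i> * (a * \<xi>)) \<le> \<bar>x\<bar> + a * \<bar>\<xi>\<bar>"
          using norm_triangle_ineq4[of "of_real x::complex" "\<i> * (a * \<xi>)"] a by (simp add: norm_mult)
        then show ?thesis by (simp add: F_def norm_mult mult_right_mono del: of_real_exp)
      qed
      have l: "((\<lambda>x. (\<bar>x\<bar> + a * \<bar>\<xi>\<bar>) * exp (-pi * x\<^sup>2 / a)) \<longlongrightarrow> 0) at_top"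
           "((\<lambda>x. (\<bar>x\<bar> + a * \<bar>\<xi>\<bar>) * exp (-pi * x\<^sup>2 / a)) \<longlongrightarrow> 0) at_bot"
        using a by real_asymp+
      show "(F \<longlongrightarrow> 0) at_top" "(F \<longlongrightarrow> 0) at_bot"
        by (rule Lim_null_comparison[OF always_eventually[OF allI[OF n]]], fact l)+
    qed
    show "((F \<circ> real_of_ereal) \<longlongrightarrow> 0) (at_right (-\<infinity>))" "((F \<circ> real_of_ereal) \<longlongrightarrow> 0) (at_left \<infinity>)"
      using lim by (simp_all add: ereal_tendsto_simps1)
  qed auto
  then have g0: "integral\<^sup>L lborel g = 0"
    by (simp add: interval_lebesgue_integral_def set_lebesgue_integral_def)
  have "(\<integral>x. (1 - 2*pi*x\<^sup>2/a) * cis (-2*pi*\<xi>*x) * exp (-pi * x\<^sup>2 / a) \<partial>lborel) = (\<integral>x. g x + 2*pi*a*\<xi>\<^sup>2 * ?e x \<partial>lborel)"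
    by (intro Bochner_Integration.integral_cong) (auto simp: g_def algebra_simps)
  also have "\<dots> = integral\<^sup>L lborel g + 2*pi*a*\<xi>\<^sup>2 * (\<integral>x. ?e x \<partial>lborel)"
    by (subst Bochner_Integration.integral_add[OF gi integrable_mult_right[OF i0]]) (simp only: integral_mult_right_zero)
  finally show ?B unfolding g0 gaussian_integral_1d(2)[OF a] by simp
qed

lemma prod_exp_coordinates:
  fixes x :: "'a::euclidean_space"
  shows "(\<Prod>b\<in>Basis. exp (c * (x \<bullet> b)\<^sup>2)) = exp (c * (norm x)\<^sup>2)"
proof -
  have "(norm x)\<^sup>2 = (\<Sum>b\<in>Basis. (x \<bullet> b)\<^sup>2)"
    unfolding power2_norm_eq_inner by (subst euclidean_inner) (simp only: power2_eq_square)
  then show ?thesis by (simp add: sum_distrib_left exp_sum)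
qed

lemma norm_add_sq_le:
  fixes x y :: "'a::real_inner"
  shows "(norm (x + y))\<^sup>2 \<le> 2 * (norm x)\<^sup>2 + 2 * (norm y)\<^sup>2"
proof -
  have "2 * (norm x)\<^sup>2 + 2 * (norm y)\<^sup>2 - (norm (x + y))\<^sup>2 = (norm (x - y))\<^sup>2"
    unfolding power2_norm_eq_inner by (simp add: inner_diff_left inner_diff_right inner_add_left inner_add_right inner_commute)
  then show ?thesis by (smt (verit) zero_le_power2)
qed

abbreviation gauss :: "real \<Rightarrow> 'a::real_normed_vector \<Rightarrow> real" where
  "gauss a x \<equiv> exp (-pi * (norm x)\<^sup>2 / a)"

lemma gaussian_prod:
  fixes x \<xi> :: "'a::euclidean_space"
  shows "(\<Prod>b\<in>Basis. cis (-2*pi*(\<xi> \<bullet> b)*(x \<bullet> b)) * complex_of_real (exp (-pi * (x \<bullet> b)\<^sup>2 / a)))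
    = cis (-2*pi*(x \<bullet> \<xi>)) * gauss a x"
proof -
  have 1: "(\<Prod>b\<in>Basis. cis (-2*pi*(\<xi> \<bullet> b)*(x \<bullet> b))) = cis (-2*pi*(x \<bullet> \<xi>))"
    by (simp add: cis_conv_exp euclidean_inner[of x \<xi>] sum_distrib_left exp_sum flip: sum_negf)
       (simp add: mult_ac)
  have 2: "(\<Prod>b\<in>Basis. exp (-pi * (x \<bullet> b)\<^sup>2 / a)) = gauss a x"
    using prod_exp_coordinates[of "-pi/a" x] by simp
  show ?thesis by (simp only: prod.distrib 1 2 flip: of_real_prod)
qed

lemma gaussian_fourier:
  fixes \<xi> :: "'a::euclidean_space" assumes a: "a > 0"
  shows "integrable lborel (\<lambda>x. cis (-2*pi*(x \<bullet> \<xi>)) * gauss a x)"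
    and "(\<integral>x. cis (-2*pi*(x \<bullet> \<xi>)) * gauss a x \<partial>lborel)
      = sqrt a ^ DIM('a) * exp (-pi * a * (norm \<xi>)\<^sup>2)"
proof -
  let ?\<phi> = "\<lambda>b x. cis (-2*pi*(\<xi> \<bullet> b)*x) * complex_of_real (exp (-pi * x\<^sup>2 / a))"
  note P = integral_lborel_prod[of ?\<phi>, OF gaussian_integral_1d(1)[OF a], unfolded gaussian_prod]
  show "integrable lborel (\<lambda>x. cis (-2*pi*(x \<bullet> \<xi>)) * gauss a x)" using P(1) .
  have "(\<Prod>b\<in>Basis. exp (-pi * a * (\<xi> \<bullet> b)\<^sup>2)) = exp (-pi * a * (norm \<xi>)\<^sup>2)"
    by (rule prod_exp_coordinates)
  then show "(\<integral>x. cis (-2*pi*(x \<bullet> \<xi>)) * gauss a x \<partial>lborel)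
      = sqrt a ^ DIM('a) * exp (-pi * a * (norm \<xi>)\<^sup>2)"
    unfolding P(2) by (simp only: gaussian_integral_1d(2)[OF a] flip: of_real_mult of_real_prod) (simp add: prod.distrib)
qed

text \<open>
  In dimension \<open>d\<close> the multiplier \<open>\<bar>\<xi>\<bar>\<^sup>2 exp (-\<pi> a \<bar>\<xi>\<bar>\<^sup>2)\<close> is again the transform of a function with Gaussian decay.  This
  multiplier is the error made when a packet is averaged along a line segment.
\<close>

lemma gaussian_second_moment:
  fixes \<xi> :: "'a::euclidean_space" and G :: "'a \<Rightarrow> complex"
  assumes a: "a > 0"
  defines "G \<equiv> \<lambda>x::'a. cis (-2*pi*(x \<bullet> \<xi>)) * complex_of_real (gauss a x)"
  shows "integrable lborel (\<lambda>x. (DIM('a) - 2*pi*(norm x)\<^sup>2/a) * G x)"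
    and "(\<integral>x. (DIM('a) - 2*pi*(norm x)\<^sup>2/a) * G x \<partial>lborel)
      = 2*pi*a*(norm \<xi>)\<^sup>2 * (sqrt a ^ DIM('a) * exp (-pi * a * (norm \<xi>)\<^sup>2))"
proof -
  let ?e = "\<lambda>b x. cis (-2*pi*(\<xi> \<bullet> b)*x) * complex_of_real (exp (-pi * x\<^sup>2 / a))"
  define \<phi> where "\<phi> = (\<lambda>c b x. (if b = c then complex_of_real (1 - 2*pi*x\<^sup>2/a) else 1) * ?e b x)"
  have \<phi>: "(\<Prod>b\<in>Basis. \<phi> c b (x \<bullet> b)) = (1 - 2*pi*(x \<bullet> c)\<^sup>2/a) * G x" if "c \<in> Basis" for c and x :: 'a
    unfolding \<phi>_def by (subst prod.distrib, subst gaussian_prod) (use that in \<open>simp add: G_def\<close>)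
  have int1: "integrable lborel (\<phi> c b)" for c b :: 'a
    using gaussian_integral_1d(1)[OF a] gaussian_second_moment_1d(1)[OF a]
    by (cases "b = c") (simp_all add: \<phi>_def mult.assoc)
  have val: "integral\<^sup>L lborel (\<phi> c b) = (if b = c then of_real (2*pi*a*(\<xi> \<bullet> b)\<^sup>2) else 1) * of_real (sqrt a * exp (-pi * a * (\<xi> \<bullet> b)\<^sup>2))" for c b :: 'a
    using gaussian_integral_1d(2)[OF a, of "\<xi> \<bullet> b"] gaussian_second_moment_1d(2)[OF a, of "\<xi> \<bullet> b"]
    by (cases "b = c") (simp_all add: \<phi>_def mult.assoc)
  have E: "(\<Prod>b\<in>Basis. exp (-pi * a * (\<xi> \<bullet> b)\<^sup>2)) = exp (-pi * a * (norm \<xi>)\<^sup>2)"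
    by (rule prod_exp_coordinates)
  have I: "integrable lborel (\<lambda>x. (1 - 2*pi*(x \<bullet> c)\<^sup>2/a) * G x)"
      "(\<integral>x. (1 - 2*pi*(x \<bullet> c)\<^sup>2/a) * G x \<partial>lborel) = 2*pi*a*(\<xi> \<bullet> c)\<^sup>2 * (sqrt a ^ DIM('a) * exp (-pi * a * (norm \<xi>)\<^sup>2))"
    if c: "c \<in> Basis" for c
  proof -
    note P = integral_lborel_prod[of "\<phi> c", OF int1, unfolded \<phi>[OF c]]
    show "integrable lborel (\<lambda>x. (1 - 2*pi*(x \<bullet> c)\<^sup>2/a) * G x)" using P(1) .
    have "(\<Prod>b\<in>Basis. integral\<^sup>L lborel (\<phi> c b)) = of_real (2*pi*a*(\<xi> \<bullet> c)\<^sup>2) * of_real (\<Prod>b\<in>Basis. sqrt a * exp (-pi * a * (\<xi> \<bullet> b)\<^sup>2))"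
      unfolding val prod.distrib[of "\<lambda>b. if b = c then _ b else _"] of_real_prod using c by simp
    also have "(\<Prod>b\<in>Basis. sqrt a * exp (-pi * a * (\<xi> \<bullet> b)\<^sup>2)) = sqrt a ^ DIM('a) * exp (-pi * a * (norm \<xi>)\<^sup>2)"
      unfolding prod.distrib E by simp
    finally show "(\<integral>x. (1 - 2*pi*(x \<bullet> c)\<^sup>2/a) * G x \<partial>lborel) = 2*pi*a*(\<xi> \<bullet> c)\<^sup>2 * (sqrt a ^ DIM('a) * exp (-pi * a * (norm \<xi>)\<^sup>2))"
      unfolding P(2) by simp
  qed
  have nsq: "(\<Sum>c\<in>Basis. (y \<bullet> c)\<^sup>2) = (norm y)\<^sup>2" for y :: 'a
    unfolding power2_norm_eq_inner by (subst euclidean_inner) (simp only: power2_eq_square)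
  have s: "(\<Sum>c\<in>Basis. (1 - 2*pi*(x \<bullet> c)\<^sup>2/a) * G x) = (DIM('a) - 2*pi*(norm x)\<^sup>2/a) * G x" for x :: 'a
  proof -
    have "(\<Sum>c\<in>Basis. (1 - 2*pi*(x \<bullet> c)\<^sup>2/a)) = DIM('a) - 2*pi*(\<Sum>c\<in>Basis. (x \<bullet> c)\<^sup>2)/a"
      by (simp add: sum_subtractf sum_distrib_left sum_divide_distrib)
    then show ?thesis by (simp only: nsq flip: of_real_sum sum_distrib_right)
  qed
  have "integrable lborel (\<lambda>x. \<Sum>c\<in>Basis. (1 - 2*pi*(x \<bullet> c)\<^sup>2/a) * G x)"
    using I(1) by (intro Bochner_Integration.integrable_sum) auto
  then show "integrable lborel (\<lambda>x. (DIM('a) - 2*pi*(norm x)\<^sup>2/a) * G x)" unfolding s .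
  have "(\<integral>x. (\<Sum>c\<in>Basis. (1 - 2*pi*(x \<bullet> c)\<^sup>2/a) * G x) \<partial>lborel) = (\<Sum>c\<in>Basis. of_real (2*pi*a*(\<xi> \<bullet> c)\<^sup>2) * (sqrt a ^ DIM('a) * exp (-pi * a * (norm \<xi>)\<^sup>2)))"
    using I by (subst Bochner_Integration.integral_sum) auto
  also have "\<dots> = of_real (2*pi*a*(\<Sum>c\<in>Basis. (\<xi> \<bullet> c)\<^sup>2)) * (sqrt a ^ DIM('a) * exp (-pi * a * (norm \<xi>)\<^sup>2))"
    by (simp only: sum_distrib_left of_real_sum flip: sum_distrib_right)
  finally show "(\<integral>x. (DIM('a) - 2*pi*(norm x)\<^sup>2/a) * G x \<partial>lborel)
      = 2*pi*a*(norm \<xi>)\<^sup>2 * (sqrt a ^ DIM('a) * exp (-pi * a * (norm \<xi>)\<^sup>2))"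
    unfolding s nsq by simp
qed

lemma gaussian_integral:
  fixes z :: "'a::euclidean_space" assumes a: "a > 0"
  shows "integrable lborel (\<lambda>x::'a. gauss a (x - z))"
    and "(\<integral>x. gauss a (x - z) \<partial>lborel) = sqrt a ^ DIM('a)"
    and "(\<integral>\<^sup>+x. ennreal (gauss a (x - z)) \<partial>lborel) = ennreal (sqrt a ^ DIM('a))"
proof -
  have 0: "integrable lborel (\<lambda>x::'a. gauss a x)"
    using gaussian_fourier(1)[OF a, of 0] by (simp add: complex_of_real_integrable_eq del: of_real_exp)
  have "complex_of_real (\<integral>x. gauss a (x::'a) \<partial>lborel) = of_real (sqrt a ^ DIM('a))"
    using gaussian_fourier(2)[OF a, of 0] by (simp del: of_real_exp)
  then have 1: "(\<integral>x. gauss a (x::'a) \<partial>lborel) = sqrt a ^ DIM('a)"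
    by (simp only: of_real_eq_iff)
  have eq: "gauss a (x - z) = gauss a (- z + x)" for x by simp
  have lt: "distr lborel borel ((+) (- z)) = lborel" by (rule lborel_distr_plus)
  show i: "integrable lborel (\<lambda>x::'a. gauss a (x - z))"
    unfolding eq using 0 by (subst (asm) lt[symmetric], subst (asm) integrable_distr_eq) auto
  show v: "(\<integral>x. gauss a (x - z) \<partial>lborel) = sqrt a ^ DIM('a)"
    unfolding eq using 1 by (subst (asm) lt[symmetric], subst (asm) integral_distr) auto
  show "(\<integral>\<^sup>+x. ennreal (gauss a (x - z)) \<partial>lborel) = ennreal (sqrt a ^ DIM('a))"
    using nn_integral_eq_integral[OF i] unfolding v by simp
qed

lemma gaussian_fourier_shift:
  fixes \<xi> z :: "'a::euclidean_space" assumes a: "a > 0"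
  shows "integrable lborel (\<lambda>x. cis (-2*pi*(x \<bullet> \<xi>)) * gauss a (x - z))"
    and "(\<integral>x. cis (-2*pi*(x \<bullet> \<xi>)) * gauss a (x - z) \<partial>lborel)
      = cis (-2*pi*(z \<bullet> \<xi>)) * (sqrt a ^ DIM('a) * exp (-pi * a * (norm \<xi>)\<^sup>2))"
proof -
  define G where "G = (\<lambda>x::'a. cis (-2*pi*(x \<bullet> \<xi>)) * complex_of_real (gauss a x))"
  have G: "integrable lborel G" "integral\<^sup>L lborel G = sqrt a ^ DIM('a) * exp (-pi * a * (norm \<xi>)\<^sup>2)"
    using gaussian_fourier[OF a, of \<xi>] by (simp_all add: G_def)
  have [measurable]: "G \<in> borel_measurable borel" unfolding G_def by measurable
  have eq: "cis (-2*pi*(x \<bullet> \<xi>)) * gauss a (x - z) = cis (-2*pi*(z \<bullet> \<xi>)) * G (- z + x)" for x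
  proof -
    have "-2*pi*(x \<bullet> \<xi>) = -2*pi*(z \<bullet> \<xi>) + -2*pi*((- z + x) \<bullet> \<xi>)" by (simp add: inner_diff_left right_diff_distrib)
    then have "cis (-2*pi*(x \<bullet> \<xi>)) = cis (-2*pi*(z \<bullet> \<xi>)) * cis (-2*pi*((- z + x) \<bullet> \<xi>))" by (simp only: cis_mult)
    then show ?thesis by (simp only: G_def mult.assoc uminus_add_conv_diff)
  qed
  have lt: "distr lborel borel ((+) (- z)) = lborel" by (rule lborel_distr_plus)
  have "integrable lborel (\<lambda>x. G (- z + x))"
    using G(1) by (subst (asm) lt[symmetric], subst (asm) integrable_distr_eq) auto
  then show "integrable lborel (\<lambda>x. cis (-2*pi*(x \<bullet> \<xi>)) * gauss a (x - z))"
    unfolding eq by (rule integrable_mult_right)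
  have "(\<integral>x. G (- z + x) \<partial>lborel) = integral\<^sup>L lborel G"
    by (subst (2) lt[symmetric], subst integral_distr) auto
  then show "(\<integral>x. cis (-2*pi*(x \<bullet> \<xi>)) * gauss a (x - z) \<partial>lborel)
      = cis (-2*pi*(z \<bullet> \<xi>)) * (sqrt a ^ DIM('a) * exp (-pi * a * (norm \<xi>)\<^sup>2))"
    unfolding eq by (simp add: G(2))
qed

section \<open>Quadratic forms of integral operators\<close>

lemma measurable_cnj [measurable (raw)]:
  "f \<in> borel_measurable M \<Longrightarrow> (\<lambda>x. cnj (f x)) \<in> borel_measurable M"
  by (rule measurable_compose[where g = cnj]) (auto intro!: borel_measurable_continuous_onI continuous_intros)

lemma integrable_tensor:
  fixes u :: "'a \<Rightarrow> complex" and v :: "'b \<Rightarrow> complex"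
  assumes "sigma_finite_measure M" "sigma_finite_measure N"
    and u: "integrable M u" and v: "integrable N v"
  shows "integrable (M \<Otimes>\<^sub>M N) (\<lambda>(x, y). u x * v y)"
    and "(\<integral>(x, y). u x * v y \<partial>(M \<Otimes>\<^sub>M N)) = integral\<^sup>L M u * integral\<^sup>L N v"
proof -
  interpret pair_sigma_finite M N by (intro pair_sigma_finite.intro assms)
  have [measurable]: "u \<in> borel_measurable M" "v \<in> borel_measurable N" using u v by auto
  show i: "integrable (M \<Otimes>\<^sub>M N) (\<lambda>(x, y). u x * v y)"
  proof (rule Fubini_integrable)
    show "integrable M (\<lambda>x. \<integral>y. norm (case (x, y) of (x, y) \<Rightarrow> u x * v y) \<partial>N)"
      using u by (simp add: norm_mult)
    show "AE x in M. integrable N (\<lambda>y. case (x, y) of (x, y) \<Rightarrow> u x * v y)"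
      using v by simp
  qed measurable
  show "(\<integral>(x, y). u x * v y \<partial>(M \<Otimes>\<^sub>M N)) = integral\<^sup>L M u * integral\<^sup>L N v"
    using integral_fst[OF i] by simp
qed

text \<open>
  Squaring out \<open>\<bar>\<integral> k f\<bar>\<^sup>2\<close> and integrating first in \<open>x\<close> gives a quadratic form in \<open>f\<close>.  With Gaussian kernels it takes over
  the role of Plancherel's theorem: two square functions whose kernels have proportional quadratic forms are proportional.
\<close>

lemma nn_integral_kernel_sq:
  fixes f :: "'b \<Rightarrow> complex" and k :: "'a \<Rightarrow> 'b \<Rightarrow> complex"
  assumes N: "sigma_finite_measure N" and S: "sigma_finite_measure \<sigma>"
    and f: "integrable \<sigma> f"
    and k: "(\<lambda>(x, \<omega>). k x \<omega>) \<in> borel_measurable (N \<Otimes>\<^sub>M \<sigma>)"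
    and G: "integrable N (\<lambda>x. (G x)\<^sup>2)"
    and kG: "\<And>x \<omega>. x \<in> space N \<Longrightarrow> \<omega> \<in> space \<sigma> \<Longrightarrow> cmod (k x \<omega>) \<le> G x"
  shows "(\<integral>\<^sup>+x. ennreal ((cmod (\<integral>\<omega>. k x \<omega> * f \<omega> \<partial>\<sigma>))\<^sup>2) \<partial>N)
    = ennreal (Re (\<integral>(\<omega>, \<omega>'). (\<integral>x. k x \<omega> * cnj (k x \<omega>') \<partial>N) * (f \<omega> * cnj (f \<omega>')) \<partial>(\<sigma> \<Otimes>\<^sub>M \<sigma>)))"
proof -
  let ?SS = "\<sigma> \<Otimes>\<^sub>M \<sigma>"
  interpret N: sigma_finite_measure N by fact
  interpret S: sigma_finite_measure \<sigma> by fact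
  interpret SS: pair_sigma_finite \<sigma> \<sigma> ..
  have SSs: "sigma_finite_measure ?SS" by unfold_locales
  interpret NS: pair_sigma_finite N "\<sigma> \<Otimes>\<^sub>M \<sigma>" ..
  have [measurable]: "f \<in> borel_measurable \<sigma>" using f by auto
  note k[measurable]
  have kx[measurable]: "(\<lambda>\<omega>. k x \<omega>) \<in> borel_measurable \<sigma>" if "x \<in> space N" for x
    using measurable_compose[OF measurable_Pair1'[OF that] k] by simp
  define H where "H = (\<lambda>x. \<integral>\<omega>. k x \<omega> * f \<omega> \<partial>\<sigma>)"
  have [measurable]: "H \<in> borel_measurable N" unfolding H_def by measurable
  have ki: "integrable \<sigma> (\<lambda>\<omega>. k x \<omega> * f \<omega>)" if x: "x \<in> space N" for x
  proof (rule Bochner_Integration.integrable_bound[OF integrable_mult_right[OF f, of "G x"]])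
    show "AE \<omega> in \<sigma>. norm (k x \<omega> * f \<omega>) \<le> norm (of_real (G x) * f \<omega>)"
    proof (rule AE_I2)
      fix \<omega> assume "\<omega> \<in> space \<sigma>"
      then have "cmod (k x \<omega>) \<le> \<bar>G x\<bar>" using kG[OF x] by fastforce
      then show "norm (k x \<omega> * f \<omega>) \<le> norm (of_real (G x) * f \<omega>)" by (simp add: norm_mult mult_right_mono)
    qed
  qed (use x in measurable)
  define K where "K = (\<lambda>x p. k x (fst p) * cnj (k x (snd p)) * (f (fst p) * cnj (f (snd p))))"
  have Km: "case_prod K \<in> borel_measurable (N \<Otimes>\<^sub>M ?SS)"
    unfolding K_def by measurable
  have cf: "integrable \<sigma> (\<lambda>\<omega>. cnj (f \<omega>))" using f by simp
  have HK: "integrable ?SS (K x)" "(\<integral>p. K x p \<partial>?SS) = of_real ((cmod (H x))\<^sup>2)"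
    if x: "x \<in> space N" for x
  proof -
    have c: "integrable \<sigma> (\<lambda>\<omega>. cnj (k x \<omega> * f \<omega>))" by (rule integrable_cnj[OF ki[OF x]])
    have e: "(\<lambda>(\<omega>, \<omega>'). k x \<omega> * f \<omega> * cnj (k x \<omega>' * f \<omega>')) = K x"
      by (auto simp: K_def)
    note t = integrable_tensor[OF S S ki[OF x] c, unfolded e]
    show "integrable ?SS (K x)" using t(1) .
    show "(\<integral>p. K x p \<partial>?SS) = of_real ((cmod (H x))\<^sup>2)"
    proof -
      have eq: "(\<integral>\<omega>. cnj (k x \<omega> * f \<omega>) \<partial>\<sigma>) = cnj (H x)" unfolding H_def using Bochner_Integration.integral_cnj[of \<sigma> "\<lambda>\<omega>. k x \<omega> * f \<omega>"] by (simp only:)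
      then have "(\<integral>p. K x p \<partial>?SS) = H x * cnj (H x)" using t(2) unfolding eq by (simp only: H_def)
      then show ?thesis by (simp only: complex_norm_square)
    qed
  qed
  have bd: "integrable (N \<Otimes>\<^sub>M ?SS) (\<lambda>(x, p). of_real ((G x)\<^sup>2) * (case p of (\<omega>, \<omega>') \<Rightarrow> f \<omega> * cnj (f \<omega>')))"
    by (rule integrable_tensor(1)[OF N SSs integrable_of_real[OF G] integrable_tensor(1)[OF S S f cf]])
  have int: "integrable (N \<Otimes>\<^sub>M ?SS) (\<lambda>(x, p). K x p)"
  proof (rule Bochner_Integration.integrable_bound[OF bd])
    show "AE q in N \<Otimes>\<^sub>M ?SS. norm (case q of (x, p) \<Rightarrow> K x p) \<le>
      norm (case q of (x, p) \<Rightarrow> of_real ((G x)\<^sup>2) * (case p of (\<omega>, \<omega>') \<Rightarrow> f \<omega> * cnj (f \<omega>')))"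
    proof (rule AE_I2)
      fix q assume q: "q \<in> space (N \<Otimes>\<^sub>M ?SS)"
      obtain x w w' where qq: "q = (x, w, w')" by (cases q) auto
      with q have s: "x \<in> space N" "w \<in> space \<sigma>" "w' \<in> space \<sigma>" by (auto simp: space_pair_measure)
      have "cmod (k x w) * cmod (k x w') \<le> G x * G x"
        using kG[OF s(1,2)] kG[OF s(1,3)] by (intro mult_mono) (auto intro: order_trans[OF norm_ge_zero])
      then show "norm (case q of (x, p) \<Rightarrow> K x p) \<le> norm (case q of (x, p) \<Rightarrow> of_real ((G x)\<^sup>2) * (case p of (\<omega>, \<omega>') \<Rightarrow> f \<omega> * cnj (f \<omega>')))"
        by (simp add: qq K_def norm_mult power2_eq_square mult_right_mono)
    qed
  qed (fact Km)
  have hi: "integrable N (\<lambda>x. of_real ((cmod (H x))\<^sup>2) :: complex)"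
    by (rule Bochner_Integration.integrable_cong[THEN iffD1, OF refl HK(2) NS.integrable_fst[OF int]])
  then have hi': "integrable N (\<lambda>x. (cmod (H x))\<^sup>2)" unfolding complex_of_real_integrable_eq .
  have "complex_of_real (\<integral>x. (cmod (H x))\<^sup>2 \<partial>N) = (\<integral>x. of_real ((cmod (H x))\<^sup>2) \<partial>N)"
    by (rule integral_complex_of_real[symmetric])
  also have "\<dots> = (\<integral>x. (\<integral>p. K x p \<partial>?SS) \<partial>N)"
    by (rule Bochner_Integration.integral_cong[OF refl HK(2)[symmetric]])
  also have "\<dots> = (\<integral>p. (\<integral>x. K x p \<partial>N) \<partial>?SS)"
    using NS.integral_fst[OF int] NS.integral_snd[OF int] by (simp only:)
  also have "\<dots> = (\<integral>(\<omega>, \<omega>'). (\<integral>x. k x \<omega> * cnj (k x \<omega>') \<partial>N) * (f \<omega> * cnj (f \<omega>')) \<partial>?SS)"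
    by (rule Bochner_Integration.integral_cong) (auto simp: K_def simp del: integral_mult_left_zero intro!: integral_mult_left_zero)
  finally have C: "complex_of_real (\<integral>x. (cmod (H x))\<^sup>2 \<partial>N) = (\<integral>(\<omega>, \<omega>'). (\<integral>x. k x \<omega> * cnj (k x \<omega>') \<partial>N) * (f \<omega> * cnj (f \<omega>')) \<partial>?SS)" .
  have "(\<integral>x. (cmod (H x))\<^sup>2 \<partial>N) = Re (\<integral>(\<omega>, \<omega>'). (\<integral>x. k x \<omega> * cnj (k x \<omega>') \<partial>N) * (f \<omega> * cnj (f \<omega>')) \<partial>?SS)"
    using arg_cong[OF C, of Re] by (simp only: Re_complex_of_real)
  moreover have "(\<integral>\<^sup>+x. ennreal ((cmod (H x))\<^sup>2) \<partial>N) = ennreal (\<integral>x. (cmod (H x))\<^sup>2 \<partial>N)"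
    by (intro nn_integral_eq_integral hi') auto
  ultimately show ?thesis by (simp add: H_def)
qed

section \<open>The extension operator, Gaussian packets and local energies\<close>

definition sphere_ft :: "'a::euclidean_space measure \<Rightarrow> ('a \<Rightarrow> complex) \<Rightarrow> 'a \<Rightarrow> complex" where
  "sphere_ft \<sigma> f x = (\<integral>\<omega>. cis (-2*pi*(x \<bullet> \<omega>)) * f \<omega> \<partial>\<sigma>)"

text \<open>
  The centre \<open>v\<close> is an arbitrary point of the space, not a point of the sphere: the frame identity is exact only when \<open>v\<close>
  runs through the whole space.
\<close>

definition packet :: "real \<Rightarrow> 'a::euclidean_space \<Rightarrow> ('a \<Rightarrow> complex) \<Rightarrow> 'a \<Rightarrow> complex" where
  "packet \<tau> v f \<omega> = of_real (exp (-pi * \<tau> * (norm (\<omega> - v))\<^sup>2)) * f \<omega>"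

text \<open>
  The Gaussian has width \<open>sqrt a\<close> and is not normalised, so that the local energy increases with \<open>a\<close>.
\<close>

definition local_energy :: "'a::euclidean_space measure \<Rightarrow> ('a \<Rightarrow> complex) \<Rightarrow> real \<Rightarrow> 'a \<Rightarrow> ennreal" where
  "local_energy \<sigma> f a z = (\<integral>\<^sup>+x. ennreal ((cmod (sphere_ft \<sigma> f x))\<^sup>2 * gauss a (x - z)) \<partial>lborel)"

text \<open>
  The quadratic form to which both the local energy and the integral over all packets reduce.
\<close>

definition gauss_form :: "'a::euclidean_space measure \<Rightarrow> ('a \<Rightarrow> complex) \<Rightarrow> real \<Rightarrow> 'a \<Rightarrow> real" where
  "gauss_form \<sigma> f a z = Re (\<integral>(\<omega>, \<omega>'). (cis (-2*pi*(z \<bullet> (\<omega> - \<omega>'))) * exp (-pi * a * (norm (\<omega> - \<omega>'))\<^sup>2))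
      * (f \<omega> * cnj (f \<omega>')) \<partial>(\<sigma> \<Otimes>\<^sub>M \<sigma>))"

text \<open>
  Only two features of surface measure matter until the Schur test: it is finite, and its points have norm one.  The
  \<open>\<sigma>\<close>-algebra may be that of the sphere or of the whole space.
\<close>

locale sphere_carried = finite_measure \<sigma> for \<sigma> :: "'a::euclidean_space measure" +
  assumes measurable_point: "(\<lambda>\<omega>. \<omega>) \<in> \<sigma> \<rightarrow>\<^sub>M borel"
    and norm_point: "\<omega> \<in> space \<sigma> \<Longrightarrow> norm \<omega> = 1"
begin

abbreviation ft where "ft \<equiv> sphere_ft \<sigma>"
abbreviation dens where "dens f z \<equiv> ennreal ((cmod (sphere_ft \<sigma> f z))\<^sup>2)"
abbreviation energy where "energy \<equiv> local_energy \<sigma>"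

lemma integrable_bounded_mult:
  fixes m f :: "'a \<Rightarrow> complex"
  assumes f: "integrable \<sigma> f" and m: "m \<in> borel_measurable \<sigma>" and B: "\<And>\<omega>. \<omega> \<in> space \<sigma> \<Longrightarrow> cmod (m \<omega>) \<le> B"
  shows "integrable \<sigma> (\<lambda>\<omega>. m \<omega> * f \<omega>)"
proof (rule Bochner_Integration.integrable_bound[OF integrable_mult_right[OF f, of "of_real B"]])
  note [measurable] = m borel_measurable_integrable[OF f]
  show "(\<lambda>\<omega>. m \<omega> * f \<omega>) \<in> borel_measurable \<sigma>" by measurable
  show "AE \<omega> in \<sigma>. norm (m \<omega> * f \<omega>) \<le> norm (of_real B * f \<omega>)"
  proof (rule AE_I2)
    fix \<omega> assume "\<omega> \<in> space \<sigma>"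
    then have "cmod (m \<omega>) \<le> \<bar>B\<bar>" using B by fastforce
    then show "norm (m \<omega> * f \<omega>) \<le> norm (of_real B * f \<omega>)" by (simp add: norm_mult mult_right_mono)
  qed
qed

lemma measurable_packet [measurable (raw)]:
  assumes [measurable]: "f \<in> borel_measurable \<sigma>" "v \<in> borel_measurable M" "g \<in> M \<rightarrow>\<^sub>M \<sigma>"
  shows "(\<lambda>x. packet \<tau> (v x) f (g x)) \<in> borel_measurable M"
proof -
  have [measurable]: "(\<lambda>x. g x) \<in> borel_measurable M"
    using measurable_compose[OF assms(3) measurable_point] .
  show ?thesis unfolding packet_def by measurable
qed

lemma integrable_packet: 
  assumes f: "integrable \<sigma> f" and "\<tau> \<ge> 0" shows "integrable \<sigma> (packet \<tau> v f)"
  unfolding packet_def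
proof (rule integrable_bounded_mult[where B = 1, OF f])
  show "(\<lambda>\<omega>. complex_of_real (exp (-pi * \<tau> * (norm (\<omega> - v))\<^sup>2))) \<in> borel_measurable \<sigma>"
    by (rule measurable_compose[OF measurable_point]) measurable
qed (use assms in auto)

lemma measurable_sphere_ft:
  assumes F: "(\<lambda>(x, \<omega>). F x \<omega>) \<in> borel_measurable (M \<Otimes>\<^sub>M \<sigma>)" and [measurable]: "y \<in> borel_measurable M"
  shows "(\<lambda>x. ft (F x) (y x)) \<in> borel_measurable M"
proof -
  note F[measurable]
  have [measurable]: "(\<lambda>p. snd p) \<in> borel_measurable (M \<Otimes>\<^sub>M \<sigma>)"
    using measurable_compose[OF measurable_snd measurable_point] .
  have [measurable]: "(\<lambda>p. snd p) \<in> M \<Otimes>\<^sub>M \<sigma> \<rightarrow>\<^sub>M \<sigma>" by simp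
  have "(\<lambda>p. cis (-2*pi*(y (fst p) \<bullet> snd p)) * F (fst p) (snd p)) \<in> borel_measurable (M \<Otimes>\<^sub>M \<sigma>)"
    by measurable
  then show ?thesis unfolding sphere_ft_def
    by (intro borel_measurable_lebesgue_integral) (simp add: case_prod_beta')
qed

text \<open>
  The \<open>x\<close>-integral of the kernel is the transform of a Gaussian, evaluated at \<open>\<omega> - \<omega>'\<close>.
\<close>

lemma local_energy_eq_form:
  assumes f: "integrable \<sigma> f" and a: "a > 0"
  shows "energy f a z = ennreal (sqrt a ^ DIM('a) * gauss_form \<sigma> f a z)"
proof -
  define k where "k = (\<lambda>x \<omega>. cis (-2*pi*(x \<bullet> \<omega>)) * complex_of_real (gauss (2*a) (x - z)))"
  have sig: "sigma_finite_measure \<sigma>" by unfold_locales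
  have [measurable]: "(\<lambda>p. snd p) \<in> borel_measurable (lborel \<Otimes>\<^sub>M \<sigma>)"
    using measurable_compose[OF measurable_snd measurable_point] .
  have sq: "exp (-pi * t / (2*a)) * exp (-pi * t / (2*a)) = exp (-pi * t / a)" for t
    using a by (simp add: mult_exp_exp)
  have K: "(\<integral>x. k x \<omega> * cnj (k x \<omega>') \<partial>lborel) = of_real (sqrt a ^ DIM('a)) * (cis (-2*pi*(z \<bullet> (\<omega> - \<omega>'))) * exp (-pi * a * (norm (\<omega> - \<omega>'))\<^sup>2))" for \<omega> \<omega>'
  proof -
    have e: "k x \<omega> * cnj (k x \<omega>') = cis (-2*pi*(x \<bullet> (\<omega> - \<omega>'))) * gauss a (x - z)" for x
    proof -
      have "cis (-2*pi*(x \<bullet> \<omega>)) * cis (2*pi*(x \<bullet> \<omega>')) = cis (-2*pi*(x \<bullet> (\<omega> - \<omega>')))"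
        by (simp add: cis_mult inner_diff_right right_diff_distrib)
      then have "k x \<omega> * cnj (k x \<omega>') = cis (-2*pi*(x \<bullet> (\<omega> - \<omega>'))) * of_real (gauss (2*a) (x - z) * gauss (2*a) (x - z))"
        unfolding k_def by (simp add: cis_cnj mult_ac del: of_real_exp)
      then show ?thesis unfolding sq .
    qed
    show ?thesis unfolding e gaussian_fourier_shift(2)[OF a] by simp
  qed
  have "energy f a z = (\<integral>\<^sup>+x. ennreal ((cmod (\<integral>\<omega>. k x \<omega> * f \<omega> \<partial>\<sigma>))\<^sup>2) \<partial>lborel)"
    unfolding local_energy_def
  proof (rule nn_integral_cong, rule arg_cong[where f = ennreal])
    fix x
    have "(\<integral>\<omega>. k x \<omega> * f \<omega> \<partial>\<sigma>) = of_real (gauss (2*a) (x - z)) * ft f x"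
      unfolding sphere_ft_def k_def by (subst integral_mult_right_zero[symmetric]) (simp only: mult_ac)
    then show "(cmod (ft f x))\<^sup>2 * gauss a (x - z) = (cmod (\<integral>\<omega>. k x \<omega> * f \<omega> \<partial>\<sigma>))\<^sup>2"
      unfolding sq[symmetric] by (simp add: norm_mult power2_eq_square mult_ac del: of_real_exp)
  qed
  also have "\<dots> = ennreal (Re (\<integral>(\<omega>, \<omega>'). (\<integral>x. k x \<omega> * cnj (k x \<omega>') \<partial>lborel) * (f \<omega> * cnj (f \<omega>')) \<partial>(\<sigma> \<Otimes>\<^sub>M \<sigma>)))"
  proof (rule nn_integral_kernel_sq[OF lborel.sigma_finite_measure_axioms sig f])
    show "(\<lambda>(x, \<omega>). k x \<omega>) \<in> borel_measurable (lborel \<Otimes>\<^sub>M \<sigma>)" unfolding k_def by measurable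
    show "integrable lborel (\<lambda>x. (gauss (2*a) (x - z))\<^sup>2)"
      unfolding power2_eq_square[of "exp _"] sq by (rule gaussian_integral[OF a])
  qed (simp add: k_def norm_mult del: of_real_exp)
  also have "(\<integral>(\<omega>, \<omega>'). (\<integral>x. k x \<omega> * cnj (k x \<omega>') \<partial>lborel) * (f \<omega> * cnj (f \<omega>')) \<partial>(\<sigma> \<Otimes>\<^sub>M \<sigma>))
    = of_real (sqrt a ^ DIM('a)) * (\<integral>(\<omega>, \<omega>'). (cis (-2*pi*(z \<bullet> (\<omega> - \<omega>'))) * exp (-pi * a * (norm (\<omega> - \<omega>'))\<^sup>2))
      * (f \<omega> * cnj (f \<omega>')) \<partial>(\<sigma> \<Otimes>\<^sub>M \<sigma>))"
    unfolding K by (subst integral_mult_right_zero[symmetric]) (simp only: case_prod_beta' mult.assoc)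
  finally show ?thesis by (simp only: gauss_form_def times_complex.sel complex.sel Re_complex_of_real Im_complex_of_real) simp
qed

text \<open>
  By the parallelogram law \<open>\<bar>\<omega> - v\<bar>\<^sup>2 + \<bar>\<omega>' - v\<bar>\<^sup>2\<close> is \<open>\<bar>\<omega> - \<omega>'\<bar>\<^sup>2/2\<close> plus twice the squared distance of \<open>v\<close> from the midpoint, so
  integrating over \<open>v\<close> leaves a Gaussian in \<open>\<omega> - \<omega>'\<close>.
\<close>

lemma frame_eq_form:
  assumes f: "integrable \<sigma> f" and t: "\<tau> > 0"
  shows "(\<integral>\<^sup>+v. dens (packet \<tau> v f) z \<partial>lborel) = ennreal ((1 / sqrt (2*\<tau>)) ^ DIM('a) * gauss_form \<sigma> f (\<tau>/2) z)"
proof -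
  define k where "k = (\<lambda>v \<omega>. cis (-2*pi*(z \<bullet> \<omega>)) * complex_of_real (exp (-pi * \<tau> * (norm (\<omega> - v))\<^sup>2)))"
  have sig: "sigma_finite_measure \<sigma>" by unfold_locales
  have [measurable]: "(\<lambda>p. snd p) \<in> borel_measurable (lborel \<Otimes>\<^sub>M \<sigma>)"
    using measurable_compose[OF measurable_snd measurable_point] .
  have K: "(\<integral>v. k v \<omega> * cnj (k v \<omega>') \<partial>lborel) = of_real ((1 / sqrt (2*\<tau>)) ^ DIM('a)) * (cis (-2*pi*(z \<bullet> (\<omega> - \<omega>'))) * exp (-pi * (\<tau>/2) * (norm (\<omega> - \<omega>'))\<^sup>2))" for \<omega> \<omega>'
  proof -
    define m where "m = (\<omega> + \<omega>') /\<^sub>R 2"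
    have par: "(norm (\<omega> - v))\<^sup>2 + (norm (\<omega>' - v))\<^sup>2 = 2 * (norm (v - m))\<^sup>2 + (norm (\<omega> - \<omega>'))\<^sup>2 / 2" for v
      unfolding m_def power2_norm_eq_inner
      by (simp add: inner_diff_left inner_diff_right inner_add_left inner_add_right inner_commute field_simps)
    have e: "k v \<omega> * cnj (k v \<omega>') = cis (-2*pi*(z \<bullet> (\<omega> - \<omega>'))) * exp (-pi * (\<tau>/2) * (norm (\<omega> - \<omega>'))\<^sup>2) * of_real (gauss (1/(2*\<tau>)) (v - m))" for v
    proof -
      have "cis (-2*pi*(z \<bullet> \<omega>)) * cis (2*pi*(z \<bullet> \<omega>')) = cis (-2*pi*(z \<bullet> (\<omega> - \<omega>')))"
        by (simp add: cis_mult inner_diff_right right_diff_distrib)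
      moreover have "exp (-pi * \<tau> * (norm (\<omega> - v))\<^sup>2) * exp (-pi * \<tau> * (norm (\<omega>' - v))\<^sup>2)
        = exp (-pi * (\<tau>/2) * (norm (\<omega> - \<omega>'))\<^sup>2) * gauss (1/(2*\<tau>)) (v - m)"
      proof -
        have "-pi * \<tau> * (norm (\<omega> - v))\<^sup>2 + -pi * \<tau> * (norm (\<omega>' - v))\<^sup>2 = -pi * \<tau> * ((norm (\<omega> - v))\<^sup>2 + (norm (\<omega>' - v))\<^sup>2)"
          by (simp add: algebra_simps)
        also have "\<dots> = -pi * (\<tau>/2) * (norm (\<omega> - \<omega>'))\<^sup>2 + -pi * (norm (v - m))\<^sup>2 / (1/(2*\<tau>))"
          unfolding par by (simp add: algebra_simps)
        finally show ?thesis by (simp only: mult_exp_exp)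
      qed
      ultimately show ?thesis unfolding k_def
        by (simp add: cis_cnj mult_ac del: of_real_exp flip: of_real_mult)
    qed
    have m: "(\<integral>v. complex_of_real (gauss (1/(2*\<tau>)) (v - m)) \<partial>lborel) = of_real (sqrt (1/(2*\<tau>)) ^ DIM('a))"
      unfolding integral_complex_of_real using gaussian_integral(2)[of "1/(2*\<tau>)" m] t by (simp del: of_real_exp)
    show ?thesis unfolding e by (subst integral_mult_right_zero, subst m) (simp add: real_sqrt_divide)
  qed
  have eq: "ft (packet \<tau> v f) z = (\<integral>\<omega>. k v \<omega> * f \<omega> \<partial>\<sigma>)" for v
    by (simp add: sphere_ft_def packet_def k_def mult.assoc)
  have "(\<integral>\<^sup>+v. dens (packet \<tau> v f) z \<partial>lborel) =
    ennreal (Re (\<integral>(\<omega>, \<omega>'). (\<integral>v. k v \<omega> * cnj (k v \<omega>') \<partial>lborel) * (f \<omega> * cnj (f \<omega>')) \<partial>(\<sigma> \<Otimes>\<^sub>M \<sigma>)))"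
    unfolding eq
  proof (rule nn_integral_kernel_sq[OF lborel.sigma_finite_measure_axioms sig f])
    show "(\<lambda>(v, \<omega>). k v \<omega>) \<in> borel_measurable (lborel \<Otimes>\<^sub>M \<sigma>)" unfolding k_def by measurable
    have sq: "(exp (pi * \<tau>) * gauss (2/\<tau>) (v - 0))\<^sup>2 = exp (2 * pi * \<tau>) * gauss (1/\<tau>) (v - 0)" for v :: 'a
      by (simp add: power2_eq_square mult_exp_exp)
    show "integrable lborel (\<lambda>v::'a. (exp (pi * \<tau>) * gauss (2/\<tau>) (v - 0))\<^sup>2)"
      unfolding sq using t by (intro integrable_mult_right gaussian_integral) simp
    fix v \<omega> assume "\<omega> \<in> space \<sigma>"
    then have "norm \<omega> = 1" by (rule norm_point)
    have "(norm v)\<^sup>2 \<le> 2 * (norm (\<omega> - v))\<^sup>2 + 2 * (norm \<omega>)\<^sup>2"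
    proof -
      have "2 * (norm (\<omega> - v))\<^sup>2 + 2 * (norm \<omega>)\<^sup>2 - (norm v)\<^sup>2 = (norm (2 *\<^sub>R \<omega> - v))\<^sup>2"
        unfolding power2_norm_eq_inner by (simp add: inner_diff_left inner_diff_right inner_commute algebra_simps)
      then show ?thesis by (smt (verit) zero_le_power2)
    qed
    then have "pi * \<tau> * (norm v)\<^sup>2 \<le> pi * \<tau> * (2 * (norm (\<omega> - v))\<^sup>2 + 2)"
      using t \<open>norm \<omega> = 1\<close> by (intro mult_left_mono) auto
    then have "-pi * \<tau> * (norm (\<omega> - v))\<^sup>2 \<le> pi * \<tau> + -pi * (norm (v - 0))\<^sup>2 / (2/\<tau>)"
      by (simp add: algebra_simps)
    then show "cmod (k v \<omega>) \<le> exp (pi * \<tau>) * gauss (2/\<tau>) (v - 0)"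
      by (simp add: k_def norm_mult mult_exp_exp del: of_real_exp)
  qed
  also have "(\<integral>(\<omega>, \<omega>'). (\<integral>v. k v \<omega> * cnj (k v \<omega>') \<partial>lborel) * (f \<omega> * cnj (f \<omega>')) \<partial>(\<sigma> \<Otimes>\<^sub>M \<sigma>))
    = of_real ((1 / sqrt (2*\<tau>)) ^ DIM('a)) * (\<integral>(\<omega>, \<omega>'). (cis (-2*pi*(z \<bullet> (\<omega> - \<omega>'))) * exp (-pi * (\<tau>/2) * (norm (\<omega> - \<omega>'))\<^sup>2))
      * (f \<omega> * cnj (f \<omega>')) \<partial>(\<sigma> \<Otimes>\<^sub>M \<sigma>))"
    unfolding K by (subst integral_mult_right_zero[symmetric]) (simp only: case_prod_beta' mult.assoc)
  finally show ?thesis by (simp only: gauss_form_def times_complex.sel complex.sel Re_complex_of_real Im_complex_of_real) simp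
qed

end

lemma nn_integral_translate:
  fixes g :: "'a::euclidean_space \<Rightarrow> ennreal"
  assumes [measurable]: "g \<in> borel_measurable borel"
  shows "(\<integral>\<^sup>+x. g (z + x) \<partial>lborel) = (\<integral>\<^sup>+x. g x \<partial>lborel)"
proof -
  have "(\<integral>\<^sup>+x. g x \<partial>lborel) = (\<integral>\<^sup>+x. g x \<partial>distr lborel borel ((+) z))"
    by (simp only: lborel_distr_plus)
  then show ?thesis by (simp add: nn_integral_distr)
qed

lemma ennreal_absorb:
  fixes E A :: ennreal
  assumes "E \<le> A + ennreal (1/2) * E" "E < \<top>"
  shows "E \<le> 2 * A"
proof (cases A)
  case (real a)
  obtain e where e: "E = ennreal e" "e \<ge> 0" using assms(2) by (cases E) auto
  have "ennreal e \<le> ennreal a + ennreal (1/2) * ennreal e" using assms(1) e real by (simp only:)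
  also have "\<dots> = ennreal (a + 1/2 * e)"
    using e real by (simp only: ennreal_mult'[symmetric] ennreal_plus[symmetric] mult_nonneg_nonneg)
  finally have "e \<le> a + 1/2 * e" using e real by (subst (asm) ennreal_le_iff) auto
  then have "e \<le> 2 * a" by simp
  then have "ennreal e \<le> ennreal (2 * a)" by (rule ennreal_leI)
  then show ?thesis using e real by (simp add: ennreal_mult)
qed simp

context sphere_carried
begin

lemma measurable_sphere_ft_fixed [measurable (raw)]:
  assumes [measurable]: "f \<in> borel_measurable \<sigma>" "y \<in> borel_measurable M"
  shows "(\<lambda>x. ft f (y x)) \<in> borel_measurable M"
  by (rule measurable_sphere_ft[of "\<lambda>_. f" M y]) measurable

lemma measurable_sphere_ft_packet [measurable (raw)]:
  assumes [measurable]: "f \<in> borel_measurable \<sigma>" "v \<in> borel_measurable M" "y \<in> borel_measurable M"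
  shows "(\<lambda>x. ft (packet \<tau> (v x) f) (y x)) \<in> borel_measurable M"
proof (rule measurable_sphere_ft)
  show "(\<lambda>(x, \<omega>). packet \<tau> (v x) f \<omega>) \<in> borel_measurable (M \<Otimes>\<^sub>M \<sigma>)"
    unfolding case_prod_beta' by measurable
qed measurable

lemma sphere_ft_cong:
  "(\<And>\<omega>. \<omega> \<in> space \<sigma> \<Longrightarrow> f \<omega> = g \<omega>) \<Longrightarrow> ft f z = ft g z"
  unfolding sphere_ft_def by (intro Bochner_Integration.integral_cong) auto

lemma sphere_ft_scale: "ft (\<lambda>\<omega>. c * f \<omega>) z = c * ft f z"
  unfolding sphere_ft_def by (subst integral_mult_right_zero[symmetric]) (simp only: mult_ac)

lemma local_energy_mono:
  assumes "0 < a" "a \<le> b" shows "energy f a z \<le> energy f b z"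
  unfolding local_energy_def
  by (intro nn_integral_mono ennreal_leI mult_left_mono) (use assms in \<open>auto intro!: divide_left_mono mult_nonneg_nonneg\<close>)

lemma local_energy_finite: "integrable \<sigma> f \<Longrightarrow> a > 0 \<Longrightarrow> energy f a z < \<top>"
  by (simp add: local_energy_eq_form)

text \<open>
  The exact replacement for the almost orthogonality of wave packets; it holds at every point \<open>z\<close>.
\<close>

lemma frame_eq_energy:
  assumes f: "integrable \<sigma> f" and t: "\<tau> > 0"
  shows "energy f (\<tau>/2) z = ennreal (\<tau> ^ DIM('a)) * (\<integral>\<^sup>+v. dens (packet \<tau> v f) z \<partial>lborel)"
proof -
  have "\<tau> * (1 / sqrt (2*\<tau>)) = sqrt (\<tau>/2)"
  proof -
    have "sqrt (2*\<tau>) * sqrt (\<tau>/2) = \<tau>" using t by (simp flip: real_sqrt_mult)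
    moreover have "\<tau> * (1 / s) = r" if "s * r = \<tau>" "s \<noteq> 0" for s r using that by auto
    ultimately show ?thesis using t by simp
  qed
  then have "\<tau> ^ DIM('a) * (1 / sqrt (2*\<tau>)) ^ DIM('a) = sqrt (\<tau>/2) ^ DIM('a)" by (simp only: flip: power_mult_distrib)
  then have "ennreal (sqrt (\<tau>/2) ^ DIM('a) * gauss_form \<sigma> f (\<tau>/2) z)
      = ennreal (\<tau> ^ DIM('a) * ((1 / sqrt (2*\<tau>)) ^ DIM('a) * gauss_form \<sigma> f (\<tau>/2) z))"
    by (simp only: mult.assoc[symmetric])
  also have "\<dots> = ennreal (\<tau> ^ DIM('a)) * ennreal ((1 / sqrt (2*\<tau>)) ^ DIM('a) * gauss_form \<sigma> f (\<tau>/2) z)"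
    using t by (intro ennreal_mult') simp
  finally show ?thesis
    using t by (simp only: local_energy_eq_form[OF f] frame_eq_form[OF f] half_gt_zero)
qed

text \<open>
  A multiplier that is a superposition of characters acts on the extension as a superposition of translations; the square
  is then bounded by the Cauchy-Schwarz inequality with respect to \<open>\<bar>\<kappa>\<bar>\<close>.
\<close>

lemma superposition_bound:
  fixes \<kappa> :: "'b \<Rightarrow> complex" and s :: "'b \<Rightarrow> 'a"
  assumes f: "integrable \<sigma> f" and N: "sigma_finite_measure N" and \<kappa>: "integrable N \<kappa>"
    and s[measurable]: "s \<in> N \<rightarrow>\<^sub>M borel"
    and m: "\<And>\<omega>. \<omega> \<in> space \<sigma> \<Longrightarrow> m \<omega> = (\<integral>n. \<kappa> n * cis (-2*pi*(s n \<bullet> \<omega>)) \<partial>N)"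
  shows "dens (\<lambda>\<omega>. m \<omega> * f \<omega>) z
    \<le> (\<integral>\<^sup>+n. ennreal (cmod (\<kappa> n)) \<partial>N) * (\<integral>\<^sup>+n. ennreal (cmod (\<kappa> n) * (cmod (ft f (z + s n)))\<^sup>2) \<partial>N)"
proof -
  interpret N: sigma_finite_measure N by fact
  interpret NS: pair_sigma_finite N \<sigma> ..
  have sig: "sigma_finite_measure \<sigma>" by unfold_locales
  have [measurable]: "f \<in> borel_measurable \<sigma>" "\<kappa> \<in> borel_measurable N" using f \<kappa> by auto
  have [measurable]: "(\<lambda>p. snd p) \<in> borel_measurable (N \<Otimes>\<^sub>M \<sigma>)"
    using measurable_compose[OF measurable_snd measurable_point] .
  have [measurable]: "(\<lambda>p. snd p) \<in> N \<Otimes>\<^sub>M \<sigma> \<rightarrow>\<^sub>M \<sigma>" by simp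
  define J where "J = (\<lambda>n \<omega>. \<kappa> n * (cis (-2*pi*((z + s n) \<bullet> \<omega>)) * f \<omega>))"
  have J: "integrable (N \<Otimes>\<^sub>M \<sigma>) (\<lambda>(n, \<omega>). J n \<omega>)"
  proof (rule Bochner_Integration.integrable_bound[OF integrable_tensor(1)[OF N sig \<kappa> f]])
    show "(\<lambda>(n, \<omega>). J n \<omega>) \<in> borel_measurable (N \<Otimes>\<^sub>M \<sigma>)" unfolding J_def case_prod_beta' by measurable
  qed (auto simp: J_def norm_mult)
  have "ft (\<lambda>\<omega>. m \<omega> * f \<omega>) z = (\<integral>\<omega>. (\<integral>n. J n \<omega> \<partial>N) \<partial>\<sigma>)"
    unfolding sphere_ft_def
  proof (rule Bochner_Integration.integral_cong[OF refl])
    fix \<omega> assume w: "\<omega> \<in> space \<sigma>"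
    have "J n \<omega> = (cis (-2*pi*(z \<bullet> \<omega>)) * f \<omega>) * (\<kappa> n * cis (-2*pi*(s n \<bullet> \<omega>)))" for n
    proof -
      have "-2*pi*((z + s n) \<bullet> \<omega>) = -2*pi*(z \<bullet> \<omega>) + -2*pi*(s n \<bullet> \<omega>)" by (simp add: inner_add_left algebra_simps)
      then have "cis (-2*pi*((z + s n) \<bullet> \<omega>)) = cis (-2*pi*(z \<bullet> \<omega>)) * cis (-2*pi*(s n \<bullet> \<omega>))" by (simp only: cis_mult)
      then show ?thesis by (simp only: J_def mult_ac)
    qed
    then have "(\<integral>n. J n \<omega> \<partial>N) = (cis (-2*pi*(z \<bullet> \<omega>)) * f \<omega>) * m \<omega>"
      unfolding m[OF w] by (simp only: integral_mult_right_zero)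
    then show "cis (-2*pi*(z \<bullet> \<omega>)) * (m \<omega> * f \<omega>) = (\<integral>n. J n \<omega> \<partial>N)" by (simp only: mult_ac)
  qed
  also have "\<dots> = (\<integral>n. (\<integral>\<omega>. J n \<omega> \<partial>\<sigma>) \<partial>N)"
    using NS.integral_fst[OF J] NS.integral_snd[OF J] by (simp only:)
  also have "\<dots> = (\<integral>n. \<kappa> n * ft f (z + s n) \<partial>N)"
    unfolding J_def sphere_ft_def by (simp only: integral_mult_right_zero)
  finally have eq: "ft (\<lambda>\<omega>. m \<omega> * f \<omega>) z = (\<integral>n. \<kappa> n * ft f (z + s n) \<partial>N)" .
  have "ennreal (cmod (\<integral>n. \<kappa> n * ft f (z + s n) \<partial>N)) \<le> (\<integral>\<^sup>+n. ennreal (cmod (\<kappa> n * ft f (z + s n))) \<partial>N)"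
    by (cases "integrable N (\<lambda>n. \<kappa> n * ft f (z + s n))")
       (auto intro: integral_norm_bound_ennreal simp: not_integrable_integral_eq)
  also have "\<dots> = (\<integral>\<^sup>+n. ennreal (sqrt (cmod (\<kappa> n))) * ennreal (sqrt (cmod (\<kappa> n)) * cmod (ft f (z + s n))) \<partial>N)"
    by (intro nn_integral_cong) (simp add: norm_mult flip: ennreal_mult mult.assoc)
  finally have "(ennreal (cmod (\<integral>n. \<kappa> n * ft f (z + s n) \<partial>N)))\<^sup>2 \<le> \<dots>\<^sup>2"
    by (rule power_mono) simp
  also have "\<dots> \<le> (\<integral>\<^sup>+n. (ennreal (sqrt (cmod (\<kappa> n))))\<^sup>2 \<partial>N) * (\<integral>\<^sup>+n. (ennreal (sqrt (cmod (\<kappa> n)) * cmod (ft f (z + s n))))\<^sup>2 \<partial>N)"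
    by (rule Cauchy_Schwarz_nn_integral) measurable
  finally show ?thesis
    unfolding eq by (simp add: ennreal_power power_mult_distrib)
qed

text \<open>
  The convolution kernels below need not be positive, but all are dominated by a multiple of an \<open>L\<^sup>1\<close>-normalised Gaussian of
  width \<open>sqrt \<tau>\<close>, which makes the right-hand side a local energy.
\<close>

lemma gaussian_majorant_bound:
  assumes f: "integrable \<sigma> f" and t: "\<tau> > 0" and A: "A \<ge> 0"
    and \<kappa>: "integrable lborel \<kappa>"
    and le: "\<And>x. cmod (\<kappa> x) \<le> A * (1 / sqrt \<tau>) ^ DIM('a) * gauss \<tau> x"
    and m: "\<And>\<omega>. \<omega> \<in> space \<sigma> \<Longrightarrow> m \<omega> = (\<integral>x. \<kappa> x * cis (-2*pi*(x \<bullet> \<omega>)) \<partial>lborel)"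
  shows "dens (\<lambda>\<omega>. m \<omega> * f \<omega>) z \<le> ennreal (A\<^sup>2 * (1 / sqrt \<tau>) ^ DIM('a)) * energy f \<tau> z"
proof -
  have [measurable]: "f \<in> borel_measurable \<sigma>" using f by auto
  define c where "c = (1 / sqrt \<tau>) ^ DIM('a)"
  have c: "c > 0" "c * sqrt \<tau> ^ DIM('a) = 1" using t by (auto simp: c_def simp flip: power_mult_distrib)
  define h where "h = (\<lambda>x::'a. A * c * gauss \<tau> (x - 0))"
  have le': "cmod (\<kappa> x) \<le> h x" for x using le[of x] by (simp add: h_def c_def)
  have 1: "(\<integral>\<^sup>+x. ennreal (cmod (\<kappa> x)) \<partial>lborel) \<le> ennreal A"
  proof -
    have "(\<integral>\<^sup>+x. ennreal (cmod (\<kappa> x)) \<partial>lborel) \<le> (\<integral>\<^sup>+x. ennreal (A * c) * ennreal (gauss \<tau> (x - (0::'a))) \<partial>lborel)"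
    proof (rule nn_integral_mono)
      fix x
      have "ennreal (cmod (\<kappa> x)) \<le> ennreal ((A * c) * gauss \<tau> (x - 0))"
        using le'[of x] by (intro ennreal_leI) (simp add: h_def)
      then show "ennreal (cmod (\<kappa> x)) \<le> ennreal (A * c) * ennreal (gauss \<tau> (x - 0))"
        using A c by (simp add: ennreal_mult')
    qed
    also have "\<dots> = ennreal (A * c) * ennreal (sqrt \<tau> ^ DIM('a))"
      by (subst nn_integral_cmult) (simp_all only: gaussian_integral(3)[OF t], measurable)
    also have "\<dots> = ennreal A" using A c t by (simp add: mult.assoc flip: ennreal_mult')
    finally show ?thesis .
  qed
  have 2: "(\<integral>\<^sup>+x. ennreal (cmod (\<kappa> x) * (cmod (ft f (z + x)))\<^sup>2) \<partial>lborel) \<le> ennreal (A * c) * energy f \<tau> z"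
  proof -
    have "(\<integral>\<^sup>+x. ennreal (cmod (\<kappa> x) * (cmod (ft f (z + x)))\<^sup>2) \<partial>lborel)
      \<le> (\<integral>\<^sup>+x. ennreal (A * c) * ennreal ((cmod (ft f (z + x)))\<^sup>2 * gauss \<tau> ((z + x) - z)) \<partial>lborel)"
    proof (rule nn_integral_mono)
      fix x
      have "cmod (\<kappa> x) * (cmod (ft f (z + x)))\<^sup>2 \<le> h x * (cmod (ft f (z + x)))\<^sup>2"
        by (rule mult_right_mono[OF le']) simp
      then have "ennreal (cmod (\<kappa> x) * (cmod (ft f (z + x)))\<^sup>2) \<le> ennreal ((A * c) * ((cmod (ft f (z + x)))\<^sup>2 * gauss \<tau> ((z + x) - z)))"
        by (intro ennreal_leI) (simp add: h_def mult_ac)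
      then show "ennreal (cmod (\<kappa> x) * (cmod (ft f (z + x)))\<^sup>2) \<le> ennreal (A * c) * ennreal ((cmod (ft f (z + x)))\<^sup>2 * gauss \<tau> ((z + x) - z))"
        using A c by (simp add: ennreal_mult')
    qed
    also have "\<dots> = ennreal (A * c) * (\<integral>\<^sup>+x. ennreal ((cmod (ft f (z + x)))\<^sup>2 * gauss \<tau> ((z + x) - z)) \<partial>lborel)"
      by (rule nn_integral_cmult) measurable
    also have "(\<integral>\<^sup>+x. ennreal ((cmod (ft f (z + x)))\<^sup>2 * gauss \<tau> ((z + x) - z)) \<partial>lborel) = energy f \<tau> z"
      unfolding local_energy_def by (rule nn_integral_translate) measurable
    finally show ?thesis .
  qed
  have "dens (\<lambda>\<omega>. m \<omega> * f \<omega>) z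
    \<le> (\<integral>\<^sup>+x. ennreal (cmod (\<kappa> x)) \<partial>lborel) * (\<integral>\<^sup>+x. ennreal (cmod (\<kappa> x) * (cmod (ft f (z + x)))\<^sup>2) \<partial>lborel)"
    by (rule superposition_bound[OF f lborel.sigma_finite_measure_axioms \<kappa> _ m]) measurable
  also have "\<dots> \<le> ennreal A * (ennreal (A * c) * energy f \<tau> z)"
    by (intro mult_mono 1 2) auto
  also have "\<dots> = ennreal (A\<^sup>2 * c) * energy f \<tau> z"
    using A c by (simp add: power2_eq_square mult.assoc[symmetric] flip: ennreal_mult')
  finally show ?thesis by (simp only: c_def)
qed

lemma gaussian_multiplier:
  fixes u \<omega> :: 'a
  assumes t: "\<tau> > 0"
  defines "\<kappa> \<equiv> \<lambda>x::'a. complex_of_real ((1 / sqrt \<tau>) ^ DIM('a)) * (cis (-2*pi*(x \<bullet> (- u))) * gauss \<tau> x)"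
  shows "of_real (exp (-pi * \<tau> * (norm (\<omega> - u))\<^sup>2)) = (\<integral>x. \<kappa> x * cis (-2*pi*(x \<bullet> \<omega>)) \<partial>lborel)"
proof -
  define c where "c = (1 / sqrt \<tau>) ^ DIM('a)"
  have c: "c * sqrt \<tau> ^ DIM('a) = 1" using t by (auto simp: c_def simp flip: power_mult_distrib)
  have "\<kappa> x * cis (-2*pi*(x \<bullet> \<omega>)) = of_real c * (cis (-2*pi*(x \<bullet> (\<omega> - u))) * gauss \<tau> x)" for x
  proof -
    have "cis (-2*pi*(x \<bullet> (\<omega> - u))) = cis (-2*pi*(x \<bullet> (- u))) * cis (-2*pi*(x \<bullet> \<omega>))"
      by (simp add: cis_mult inner_diff_right algebra_simps)
    then show ?thesis by (simp only: \<kappa>_def c_def mult_ac)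
  qed
  then have "(\<integral>x. \<kappa> x * cis (-2*pi*(x \<bullet> \<omega>)) \<partial>lborel) = of_real c * of_real (sqrt \<tau> ^ DIM('a) * exp (-pi * \<tau> * (norm (\<omega> - u))\<^sup>2))"
    by (simp only: integral_mult_right_zero gaussian_fourier(2)[OF t])
  also have "\<dots> = of_real ((c * sqrt \<tau> ^ DIM('a)) * exp (-pi * \<tau> * (norm (\<omega> - u))\<^sup>2))"
    by (simp only: mult.assoc flip: of_real_mult)
  finally show ?thesis unfolding c by simp
qed

lemma packet_le_energy:
  assumes f: "integrable \<sigma> f" and t: "\<tau> > 0"
  shows "dens (packet \<tau> u f) z \<le> ennreal ((1 / sqrt \<tau>) ^ DIM('a)) * energy f \<tau> z"
proof -
  define \<kappa> where "\<kappa> = (\<lambda>x::'a. complex_of_real ((1 / sqrt \<tau>) ^ DIM('a)) * (cis (-2*pi*(x \<bullet> (- u))) * gauss \<tau> x))"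
  have "dens (\<lambda>\<omega>. complex_of_real (exp (-pi * \<tau> * (norm (\<omega> - u))\<^sup>2)) * f \<omega>) z
    \<le> ennreal (1\<^sup>2 * (1 / sqrt \<tau>) ^ DIM('a)) * energy f \<tau> z"
  proof (rule gaussian_majorant_bound[OF f t])
    show "integrable lborel \<kappa>" unfolding \<kappa>_def by (intro integrable_mult_right gaussian_fourier(1) t)
    show "cmod (\<kappa> x) \<le> 1 * (1 / sqrt \<tau>) ^ DIM('a) * gauss \<tau> x" for x
      using t by (simp add: \<kappa>_def norm_mult norm_power norm_divide del: of_real_exp of_real_power)
    show "of_real (exp (-pi * \<tau> * (norm (\<omega> - u))\<^sup>2)) = (\<integral>x. \<kappa> x * cis (-2*pi*(x \<bullet> \<omega>)) \<partial>lborel)" for \<omega>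
      unfolding \<kappa>_def by (rule gaussian_multiplier[OF t])
  qed simp
  then show ?thesis by (simp add: packet_def[abs_def])
qed

text \<open>
  The packet of width parameter one centred at the origin is a constant multiple of \<open>f\<close>, since \<open>\<bar>\<omega>\<bar> = 1\<close>.
\<close>

lemma pointwise_le_energy:
  assumes f: "integrable \<sigma> f"
  shows "dens f z \<le> ennreal (exp (2*pi)) * energy f 1 z"
proof -
  have "ft (packet 1 0 f) z = of_real (exp (-pi)) * ft f z"
    unfolding sphere_ft_scale[symmetric] by (rule sphere_ft_cong) (simp add: packet_def norm_point)
  then have "ennreal ((exp (-pi))\<^sup>2 * (cmod (ft f z))\<^sup>2) \<le> energy f 1 z"
    using packet_le_energy[OF f, of 1 0 z] by (simp add: norm_mult power_mult_distrib del: of_real_exp)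
  then have "ennreal (exp (2*pi)) * ennreal ((exp (-pi))\<^sup>2 * (cmod (ft f z))\<^sup>2) \<le> ennreal (exp (2*pi)) * energy f 1 z"
    by (rule mult_left_mono) simp
  moreover have "exp (2*pi) * ((exp (-pi))\<^sup>2 * (cmod (ft f z))\<^sup>2) = (cmod (ft f z))\<^sup>2"
    by (simp add: mult_exp_exp flip: exp_double mult.assoc)
  ultimately show ?thesis by (simp flip: ennreal_mult')
qed

text \<open>
  On the sphere \<open>\<tau> \<bar>\<omega> - v\<bar>\<^sup>2 = (\<tau>/2) \<bar>\<omega> - 2 v\<bar>\<^sup>2 + \<tau> (1/2 - \<bar>v\<bar>\<^sup>2)\<close>.  So a packet centred well inside the sphere is an
  exponentially small multiple of a packet of half the parameter.
\<close>

lemma inner_packet_le_energy: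
  assumes f: "integrable \<sigma> f" and t: "\<tau> > 0" and v: "norm v \<le> 1/2"
  shows "dens (packet \<tau> v f) z
    \<le> ennreal (exp (-pi*\<tau>/2) * (1 / sqrt (\<tau>/2)) ^ DIM('a)) * energy f (\<tau>/2) z"
proof -
  define c where "c = exp (-pi*\<tau>*(1/2 - (norm v)\<^sup>2))"
  have p: "packet \<tau> v f \<omega> = of_real c * packet (\<tau>/2) (2 *\<^sub>R v) f \<omega>" if "\<omega> \<in> space \<sigma>" for \<omega>
  proof -
    have "\<omega> \<bullet> \<omega> = 1" using norm_point[OF that] by (simp add: norm_eq_1)
    then have "-pi * \<tau> * (norm (\<omega> - v))\<^sup>2 = -pi*\<tau>*(1/2 - (norm v)\<^sup>2) + -pi * (\<tau>/2) * (norm (\<omega> - 2 *\<^sub>R v))\<^sup>2"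
      unfolding power2_norm_eq_inner by (simp add: inner_diff_left inner_diff_right inner_commute algebra_simps)
    then show ?thesis by (simp only: packet_def c_def exp_add of_real_mult mult.assoc)
  qed
  have "ft (packet \<tau> v f) z = of_real c * ft (packet (\<tau>/2) (2 *\<^sub>R v) f) z"
    unfolding sphere_ft_scale[symmetric] by (rule sphere_ft_cong) (rule p)
  then have "dens (packet \<tau> v f) z = ennreal (c\<^sup>2) * dens (packet (\<tau>/2) (2 *\<^sub>R v) f) z"
    by (simp add: norm_mult power_mult_distrib flip: ennreal_mult')
  also have "\<dots> \<le> ennreal (exp (-pi*\<tau>/2)) * (ennreal ((1 / sqrt (\<tau>/2)) ^ DIM('a)) * energy f (\<tau>/2) z)"
  proof (intro mult_mono packet_le_energy f ennreal_leI)
    have "(norm v)\<^sup>2 \<le> (1/2)\<^sup>2" using v by (intro power_mono) auto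
    then have "pi*\<tau> * (norm v)\<^sup>2 \<le> pi*\<tau> * (1/4)" using t by (intro mult_left_mono) (auto simp: power2_eq_square)
    then have "2 * (-pi*\<tau>*(1/2 - (norm v)\<^sup>2)) \<le> -pi*\<tau>/2" by (simp add: algebra_simps)
    then show "c\<^sup>2 \<le> exp (-pi*\<tau>/2)" unfolding c_def by (simp flip: exp_double)
  qed (use t in auto)
  finally show ?thesis by (simp add: ennreal_mult' mult.assoc)
qed

text \<open>
  By the preceding bound the packets with \<open>\<bar>v\<bar> < 1/2\<close> contribute at most half of the local energy once \<open>\<tau>\<close> is large, and this
  half can be absorbed because the local energy is finite.
\<close>

lemma outer_packets_dominate:
  "\<exists>\<tau>0\<ge>1. \<forall>\<tau>\<ge>\<tau>0. \<forall>f z. integrable \<sigma> f \<longrightarrow> energy f (\<tau>/2) z \<le>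
    ennreal (2 * \<tau> ^ DIM('a)) * (\<integral>\<^sup>+v. indicator {v. 1/2 \<le> norm v} v * dens (packet \<tau> v f) z \<partial>lborel)"
proof -
  define V where "V = measure lborel (ball (0::'a) (1/2))"
  have "((\<lambda>\<tau>. V * (\<tau> ^ DIM('a) / exp \<tau>)) \<longlongrightarrow> V * 0) at_top"
    by (intro tendsto_mult_left tendsto_power_div_exp_0)
  then have "eventually (\<lambda>\<tau>. V * (\<tau> ^ DIM('a) / exp \<tau>) < 1/2) at_top"
    by (rule order_tendstoD(2)) simp
  then obtain T where T: "\<And>\<tau>. \<tau> \<ge> T \<Longrightarrow> V * (\<tau> ^ DIM('a) / exp \<tau>) < 1/2"
    by (auto simp: eventually_at_top_linorder)
  show ?thesis
  proof (intro exI[of _ "max T 2"] conjI allI impI)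
    fix \<tau> and f :: "'a \<Rightarrow> complex" and z :: 'a
    assume \<tau>: "max T 2 \<le> \<tau>" and f: "integrable \<sigma> f"
    have [measurable]: "f \<in> borel_measurable \<sigma>" using f by auto
    have t: "\<tau> \<ge> 2" "V * (\<tau> ^ DIM('a) / exp \<tau>) < 1/2" using \<tau> T by auto
    define h where "h = (\<lambda>v. dens (packet \<tau> v f) z)"
    have [measurable]: "h \<in> borel_measurable borel" unfolding h_def by measurable
    have [measurable]: "ball (0::'a) (1/2) \<in> sets borel" "{v::'a. 1/2 \<le> norm v} \<in> sets borel" by auto
    define E where "E = energy f (\<tau>/2) z"
    define K where "K = exp (-pi*\<tau>/2) * (1 / sqrt (\<tau>/2)) ^ DIM('a)"
    have E: "E = ennreal (\<tau> ^ DIM('a)) * (\<integral>\<^sup>+v. h v \<partial>lborel)"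
      unfolding E_def h_def using frame_eq_energy[OF f] t by simp
    have em: "emeasure lborel (ball (0::'a) (1/2)) = ennreal V"
      unfolding V_def by (rule emeasure_eq_ennreal_measure) (use emeasure_lborel_ball_finite[of "0::'a" "1/2"] in \<open>simp add: less_top\<close>)
    have "(\<integral>\<^sup>+v. indicator (ball 0 (1/2)) v * h v \<partial>lborel) \<le> (\<integral>\<^sup>+v. ennreal K * E * indicator (ball (0::'a) (1/2)) v \<partial>lborel)"
      using inner_packet_le_energy[OF f, of \<tau> _ z] t unfolding K_def E_def h_def
      by (intro nn_integral_mono) (auto split: split_indicator)
    also have "\<dots> = ennreal K * E * ennreal V" by (subst nn_integral_cmult_indicator) (simp_all add: em)
    finally have in_le: "(\<integral>\<^sup>+v. indicator (ball 0 (1/2)) v * h v \<partial>lborel) \<le> ennreal K * E * ennreal V" .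
    have K: "\<tau> ^ DIM('a) * K * V \<le> 1/2"
    proof -
      have "exp (-pi*\<tau>/2) \<le> exp (-\<tau>)" using t pi_gt3 by simp
      moreover have "(1 / sqrt (\<tau>/2)) ^ DIM('a) \<le> 1" using t by (intro power_le_one) auto
      ultimately have "K \<le> exp (-\<tau>) * 1" unfolding K_def using t by (intro mult_mono) auto
      then have "\<tau> ^ DIM('a) * K * V \<le> \<tau> ^ DIM('a) * exp (-\<tau>) * V"
        using t by (intro mult_right_mono mult_left_mono) (auto simp: V_def)
      also have "\<dots> = V * (\<tau> ^ DIM('a) / exp \<tau>)" by (simp add: exp_minus field_simps)
      finally show ?thesis using t by linarith
    qed
    have split: "(\<integral>\<^sup>+v. h v \<partial>lborel) = (\<integral>\<^sup>+v. indicator {v. 1/2 \<le> norm v} v * h v \<partial>lborel) + (\<integral>\<^sup>+v. indicator (ball 0 (1/2)) v * h v \<partial>lborel)"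
      by (subst nn_integral_add[symmetric], measurable) (auto intro!: nn_integral_cong split: split_indicator)
    have "E \<le> ennreal (\<tau> ^ DIM('a)) * (\<integral>\<^sup>+v. indicator {v. 1/2 \<le> norm v} v * h v \<partial>lborel) + ennreal (\<tau> ^ DIM('a)) * (ennreal K * E * ennreal V)"
      by (subst E) (use in_le in \<open>simp add: split distrib_left add_left_mono mult_left_mono\<close>)
    also have "ennreal (\<tau> ^ DIM('a)) * (ennreal K * E * ennreal V) = ennreal (\<tau> ^ DIM('a) * K * V) * E"
      using t by (simp add: ennreal_mult' K_def V_def mult_ac)
    also have "\<dots> \<le> ennreal (1/2) * E" using K by (intro mult_right_mono ennreal_leI) auto
    finally have "E \<le> 2 * (ennreal (\<tau> ^ DIM('a)) * (\<integral>\<^sup>+v. indicator {v. 1/2 \<le> norm v} v * h v \<partial>lborel))"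
      using local_energy_finite[OF f, of "\<tau>/2" z] t unfolding E_def[symmetric] by (intro ennreal_absorb) (auto simp: add_left_mono)
    then show "energy f (\<tau>/2) z \<le> ennreal (2 * \<tau> ^ DIM('a)) * (\<integral>\<^sup>+v. indicator {v. 1/2 \<le> norm v} v * dens (packet \<tau> v f) z \<partial>lborel)"
      unfolding E_def h_def using t by (simp add: ennreal_mult' mult.assoc)
  qed simp
qed

text \<open>
  Schur's test for the Gaussian kernel.
\<close>

lemma local_energy_le_norm:
  assumes f: "integrable \<sigma> f" and a: "a > 0" and B0: "B \<ge> 0"
    and B: "\<And>\<omega>'. \<omega>' \<in> space \<sigma> \<Longrightarrow> (\<integral>\<^sup>+\<omega>. ennreal (exp (-pi * a * (norm (\<omega> - \<omega>'))\<^sup>2)) \<partial>\<sigma>) \<le> ennreal B"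
  shows "energy f a z \<le> ennreal (sqrt a ^ DIM('a) * B) * (\<integral>\<^sup>+\<omega>. ennreal ((cmod (f \<omega>))\<^sup>2) \<partial>\<sigma>)"
proof -
  let ?SS = "\<sigma> \<Otimes>\<^sub>M \<sigma>" and ?n = "\<lambda>\<omega>. ennreal ((cmod (f \<omega>))\<^sup>2)"
  interpret SS: pair_sigma_finite \<sigma> \<sigma> ..
  have [measurable]: "f \<in> borel_measurable \<sigma>" using f by auto
  have [measurable]: "(\<lambda>p. snd p) \<in> borel_measurable ?SS" "(\<lambda>p. fst p) \<in> borel_measurable ?SS"
    using measurable_compose[OF measurable_snd measurable_point] measurable_compose[OF measurable_fst measurable_point] .
  define g where "g = (\<lambda>(\<omega>::'a) \<omega>'. exp (-pi * a * (norm (\<omega> - \<omega>'))\<^sup>2))"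
  define J where "J = (\<lambda>(\<omega>, \<omega>'). (cis (-2*pi*(z \<bullet> (\<omega> - \<omega>'))) * exp (-pi * a * (norm (\<omega> - \<omega>'))\<^sup>2)) * (f \<omega> * cnj (f \<omega>')))"
  have [measurable]: "(\<lambda>(\<omega>, \<omega>'). ennreal (g \<omega> \<omega>')) \<in> borel_measurable ?SS"
    unfolding g_def case_prod_beta' by measurable
  have gs: "g \<omega> \<omega>' = g \<omega>' \<omega>" for \<omega> \<omega>' by (simp add: g_def norm_minus_commute)
  have "ennreal (gauss_form \<sigma> f a z) \<le> ennreal (cmod (\<integral>p. J p \<partial>?SS))"
    unfolding gauss_form_def J_def by (intro ennreal_leI complex_Re_le_cmod)
  also have "\<dots> \<le> (\<integral>\<^sup>+p. ennreal (cmod (J p)) \<partial>?SS)"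
    by (cases "integrable ?SS J") (auto intro: integral_norm_bound_ennreal simp: not_integrable_integral_eq)
  also have "\<dots> \<le> (\<integral>\<^sup>+p. (case p of (\<omega>, \<omega>') \<Rightarrow> ennreal (1/2) * (ennreal (g \<omega> \<omega>') * ?n \<omega> + ennreal (g \<omega> \<omega>') * ?n \<omega>')) \<partial>?SS)"
  proof (rule nn_integral_mono, clarify)
    fix \<omega> \<omega>'
    have am: "x * y \<le> 1/2 * (x\<^sup>2 + y\<^sup>2)" for x y :: real using sum_squares_bound[of x y] by simp
    have "cmod (J (\<omega>, \<omega>')) = g \<omega> \<omega>' * (cmod (f \<omega>) * cmod (f \<omega>'))"
      by (simp add: J_def g_def norm_mult del: of_real_exp)
    also have "\<dots> \<le> g \<omega> \<omega>' * (1/2 * ((cmod (f \<omega>))\<^sup>2 + (cmod (f \<omega>'))\<^sup>2))"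
      by (intro mult_left_mono am) (simp add: g_def)
    finally have le: "ennreal (cmod (J (\<omega>, \<omega>'))) \<le> ennreal (1/2 * (g \<omega> \<omega>' * (cmod (f \<omega>))\<^sup>2 + g \<omega> \<omega>' * (cmod (f \<omega>'))\<^sup>2))"
      by (intro ennreal_leI) (simp add: algebra_simps)
    show "ennreal (cmod (J (\<omega>, \<omega>'))) \<le> ennreal (1/2) * (ennreal (g \<omega> \<omega>') * ?n \<omega> + ennreal (g \<omega> \<omega>') * ?n \<omega>')"
    proof -
      have g0: "g \<omega> \<omega>' \<ge> 0" by (simp add: g_def)
      have "ennreal (1/2 * (p*u + p*w)) = ennreal (1/2) * (ennreal p * ennreal u + ennreal p * ennreal w)" if "p \<ge> 0" "u \<ge> 0" "w \<ge> 0" for p u w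
      proof -
        have "ennreal (p*u) = ennreal p * ennreal u" "ennreal (p*w) = ennreal p * ennreal w"
          by (rule ennreal_mult'[OF that(1)])+
        moreover have "ennreal (p*u + p*w) = ennreal (p*u) + ennreal (p*w)"
          by (rule ennreal_plus) (simp_all add: that)
        moreover have "ennreal (1/2 * (p*u + p*w)) = ennreal (1/2) * ennreal (p*u + p*w)" by (rule ennreal_mult') simp
        ultimately show ?thesis by (simp only:)
      qed
      from le this[OF g0 zero_le_power2 zero_le_power2] show ?thesis by (simp only:)
    qed
  qed
  also have "\<dots> = ennreal (1/2) * ((\<integral>\<^sup>+(\<omega>, \<omega>'). ennreal (g \<omega> \<omega>') * ?n \<omega> \<partial>?SS) + (\<integral>\<^sup>+(\<omega>, \<omega>'). ennreal (g \<omega> \<omega>') * ?n \<omega>' \<partial>?SS))"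
    unfolding case_prod_beta' by (subst nn_integral_cmult, measurable, subst nn_integral_add) auto
  also have "(\<integral>\<^sup>+(\<omega>, \<omega>'). ennreal (g \<omega> \<omega>') * ?n \<omega> \<partial>?SS) = (\<integral>\<^sup>+\<omega>. (\<integral>\<^sup>+\<omega>'. ennreal (g \<omega>' \<omega>) * ?n \<omega> \<partial>\<sigma>) \<partial>\<sigma>)"
    by (subst nn_integral_fst[symmetric]) (simp_all add: case_prod_beta' gs)
  also have "(\<integral>\<^sup>+(\<omega>, \<omega>'). ennreal (g \<omega> \<omega>') * ?n \<omega>' \<partial>?SS) = (\<integral>\<^sup>+\<omega>. (\<integral>\<^sup>+\<omega>'. ennreal (g \<omega>' \<omega>) * ?n \<omega> \<partial>\<sigma>) \<partial>\<sigma>)"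
    by (subst SS.nn_integral_snd[symmetric]) (simp_all add: case_prod_beta')
  also have "ennreal (1/2) * (X + X) = X" for X :: ennreal
  proof -
    have "ennreal (1/2) + ennreal (1/2) = 1" by (subst ennreal_plus[symmetric]) (simp_all del: ennreal_plus)
    then show ?thesis by (simp only: distrib_left distrib_right[symmetric] mult_1_left)
  qed
  also have "(\<integral>\<^sup>+\<omega>. (\<integral>\<^sup>+\<omega>'. ennreal (g \<omega>' \<omega>) * ?n \<omega> \<partial>\<sigma>) \<partial>\<sigma>) \<le> (\<integral>\<^sup>+\<omega>. ennreal B * ?n \<omega> \<partial>\<sigma>)"
  proof (rule nn_integral_mono)
    fix \<omega> assume w: "\<omega> \<in> space \<sigma>"
    have "(\<lambda>\<omega>'. ennreal (g \<omega>' \<omega>)) \<in> borel_measurable \<sigma>"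
      unfolding g_def by (rule measurable_compose[OF measurable_point]) measurable
    then have "(\<integral>\<^sup>+\<omega>'. ennreal (g \<omega>' \<omega>) * ?n \<omega> \<partial>\<sigma>) = (\<integral>\<^sup>+\<omega>'. ennreal (g \<omega>' \<omega>) \<partial>\<sigma>) * ?n \<omega>"
      by (rule nn_integral_multc)
    also have "\<dots> \<le> ennreal B * ?n \<omega>"
      using B[OF w] unfolding g_def by (intro mult_right_mono) auto
    finally show "(\<integral>\<^sup>+\<omega>'. ennreal (g \<omega>' \<omega>) * ?n \<omega> \<partial>\<sigma>) \<le> ennreal B * ?n \<omega>" .
  qed
  also have "\<dots> = ennreal B * (\<integral>\<^sup>+\<omega>. ?n \<omega> \<partial>\<sigma>)"
    by (rule nn_integral_cmult) measurable
  finally have "ennreal (sqrt a ^ DIM('a)) * ennreal (gauss_form \<sigma> f a z) \<le> ennreal (sqrt a ^ DIM('a)) * (ennreal B * (\<integral>\<^sup>+\<omega>. ?n \<omega> \<partial>\<sigma>))"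
    by (rule mult_left_mono) simp
  then show ?thesis using a B0 by (simp add: local_energy_eq_form[OF f a] ennreal_mult' mult.assoc)
qed

end

section \<open>Packets are constant along tubes\<close>

text \<open>
  The fundamental theorem of calculus for \<open>(1 - t) cis (\<theta> t)\<close> on the unit interval, in the form of a one-dimensional Sobolev
  inequality: a function is its average plus an average of its derivative.
\<close>

lemma one_eq_line_average:
  fixes \<theta> :: real
  shows "1 = (\<integral>t. indicator {0..1} t *\<^sub>R cis (\<theta> * t) \<partial>lborel) + \<theta> * (\<integral>t. indicator {0..1} t *\<^sub>R (- \<i> * (1 - t) * cis (\<theta> * t)) \<partial>lborel)"
proof -
  have i: "integrable lborel (\<lambda>t. indicator {0..1} t *\<^sub>R cis (\<theta> * t))"
    "integrable lborel (\<lambda>t. indicator {0..1} t *\<^sub>R (- \<i> * (1 - t) * cis (\<theta> * t)))"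
    by (intro borel_integrable_compact continuous_intros compact_Icc)+
  have "(\<integral>t. indicator {0..1} t *\<^sub>R (- \<theta> * \<i> * (1 - t) * cis (\<theta> * t) + cis (\<theta> * t)) \<partial>lborel) = (-(1 - of_real 1) * cis (\<theta> * 1)) - (-(1 - of_real 0) * cis (\<theta> * 0))"
  proof (rule integral_FTC_Icc)
    show "((\<lambda>t. - (1 - of_real t) * cis (\<theta> * t)) has_vector_derivative (- \<theta> * \<i> * (1 - t) * cis (\<theta> * t) + cis (\<theta> * t))) (at t within {0..1})" for t
    proof -
      have "((\<lambda>t. - (1 - t) * exp (\<i> * (\<theta> * t))) has_field_derivative (- \<theta> * \<i> * (1 - t) * cis (\<theta> * t) + cis (\<theta> * t))) (at (of_real t))"
        by (rule derivative_eq_intros refl | simp add: cis_conv_exp algebra_simps)+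
      from has_vector_derivative_real_field[OF this] show ?thesis
        by (simp add: cis_conv_exp o_def)
    qed
    show "continuous_on {0..1} (\<lambda>t. - \<theta> * \<i> * (1 - t) * cis (\<theta> * t) + cis (\<theta> * t))"
      by (intro continuous_intros)
  qed simp
  also have "(\<lambda>t. indicator {0..1} t *\<^sub>R (- \<theta> * \<i> * (1 - t) * cis (\<theta> * t) + cis (\<theta> * t)))
    = (\<lambda>t. indicator {0..1} t *\<^sub>R cis (\<theta> * t) + \<theta> * (indicator {0..1} t *\<^sub>R (- \<i> * (1 - t) * cis (\<theta> * t))))"
    by (auto simp: fun_eq_iff split: split_indicator)
  also have "(\<integral>t. indicator {0..1} t *\<^sub>R cis (\<theta> * t) + \<theta> * (indicator {0..1} t *\<^sub>R (- \<i> * (1 - t) * cis (\<theta> * t))) \<partial>lborel)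
     = (\<integral>t. indicator {0..1} t *\<^sub>R cis (\<theta> * t) \<partial>lborel) + \<theta> * (\<integral>t. indicator {0..1} t *\<^sub>R (- \<i> * (1 - t) * cis (\<theta> * t)) \<partial>lborel)"
    by (subst Bochner_Integration.integral_add[OF i(1) integrable_mult_right[OF i(2)]]) (simp only: integral_mult_right_zero)
  finally show ?thesis by simp
qed

context sphere_carried
begin

lemma sphere_ft_add:
  assumes f: "integrable \<sigma> f" and g: "integrable \<sigma> g"
  shows "ft (\<lambda>\<omega>. f \<omega> + g \<omega>) z = ft f z + ft g z"
proof -
  have "(\<lambda>\<omega>. cis (-2*pi*(z \<bullet> \<omega>))) \<in> borel_measurable \<sigma>"
    by (rule measurable_compose[OF measurable_point]) measurable
  then have "integrable \<sigma> (\<lambda>\<omega>. cis (-2*pi*(z \<bullet> \<omega>)) * h \<omega>)" if "integrable \<sigma> h" for h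
    by (rule integrable_bounded_mult[OF that, of _ 1]) simp
  then show ?thesis unfolding sphere_ft_def distrib_left using f g by simp
qed

lemma measurable_local_energy [measurable (raw)]:
  assumes [measurable]: "f \<in> borel_measurable \<sigma>" "y \<in> borel_measurable M"
  shows "(\<lambda>x. energy f a (y x)) \<in> borel_measurable M"
  unfolding local_energy_def by measurable

lemma measurable_local_energy_packet [measurable (raw)]:
  assumes [measurable]: "f \<in> borel_measurable \<sigma>" "v \<in> borel_measurable M" "y \<in> borel_measurable M"
  shows "(\<lambda>x. energy (packet \<tau> (v x) f) a (y x)) \<in> borel_measurable M"
  unfolding local_energy_def by measurable

lemma packet_le_half_energy:
  assumes f: "integrable \<sigma> f" and t: "\<tau> > 0"
  shows "dens (packet \<tau> v f) y
    \<le> ennreal (2 ^ DIM('a) * (1 / sqrt \<tau>) ^ DIM('a)) * energy (packet (\<tau>/2) v f) \<tau> y"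
proof -
  let ?g = "packet (\<tau>/2) v f"
  have g: "integrable \<sigma> ?g" using t by (intro integrable_packet f) simp
  have p: "packet \<tau> v f = packet (\<tau>/2) v ?g"
    by (auto simp: packet_def fun_eq_iff mult_exp_exp simp del: of_real_exp simp flip: of_real_mult mult.assoc)
  have "1 / sqrt (\<tau>/2) = sqrt 2 * (1 / sqrt \<tau>)" using t by (simp add: real_sqrt_divide)
  also have "\<dots> \<le> 2 * (1 / sqrt \<tau>)" using t real_sqrt_le_mono[of 2 4] by (intro mult_right_mono) auto
  finally have c: "(1 / sqrt (\<tau>/2)) ^ DIM('a) \<le> 2 ^ DIM('a) * (1 / sqrt \<tau>) ^ DIM('a)"
    using t unfolding power_mult_distrib[symmetric] by (intro power_mono) auto
  have "dens (packet \<tau> v f) y \<le> ennreal ((1 / sqrt (\<tau>/2)) ^ DIM('a)) * energy ?g (\<tau>/2) y"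
    unfolding p by (rule packet_le_energy[OF g]) (use t in simp)
  also have "\<dots> \<le> ennreal (2 ^ DIM('a) * (1 / sqrt \<tau>) ^ DIM('a)) * energy ?g \<tau> y"
    using t c by (intro mult_mono ennreal_leI local_energy_mono) auto
  finally show ?thesis .
qed

text \<open>
  The derivative along the tube multiplies a packet by \<open>\<pi> \<eta> \<bar>\<omega> - v\<bar>\<^sup>2\<close>.  Since \<open>\<eta>\<close> is at most of order \<open>\<tau>\<close>, half of the Gaussian
  factor of the packet makes up for this growth.
\<close>

lemma curvature_packet_le_half_energy:
  assumes f: "integrable \<sigma> f" and t: "\<tau> > 0" and \<eta>: "0 \<le> \<eta>" "\<eta> \<le> 2 * \<tau>"
  shows "dens (\<lambda>\<omega>. of_real (pi * \<eta> * (norm (\<omega> - v))\<^sup>2) * packet \<tau> v f \<omega>) y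
    \<le> ennreal ((2 * (real DIM('a) + 4) * 2 ^ DIM('a))\<^sup>2 * (1 / sqrt \<tau>) ^ DIM('a)) * energy (packet (\<tau>/2) v f) \<tau> y"
proof -
  let ?g = "packet (\<tau>/2) v f" and ?d = "DIM('a)"
  have g: "integrable \<sigma> ?g" using t by (intro integrable_packet f) simp
  define a where "a = \<tau>/2"
  have a: "a > 0" "\<tau> = 2 * a" using t by (auto simp: a_def)
  define c where "c = (\<eta>/\<tau>) * (1 / sqrt a) ^ ?d"
  have c: "0 \<le> c" "c \<le> 2 * (2 ^ ?d * (1 / sqrt \<tau>) ^ ?d)"
  proof -
    have "1 / sqrt a = sqrt 2 * (1 / sqrt \<tau>)" using t by (simp add: a_def real_sqrt_divide)
    also have "\<dots> \<le> 2 * (1 / sqrt \<tau>)" using t real_sqrt_le_mono[of 2 4] by (intro mult_right_mono) auto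
    finally have "(1 / sqrt a) ^ ?d \<le> 2 ^ ?d * (1 / sqrt \<tau>) ^ ?d"
      using a unfolding power_mult_distrib[symmetric] by (intro power_mono) auto
    moreover have "\<eta>/\<tau> \<le> 2" using \<eta> t by (simp add: field_simps)
    ultimately show "c \<le> 2 * (2 ^ ?d * (1 / sqrt \<tau>) ^ ?d)" unfolding c_def
      using a(1) by (intro mult_mono) auto
    show "0 \<le> c" using \<eta> t a(1) by (simp add: c_def)
  qed
  define G where "G = (\<lambda>\<xi> x::'a. cis (-2*pi*(x \<bullet> \<xi>)) * complex_of_real (gauss a x))"
  define \<kappa> where "\<kappa> = (\<lambda>x::'a. of_real c * ((?d - 2*pi*(norm x)\<^sup>2/a) * G (- v) x))"
  define m where "m = (\<lambda>\<omega>. of_real (pi * \<eta> * (norm (\<omega> - v))\<^sup>2) * complex_of_real (exp (-pi * (\<tau>/2) * (norm (\<omega> - v))\<^sup>2)))"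
  have p: "of_real (pi * \<eta> * (norm (\<omega> - v))\<^sup>2) * packet \<tau> v f \<omega> = m \<omega> * ?g \<omega>" for \<omega>
  proof -
    have "exp (-pi * \<tau> * (norm (\<omega> - v))\<^sup>2) = exp (-pi * (\<tau>/2) * (norm (\<omega> - v))\<^sup>2) * exp (-pi * (\<tau>/2) * (norm (\<omega> - v))\<^sup>2)"
      by (simp add: mult_exp_exp)
    then show ?thesis by (simp only: packet_def m_def of_real_mult mult_ac)
  qed
  have "dens (\<lambda>\<omega>. m \<omega> * ?g \<omega>) y \<le> ennreal ((2 * (real ?d + 4) * 2 ^ ?d)\<^sup>2 * (1 / sqrt \<tau>) ^ ?d) * energy ?g \<tau> y"
  proof (rule gaussian_majorant_bound[OF g t])
    show "integrable lborel \<kappa>" unfolding \<kappa>_def G_def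
      by (intro integrable_mult_right gaussian_second_moment(1) a)
    show "cmod (\<kappa> x) \<le> 2 * (real ?d + 4) * 2 ^ ?d * (1 / sqrt \<tau>) ^ ?d * gauss \<tau> x" for x
    proof -
      define r where "r = pi * (norm x)\<^sup>2 / a"
      have r: "r \<ge> 0" "-pi * (norm x)\<^sup>2 / a = -r" "-pi * (norm x)\<^sup>2 / \<tau> = -r/2" "2*pi*(norm x)\<^sup>2/a = 2 * r"
        using a by (auto simp: r_def)
      have "cmod (\<kappa> x) = c * (\<bar>?d - 2 * r\<bar> * exp (- r))"
      proof -
        have "\<kappa> x = of_real c * (of_real (?d - 2 * r) * (cis (-2*pi*(x \<bullet> (- v))) * of_real (exp (- r))))"
          unfolding \<kappa>_def G_def r(2) r(4)[symmetric] by (simp only: of_real_diff of_real_of_nat_eq of_real_divide of_real_mult of_real_power of_real_numeral)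
        then show ?thesis using c by (simp only: norm_mult norm_of_real norm_cis abs_exp_cancel abs_of_nonneg mult_1_left)
      qed
      also have "\<dots> \<le> c * ((real ?d + 4) * exp (- r / 2))"
      proof (rule mult_left_mono[OF _ c(1)])
        have "r/2 \<le> exp (r/2)" using exp_ge_add_one_self[of "r/2"] by linarith
        moreover have "1 \<le> exp (r/2)" using r by simp
        ultimately have "\<bar>?d - 2 * r\<bar> \<le> ?d * exp (r/2) + 4 * exp (r/2)"
          using r mult_left_mono[of 1 "exp (r/2)" "real ?d"] by linarith
        then have "\<bar>?d - 2 * r\<bar> * exp (- r) \<le> ((real ?d + 4) * exp (r/2)) * exp (- r)"
          by (intro mult_right_mono) (auto simp: distrib_right)
        also have "\<dots> = (real ?d + 4) * exp (- r / 2)" by (simp add: mult.assoc mult_exp_exp)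
        finally show "\<bar>?d - 2 * r\<bar> * exp (- r) \<le> (real ?d + 4) * exp (- r / 2)" .
      qed
      also have "\<dots> \<le> (2 * (2 ^ ?d * (1 / sqrt \<tau>) ^ ?d)) * ((real ?d + 4) * exp (- r / 2))"
        using c by (intro mult_right_mono) auto
      finally show ?thesis unfolding r(3) by (simp only: mult_ac)
    qed
    fix \<omega> :: 'a
    have "\<kappa> x * cis (-2*pi*(x \<bullet> \<omega>)) = of_real c * ((?d - 2*pi*(norm x)\<^sup>2/a) * G (\<omega> - v) x)" for x
    proof -
      have "cis (-2*pi*(x \<bullet> (\<omega> - v))) = cis (-2*pi*(x \<bullet> (- v))) * cis (-2*pi*(x \<bullet> \<omega>))"
        by (simp add: cis_mult inner_diff_right algebra_simps)
      then show ?thesis by (simp only: \<kappa>_def G_def mult_ac)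
    qed
    then have "(\<integral>x. \<kappa> x * cis (-2*pi*(x \<bullet> \<omega>)) \<partial>lborel) = complex_of_real (c * (2*pi*a*(norm (\<omega> - v))\<^sup>2 * (sqrt a ^ ?d * exp (-pi * a * (norm (\<omega> - v))\<^sup>2))))"
      by (simp only: integral_mult_right_zero gaussian_second_moment(2)[OF a(1)] G_def of_real_mult)
    also have "c * (2*pi*a*(norm (\<omega> - v))\<^sup>2 * (sqrt a ^ ?d * exp (-pi * a * (norm (\<omega> - v))\<^sup>2)))
      = ((1 / sqrt a) ^ ?d * sqrt a ^ ?d) * ((\<eta>/\<tau>) * (2*pi*a)) * (norm (\<omega> - v))\<^sup>2 * exp (-pi * a * (norm (\<omega> - v))\<^sup>2)"
      by (simp only: c_def mult_ac)
    also have "(1 / sqrt a) ^ ?d * sqrt a ^ ?d = 1" using a by (simp flip: power_mult_distrib)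
    also have "(\<eta>/\<tau>) * (2*pi*a) = pi * \<eta>" using a by simp
    finally show "m \<omega> = (\<integral>x. \<kappa> x * cis (-2*pi*(x \<bullet> \<omega>)) \<partial>lborel)" by (simp add: m_def a_def)
  qed simp
  then show ?thesis unfolding p .
qed

text \<open>
  The extension of a packet is essentially constant along segments of length \<open>\<rho> \<le> \<tau>\<close> in the direction of its centre.  For unit
  \<open>\<omega>\<close> the phase \<open>\<theta> \<omega> = \<pi> \<eta> \<bar>\<omega> - v\<bar>\<^sup>2\<close> is affine in \<open>\<omega>\<close>, so that \<open>cis (t \<theta>)\<close> is, up to a unimodular constant, the character
  of the translation by \<open>t \<eta> v\<close>.  The identity \<open>one_eq_line_average\<close> with this phase expresses the packet through
  translates of itself and of its product with \<open>\<theta>\<close>.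
\<close>

lemma packet_le_line_average:
  fixes v :: 'a and z :: 'a
  assumes f: "integrable \<sigma> f" and t: "\<tau> > 0" and v: "1/2 \<le> norm v" and \<rho>: "0 \<le> \<rho>" "\<rho> \<le> \<tau>"
  defines "e \<equiv> v /\<^sub>R norm v" and "C \<equiv> 4 * (2 * (real DIM('a) + 4) * 2 ^ DIM('a))\<^sup>2"
  shows "dens (packet \<tau> v f) z
    \<le> ennreal (C * (1 / sqrt \<tau>) ^ DIM('a)) *
      (\<integral>\<^sup>+t. indicator {0..1} t * energy (packet (\<tau>/2) v f) \<tau> (z + (t * \<rho>) *\<^sub>R e) \<partial>lborel)"
proof -
  let ?g = "packet (\<tau>/2) v f" and ?d = "DIM('a)" and ?y = "\<lambda>t. z + (t * \<rho>) *\<^sub>R e"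
  let ?\<phi> = "\<lambda>t \<omega>. -2*pi*(((t * \<rho>) *\<^sub>R e) \<bullet> \<omega>)"
  have [measurable]: "f \<in> borel_measurable \<sigma>" using f by auto
  \<comment> \<open>Translation by \<open>\<eta> v\<close> is translation by \<open>\<rho>\<close> in the direction of \<open>v\<close>; the bound \<open>1/2 \<le> norm v\<close> keeps \<open>\<eta>\<close> of order \<open>\<tau>\<close>.\<close>
  define \<eta> where "\<eta> = \<rho> / norm v"
  have \<eta>: "0 \<le> \<eta>" "\<eta> \<le> 2 * \<tau>" "\<eta> *\<^sub>R v = \<rho> *\<^sub>R e"
  proof -
    have v0: "norm v > 0" using v by linarith
    show "0 \<le> \<eta>" using \<rho> by (simp add: \<eta>_def)
    have "\<rho> * 1 \<le> \<tau> * (2 * norm v)" using \<rho> v t by (intro mult_mono) auto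
    then show "\<eta> \<le> 2 * \<tau>" using v0 by (simp add: \<eta>_def field_simps)
    show "\<eta> *\<^sub>R v = \<rho> *\<^sub>R e" by (simp add: \<eta>_def e_def divide_inverse)
  qed
  define \<theta> where "\<theta> = (\<lambda>\<omega>. pi * \<eta> * (norm (\<omega> - v))\<^sup>2)"
  define p where "p = packet \<tau> v f"
  define p1 where "p1 = (\<lambda>\<omega>. of_real (\<theta> \<omega>) * p \<omega>)"
  have ip: "integrable \<sigma> p" unfolding p_def using t by (intro integrable_packet f) simp
  have ip1: "integrable \<sigma> p1" unfolding p1_def
  proof (rule integrable_bounded_mult[OF ip])
    show "(\<lambda>\<omega>. complex_of_real (\<theta> \<omega>)) \<in> borel_measurable \<sigma>"
      unfolding \<theta>_def by (rule measurable_compose[OF measurable_point]) measurable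
    fix \<omega> assume "\<omega> \<in> space \<sigma>"
    then have "norm (\<omega> - v) \<le> 1 + norm v" using norm_point norm_triangle_ineq4[of \<omega> v] by simp
    then have "(norm (\<omega> - v))\<^sup>2 \<le> (1 + norm v)\<^sup>2" by (intro power_mono) auto
    then show "cmod (complex_of_real (\<theta> \<omega>)) \<le> pi * \<eta> * (1 + norm v)\<^sup>2"
      unfolding norm_of_real using \<eta> by (simp add: \<theta>_def abs_mult mult_left_mono)
  qed
  define c where "c = (\<lambda>t. cis (pi * \<eta> * (1 + (norm v)\<^sup>2) * t))"
  have c1: "cmod (c t) = 1" for t by (simp add: c_def)
  have ph: "cis (\<theta> \<omega> * t) = c t * cis (?\<phi> t \<omega>)" if "\<omega> \<in> space \<sigma>" for \<omega> t
  proof -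
    have "\<omega> \<bullet> \<omega> = 1" using norm_point[OF that] by (simp add: norm_eq_1)
    moreover have "(t * \<rho>) *\<^sub>R e = (t * \<eta>) *\<^sub>R v" using \<eta>(3) by (metis scaleR_scaleR)
    ultimately have "\<theta> \<omega> * t = pi * \<eta> * (1 + (norm v)\<^sup>2) * t + ?\<phi> t \<omega>"
      unfolding \<theta>_def power2_norm_eq_inner by (simp add: inner_diff_left inner_diff_right inner_commute algebra_simps)
    then show ?thesis by (simp only: c_def cis_mult)
  qed
  define k0 where "k0 = (\<lambda>t::real. indicator {0..1} t *\<^sub>R c t)"
  define k1 where "k1 = (\<lambda>t::real. indicator {0..1} t *\<^sub>R (- \<i> * (1 - of_real t) * c t))"
  define m0 where "m0 = (\<lambda>\<omega>. \<integral>t. indicator {0..1} t *\<^sub>R cis (\<theta> \<omega> * t) \<partial>lborel)"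
  define m1 where "m1 = (\<lambda>\<omega>. \<integral>t. indicator {0..1} t *\<^sub>R (- \<i> * (1 - of_real t) * cis (\<theta> \<omega> * t)) \<partial>lborel)"
  let ?p0 = "\<lambda>\<omega>. m0 \<omega> * p \<omega>" and ?p1 = "\<lambda>\<omega>. m1 \<omega> * p1 \<omega>"
  have k: "integrable lborel k0" "integrable lborel k1"
    unfolding k0_def k1_def c_def by (intro borel_integrable_compact continuous_intros compact_Icc)+
  have kn: "cmod (k0 t) \<le> indicator {0..1} t" "cmod (k1 t) \<le> indicator {0..1} t" for t
  proof -
    have "cmod (1 - of_real t) \<le> 1" if "0 \<le> t" "t \<le> 1"
    proof -
      have "cmod (1 - of_real t) = cmod (of_real (1 - t))" by simp
      also have "\<dots> \<le> 1" unfolding norm_of_real using that by simp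
      finally show ?thesis .
    qed
    then show "cmod (k0 t) \<le> indicator {0..1} t" "cmod (k1 t) \<le> indicator {0..1} t"
      by (auto simp: k0_def k1_def c1 norm_mult split: split_indicator)
  qed
  define L where "L = (\<lambda>q. \<integral>\<^sup>+t. indicator {0..1} t * dens q (?y t) \<partial>lborel)"
  have line: "dens (\<lambda>\<omega>. m \<omega> * q \<omega>) z \<le> L q"
    if q: "integrable \<sigma> q" and \<kappa>: "integrable lborel \<kappa>" and kn: "\<And>t. cmod (\<kappa> t) \<le> indicator {0..1} t"
    and m: "\<And>\<omega>. \<omega> \<in> space \<sigma> \<Longrightarrow> m \<omega> = (\<integral>t. \<kappa> t * cis (?\<phi> t \<omega>) \<partial>lborel)"
    for q m and \<kappa> :: "real \<Rightarrow> complex"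
  proof -
    have "(\<integral>\<^sup>+t. ennreal (cmod (\<kappa> t)) \<partial>lborel) \<le> (\<integral>\<^sup>+t. indicator {0..1::real} t \<partial>lborel)"
    proof (rule nn_integral_mono)
      fix t
      have "ennreal (cmod (\<kappa> t)) \<le> ennreal (indicator {0..1} t)" by (rule ennreal_leI[OF kn])
      then show "ennreal (cmod (\<kappa> t)) \<le> indicator {0..1} t" by (simp only: ennreal_indicator)
    qed
    then have 1: "(\<integral>\<^sup>+t. ennreal (cmod (\<kappa> t)) \<partial>lborel) \<le> 1" by simp
    have 2: "(\<integral>\<^sup>+t. ennreal (cmod (\<kappa> t) * (cmod (ft q (?y t)))\<^sup>2) \<partial>lborel) \<le> L q"
      unfolding L_def
    proof (rule nn_integral_mono)
      fix t
      have "cmod (\<kappa> t) * (cmod (ft q (?y t)))\<^sup>2 \<le> indicator {0..1} t * (cmod (ft q (?y t)))\<^sup>2"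
        by (rule mult_right_mono[OF kn]) simp
      then have "ennreal (cmod (\<kappa> t) * (cmod (ft q (?y t)))\<^sup>2) \<le> ennreal (indicator {0..1} t * (cmod (ft q (?y t)))\<^sup>2)"
        by (rule ennreal_leI)
      also have "\<dots> = ennreal (indicator {0..1} t) * dens q (?y t)"
        by (rule ennreal_mult') simp
      finally show "ennreal (cmod (\<kappa> t) * (cmod (ft q (?y t)))\<^sup>2) \<le> indicator {0..1} t * dens q (?y t)"
        by (simp only: ennreal_indicator)
    qed
    have "dens (\<lambda>\<omega>. m \<omega> * q \<omega>) z \<le> (\<integral>\<^sup>+t. ennreal (cmod (\<kappa> t)) \<partial>lborel) * (\<integral>\<^sup>+t. ennreal (cmod (\<kappa> t) * (cmod (ft q (?y t)))\<^sup>2) \<partial>lborel)"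
      by (rule superposition_bound[OF q lborel.sigma_finite_measure_axioms \<kappa> _ m]) measurable
    also have "\<dots> \<le> 1 * L q" by (intro mult_mono 1 2) auto
    finally show ?thesis by simp
  qed
  have L0: "dens ?p0 z \<le> L p"
  proof (rule line[OF ip k(1) kn(1)])
    fix \<omega> assume "\<omega> \<in> space \<sigma>"
    from ph[OF this] show "m0 \<omega> = (\<integral>t. k0 t * cis (?\<phi> t \<omega>) \<partial>lborel)"
      unfolding m0_def k0_def by (simp only: mult_scaleR_left)
  qed
  have L1: "dens ?p1 z \<le> L p1"
  proof (rule line[OF ip1 k(2) kn(2)])
    fix \<omega> assume "\<omega> \<in> space \<sigma>"
    from ph[OF this] show "m1 \<omega> = (\<integral>t. k1 t * cis (?\<phi> t \<omega>) \<partial>lborel)"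
      unfolding m1_def k1_def by (simp only: mult_scaleR_left mult.assoc)
  qed
  have s: "ft p z = ft ?p0 z + ft ?p1 z"
  proof -
    have cm: "cmod (m0 \<omega>) \<le> 1" "cmod (m1 \<omega>) \<le> 1" for \<omega>
    proof -
      have b: "cmod (\<integral>t. indicator {0..1::real} t *\<^sub>R h t \<partial>lborel) \<le> 1" if "\<And>t. t \<in> {0..1} \<Longrightarrow> cmod (h t) \<le> 1" for h
      proof -
        have "ennreal (cmod (\<integral>t. indicator {0..1::real} t *\<^sub>R h t \<partial>lborel)) \<le> (\<integral>\<^sup>+t. ennreal (cmod (indicator {0..1::real} t *\<^sub>R h t)) \<partial>lborel)"
        proof (cases "integrable lborel (\<lambda>t. indicator {0..1::real} t *\<^sub>R h t)")
          case True then show ?thesis by (rule integral_norm_bound_ennreal)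
        qed (simp add: not_integrable_integral_eq)
        also have "\<dots> \<le> (\<integral>\<^sup>+t. indicator {0..1::real} t \<partial>lborel)"
          by (intro nn_integral_mono) (use that in \<open>auto split: split_indicator\<close>)
        finally show ?thesis by (simp add: ennreal_le_1)
      qed
      have u: "cmod (- \<i> * (1 - of_real t)) \<le> 1" if "t \<in> {0..1}" for t
      proof -
        have "cmod (- \<i> * (1 - of_real t)) = cmod (of_real (1 - t))" by (simp add: norm_mult)
        also have "\<dots> \<le> 1" unfolding norm_of_real using that by simp
        finally show ?thesis .
      qed
      show "cmod (m0 \<omega>) \<le> 1" unfolding m0_def by (rule b) simp
      show "cmod (m1 \<omega>) \<le> 1" unfolding m1_def by (rule b) (use u in \<open>simp add: norm_mult\<close>)
    qed
    have \<theta>m[measurable]: "\<theta> \<in> borel_measurable \<sigma>"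
      unfolding \<theta>_def by (rule measurable_compose[OF measurable_point]) measurable
    have mm: "m0 \<in> borel_measurable \<sigma>" "m1 \<in> borel_measurable \<sigma>"
      unfolding m0_def m1_def by measurable
    note i = integrable_bounded_mult[OF ip mm(1) cm(1)] integrable_bounded_mult[OF ip1 mm(2) cm(2)]
    have "p \<omega> = m0 \<omega> * p \<omega> + m1 \<omega> * p1 \<omega>" for \<omega>
    proof -
      have "m0 \<omega> + of_real (\<theta> \<omega>) * m1 \<omega> = 1" unfolding m0_def m1_def using one_eq_line_average[of "\<theta> \<omega>"] by (simp only:)
      then have "p \<omega> = (m0 \<omega> + of_real (\<theta> \<omega>) * m1 \<omega>) * p \<omega>" by simp
      then show ?thesis by (simp add: p1_def algebra_simps)
    qed
    then have "ft p z = ft (\<lambda>\<omega>. m0 \<omega> * p \<omega> + m1 \<omega> * p1 \<omega>) z" by simp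
    also have "\<dots> = ft ?p0 z + ft ?p1 z"
      by (rule sphere_ft_add[OF i])
    finally show ?thesis .
  qed
  have "dens p z \<le> 2 * L p + 2 * L p1"
  proof -
    have "dens p z \<le> ennreal (2 * (cmod (ft ?p0 z))\<^sup>2 + 2 * (cmod (ft ?p1 z))\<^sup>2)"
      unfolding s by (intro ennreal_leI norm_add_sq_le)
    also have "\<dots> = 2 * dens ?p0 z + 2 * dens ?p1 z"
      by (simp add: ennreal_plus ennreal_mult')
    also have "\<dots> \<le> 2 * L p + 2 * L p1" by (intro add_mono mult_left_mono L0 L1) auto
    finally show ?thesis .
  qed
  also have "\<dots> \<le> ennreal (C * (1 / sqrt \<tau>) ^ ?d) * (\<integral>\<^sup>+t. indicator {0..1} t * energy ?g \<tau> (?y t) \<partial>lborel)" (is "_ \<le> _ * ?I")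
  proof -
    define K where "K = (2 * (real ?d + 4) * 2 ^ ?d)\<^sup>2 * (1 / sqrt \<tau>) ^ ?d"
    have K0: "K \<ge> 0" using t by (simp add: K_def)
    have CK: "C * (1 / sqrt \<tau>) ^ ?d = 4 * K" by (simp add: C_def K_def)
    have le: "L q \<le> ennreal K * ?I" if "\<And>y. dens q y \<le> ennreal K * energy ?g \<tau> y" for q
    proof -
      have "L q \<le> (\<integral>\<^sup>+t. ennreal K * (indicator {0..1} t * energy ?g \<tau> (?y t)) \<partial>lborel)"
        unfolding L_def
      proof (rule nn_integral_mono)
        fix t
        have "indicator {0..1} t * dens q (?y t) \<le> indicator {0..1} t * (ennreal K * energy ?g \<tau> (?y t))"
          by (rule mult_left_mono[OF that]) simp
        then show "indicator {0..1} t * dens q (?y t) \<le> ennreal K * (indicator {0..1} t * energy ?g \<tau> (?y t))"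
          by (simp only: mult_ac)
      qed
      also have "\<dots> = ennreal K * ?I" by (rule nn_integral_cmult) measurable
      finally show ?thesis .
    qed
    have "L p \<le> ennreal K * ?I"
    proof (rule le)
      fix y
      have "(2::real) ^ ?d * 1 \<le> (2 * (real ?d + 4) * 2 ^ ?d) * (2 * (real ?d + 4) * 2 ^ ?d)"
        by (intro mult_mono) (auto simp: mult_ge1_I)
      then have "2 ^ ?d * (1 / sqrt \<tau>) ^ ?d \<le> K" unfolding K_def power2_eq_square using t by (intro mult_right_mono) auto
      then show "dens p y \<le> ennreal K * energy ?g \<tau> y"
        unfolding p_def by (intro order_trans[OF packet_le_half_energy[OF f t]] mult_right_mono ennreal_leI) auto
    qed
    moreover have "L p1 \<le> ennreal K * ?I"
    proof (rule le)
      fix y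
      show "dens p1 y \<le> ennreal K * energy ?g \<tau> y"
        unfolding p1_def p_def \<theta>_def K_def by (rule curvature_packet_le_half_energy[OF f t \<eta>(1,2)])
    qed
    ultimately have "2 * L p + 2 * L p1 \<le> 2 * (ennreal K * ?I) + 2 * (ennreal K * ?I)"
      by (intro add_mono mult_left_mono) auto
    also have "\<dots> = ennreal (C * (1 / sqrt \<tau>) ^ ?d) * ?I"
    proof -
      have "2 * (X * Y) + 2 * (X * Y) = (4 * X) * Y" for X Y :: ennreal
        by (simp add: mult.assoc flip: distrib_right)
      then show ?thesis unfolding CK using K0 by (simp add: ennreal_mult')
    qed
    finally show ?thesis .
  qed
  finally show ?thesis unfolding p_def .
qed

end

section \<open>Gaussian tubes and the mass of tubes\<close>

text \<open>
  Dominating a Gaussian by a superposition of balls turns Gaussian averages of a measure into masses of honest sets.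
\<close>

lemma gaussian_le_ball_average:
  fixes u :: "'a::euclidean_space"
  assumes s: "s > 0" "s\<^sup>2 \<le> \<tau>"
  shows "ennreal (gauss (2*\<tau>) u) * emeasure lborel (cball (0::'a) (s/2))
    \<le> ennreal (exp (pi/8)) * (\<integral>\<^sup>+p. ennreal (gauss (4*\<tau>) (p - 0)) * indicator (cball u (s/2)) p \<partial>lborel)"
proof -
  have t: "\<tau> > 0" using s by (smt (verit) zero_less_power2 power_not_zero zero_le_power2 zero_less_power)
  have "emeasure lborel (cball (0::'a) (s/2)) = emeasure lborel (cball u (s/2))"
    using s by (simp add: emeasure_cball)
  then have "ennreal (gauss (2*\<tau>) u) * emeasure lborel (cball (0::'a) (s/2))
    = (\<integral>\<^sup>+p. ennreal (gauss (2*\<tau>) u) * indicator (cball u (s/2)) p \<partial>lborel)"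
    by (subst nn_integral_cmult_indicator) auto
  also have "\<dots> \<le> (\<integral>\<^sup>+p. ennreal (exp (pi/8)) * (ennreal (gauss (4*\<tau>) (p - 0)) * indicator (cball u (s/2)) p) \<partial>lborel)"
  proof (rule nn_integral_mono)
    fix p
    have "gauss (2*\<tau>) u \<le> exp (pi/8) * gauss (4*\<tau>) (p - 0)" if "p \<in> cball u (s/2)"
    proof -
      have "(norm (p - u))\<^sup>2 \<le> (s/2)\<^sup>2" using that by (intro power_mono) (auto simp: dist_norm norm_minus_commute)
      then have "(norm p)\<^sup>2 \<le> 2 * (norm u)\<^sup>2 + \<tau>/2"
        using norm_add_sq_le[of u "p - u"] s by (simp add: power_divide)
      then have "pi * (norm p)\<^sup>2 \<le> pi * (2 * (norm u)\<^sup>2 + \<tau>/2)" by (intro mult_left_mono) auto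
      then have "-pi * (norm u)\<^sup>2 / (2*\<tau>) \<le> pi/8 + -pi * (norm (p - 0))\<^sup>2 / (4*\<tau>)"
        using t by (simp add: field_simps)
      then show ?thesis by (simp only: mult_exp_exp exp_le_cancel_iff)
    qed
    then show "ennreal (gauss (2*\<tau>) u) * indicator (cball u (s/2)) p
      \<le> ennreal (exp (pi/8)) * (ennreal (gauss (4*\<tau>) (p - 0)) * indicator (cball u (s/2)) p)"
      by (auto split: split_indicator simp: ennreal_leI simp flip: ennreal_mult')
  qed
  also have "\<dots> = ennreal (exp (pi/8)) * (\<integral>\<^sup>+p. ennreal (gauss (4*\<tau>) (p - 0)) * indicator (cball u (s/2)) p \<partial>lborel)"
    by (rule nn_integral_cmult) (intro borel_measurable_times_ennreal borel_measurable_indicator, auto)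
  finally show ?thesis .
qed

text \<open>
  The closed neighbourhood of radius \<open>s/2\<close> of the segment of length \<open>\<rho>\<close> from the origin in direction \<open>e\<close>.  It plays the role of a tube
  that does not refer to coordinates.
\<close>

definition capsule :: "real \<Rightarrow> real \<Rightarrow> 'a::euclidean_space \<Rightarrow> 'a set" where
  "capsule s \<rho> e = {w. \<exists>t\<in>{0..1}. norm (w - (t * \<rho>) *\<^sub>R e) \<le> s/2}"

lemma compact_capsule: "compact (capsule s \<rho> e)"
proof -
  have "capsule s \<rho> e = (\<lambda>(t, b). (t * \<rho>) *\<^sub>R e + b) ` ({0..1} \<times> cball 0 (s/2))" (is "_ = ?R")
  proof
    show "capsule s \<rho> e \<subseteq> ?R"
    proof
      fix w assume "w \<in> capsule s \<rho> e"
      then obtain t where t: "t \<in> {0..1}" "norm (w - (t * \<rho>) *\<^sub>R e) \<le> s/2" by (auto simp: capsule_def)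
      then have "(t, w - (t * \<rho>) *\<^sub>R e) \<in> {0..1} \<times> cball 0 (s/2)" by simp
      moreover have "w = (\<lambda>(t, b). (t * \<rho>) *\<^sub>R e + b) (t, w - (t * \<rho>) *\<^sub>R e)" by simp
      ultimately show "w \<in> ?R" by blast
    qed
    show "?R \<subseteq> capsule s \<rho> e"
      by (force simp: capsule_def)
  qed
  moreover have "compact ?R"
    by (intro compact_continuous_image compact_Times compact_cball compact_Icc)
       (auto simp: case_prod_beta' intro!: continuous_intros)
  ultimately show ?thesis by simp
qed

text \<open>
  While a point moves with speed \<open>\<rho>\<close>, it spends time at most \<open>s/\<rho>\<close> in a ball of radius \<open>s/2\<close>.
\<close>

lemma line_time_in_capsule:
  fixes w e :: "'a::euclidean_space"
  assumes e: "norm e = 1" and \<rho>: "\<rho> > 0" and s: "s > 0"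
  shows "(\<integral>\<^sup>+t. indicator {0..1} t * indicator (cball 0 (s/2)) (w - (t * \<rho>) *\<^sub>R e) \<partial>lborel) \<le> ennreal (s/\<rho>) * indicator (capsule s \<rho> e) w"
proof -
  \<comment> \<open>\<open>c\<close> is the time at which the moving centre is closest to \<open>w\<close>.\<close>
  define c where "c = (w \<bullet> e) / \<rho>"
  have "(\<integral>\<^sup>+t. indicator {0..1} t * indicator (cball 0 (s/2)) (w - (t * \<rho>) *\<^sub>R e) \<partial>lborel)
    \<le> (\<integral>\<^sup>+t. indicator (capsule s \<rho> e) w * indicator {c - s/(2*\<rho>)..c + s/(2*\<rho>)} t \<partial>lborel)"
  proof (rule nn_integral_mono)
    fix t :: real
    have "w \<in> capsule s \<rho> e \<and> t \<in> {c - s/(2*\<rho>)..c + s/(2*\<rho>)}" if t: "t \<in> {0..1}" "w - (t * \<rho>) *\<^sub>R e \<in> cball 0 (s/2)"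
    proof
      have n: "norm (w - (t * \<rho>) *\<^sub>R e) \<le> s/2" using t by simp
      then show "w \<in> capsule s \<rho> e" using t by (auto simp: capsule_def)
      have ee: "e \<bullet> e = 1" using e by (simp add: norm_eq_1)
      have "\<bar>(w - (t * \<rho>) *\<^sub>R e) \<bullet> e\<bar> \<le> s/2"
        using Cauchy_Schwarz_ineq2[of "w - (t * \<rho>) *\<^sub>R e" e] n e by simp
      moreover have "(w - (t * \<rho>) *\<^sub>R e) \<bullet> e = (c - t) * \<rho>"
        using \<rho> ee by (simp add: c_def inner_diff_left field_simps)
      ultimately have "\<bar>c - t\<bar> * \<rho> \<le> s/2" using \<rho> by (simp only: abs_mult abs_of_pos)
      then have "\<bar>c - t\<bar> \<le> s/(2*\<rho>)" using \<rho> by (simp add: field_simps)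
      then show "t \<in> {c - s/(2*\<rho>)..c + s/(2*\<rho>)}" by auto
    qed
    then show "indicator {0..1} t * indicator (cball 0 (s/2)) (w - (t * \<rho>) *\<^sub>R e) \<le> (indicator (capsule s \<rho> e) w * indicator {c - s/(2*\<rho>)..c + s/(2*\<rho>)} t :: ennreal)"
      by (cases "t \<in> {0..1} \<and> w - (t * \<rho>) *\<^sub>R e \<in> cball 0 (s/2)") (auto simp: indicator_def)
  qed
  also have "\<dots> = indicator (capsule s \<rho> e) w * ennreal (s/\<rho>)"
    using s \<rho> by (subst nn_integral_cmult_indicator) (auto simp: field_simps)
  finally show ?thesis by (simp only: mult_ac)
qed

text \<open>
  A measure that gives mass at most \<open>S\<close> to every capsule in direction \<open>e\<close> has the corresponding bound for Gaussian tubes: the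
  Gaussian is a superposition of balls, and a moving ball sweeps out a capsule.  No summation over parallel tubes is
  needed, since their offsets are integrated against a Gaussian.
\<close>

lemma gaussian_tube_le_capsules:
  fixes \<nu> :: "'a::euclidean_space measure"
  assumes \<nu>: "sigma_finite_measure \<nu>" "sets \<nu> = sets borel" and Q: "Q \<in> sets borel"
    and e: "norm e = 1" and s: "s > 0" "s \<le> \<rho>" "\<tau> = 2 * l * s\<^sup>2" "l \<ge> 1"
    and S: "\<And>q. emeasure \<nu> (Q \<inter> {z. q - z \<in> capsule s \<rho> e}) \<le> S"
  shows "(\<integral>\<^sup>+z. indicator Q z * (\<integral>\<^sup>+t. indicator {0..1} t * ennreal (gauss (2*\<tau>) (y - z - (t * \<rho>) *\<^sub>R e)) \<partial>lborel) \<partial>\<nu>)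
    \<le> ennreal (exp (pi/8) * (2 * sqrt (8*l)) ^ DIM('a) / unit_ball_vol DIM('a) * (s/\<rho>)) * S"
proof -
  interpret \<nu>: sigma_finite_measure \<nu> by fact
  interpret P: pair_sigma_finite \<nu> "lborel :: 'a measure" ..
  note [measurable_cong] = \<nu>(2) and [measurable] = Q
  have \<tau>: "\<tau> > 0" "s\<^sup>2 \<le> \<tau>" using s by (auto simp: mult_ge1_I)
  have \<rho>: "\<rho> > 0" using s by linarith
  define V where "V = ennreal (unit_ball_vol DIM('a) * (s/2) ^ DIM('a))"
  have V: "emeasure lborel (cball (0::'a) (s/2)) = V"
    using s by (simp add: V_def emeasure_cball)
  define c where "c = ennreal (exp (pi/8))"
  define G where "G = (\<lambda>p::'a. ennreal (gauss (4*\<tau>) (p - 0)))"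
  define g where "g = (\<lambda>u::'a. ennreal (gauss (2*\<tau>) u))"
  define B where "B = (indicator (cball 0 (s/2)) :: 'a \<Rightarrow> ennreal)"
  define K where "K = capsule s \<rho> e"
  define I where "I = (indicator {0..1} :: real \<Rightarrow> ennreal)"
  define J where "J = (indicator Q :: 'a \<Rightarrow> ennreal)"
  have [measurable]: "K \<in> sets borel" unfolding K_def by (intro borel_closed compact_imp_closed compact_capsule)
  have [measurable]: "cball (0::'a) (s/2) \<in> sets borel" by simp
  have [measurable]: "G \<in> borel_measurable borel" "g \<in> borel_measurable borel" "B \<in> borel_measurable borel"
      "I \<in> borel_measurable borel" "J \<in> borel_measurable borel"
    unfolding G_def g_def B_def I_def J_def by measurable
  \<comment> \<open>The integrand once the Gaussian \<open>g\<close> has been replaced by balls \<open>B\<close> whose centres are displaced by \<open>p\<close>.\<close>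
  define F where "F = (\<lambda>p z t. c * G p * (J z * (I t * B (y - z - (t * \<rho>) *\<^sub>R e - p))))"
  have gB: "g u * V \<le> c * (\<integral>\<^sup>+p. G p * B (u - p) \<partial>lborel)" for u
  proof -
    have "indicator (cball u (s/2)) p = B (u - p)" for p
      by (auto simp: B_def dist_norm norm_minus_commute split: split_indicator)
    then show ?thesis
      using gaussian_le_ball_average[OF s(1) \<tau>(2), of u] unfolding V c_def G_def g_def by (simp only:)
  qed
  have "(\<integral>\<^sup>+z. J z * (\<integral>\<^sup>+t. I t * g (y - z - (t * \<rho>) *\<^sub>R e) \<partial>lborel) \<partial>\<nu>) * V
    = (\<integral>\<^sup>+z. J z * (\<integral>\<^sup>+t. I t * g (y - z - (t * \<rho>) *\<^sub>R e) \<partial>lborel) * V \<partial>\<nu>)"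
    by (rule nn_integral_multc[symmetric]) measurable
  also have "\<dots> \<le> (\<integral>\<^sup>+z. (\<integral>\<^sup>+t. (\<integral>\<^sup>+p. F p z t \<partial>lborel) \<partial>lborel) \<partial>\<nu>)"
  proof (rule nn_integral_mono)
    fix z
    have "J z * (\<integral>\<^sup>+t. I t * g (y - z - (t * \<rho>) *\<^sub>R e) \<partial>lborel) * V = (\<integral>\<^sup>+t. J z * (I t * g (y - z - (t * \<rho>) *\<^sub>R e)) * V \<partial>lborel)"
      by (subst nn_integral_multc, measurable, subst nn_integral_cmult) auto
    also have "\<dots> \<le> (\<integral>\<^sup>+t. (\<integral>\<^sup>+p. F p z t \<partial>lborel) \<partial>lborel)"
    proof (rule nn_integral_mono)
      fix t
      let ?u = "y - z - (t * \<rho>) *\<^sub>R e"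
      have "J z * (I t * g ?u) * V = (J z * I t) * (g ?u * V)" by (simp only: mult_ac)
      also have "\<dots> \<le> (J z * I t) * (c * (\<integral>\<^sup>+p. G p * B (?u - p) \<partial>lborel))"
        by (rule mult_left_mono[OF gB]) simp
      also have "\<dots> = (J z * I t * c) * (\<integral>\<^sup>+p. G p * B (?u - p) \<partial>lborel)" by (simp only: mult_ac)
      also have "\<dots> = (\<integral>\<^sup>+p. (J z * I t * c) * (G p * B (?u - p)) \<partial>lborel)"
        by (rule nn_integral_cmult[symmetric]) measurable
      also have "\<dots> = (\<integral>\<^sup>+p. F p z t \<partial>lborel)" by (simp only: F_def mult_ac)
      finally show "J z * (I t * g ?u) * V \<le> (\<integral>\<^sup>+p. F p z t \<partial>lborel)" .
    qed
    finally show "J z * (\<integral>\<^sup>+t. I t * g (y - z - (t * \<rho>) *\<^sub>R e) \<partial>lborel) * V \<le> (\<integral>\<^sup>+t. (\<integral>\<^sup>+p. F p z t \<partial>lborel) \<partial>lborel)" .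
  qed
  also have "\<dots> = (\<integral>\<^sup>+z. (\<integral>\<^sup>+p. (\<integral>\<^sup>+t. F p z t \<partial>lborel) \<partial>lborel) \<partial>\<nu>)"
    by (intro nn_integral_cong lborel_pair.Fubini'[symmetric]) (unfold F_def case_prod_beta', measurable)
  also have "\<dots> = (\<integral>\<^sup>+p. (\<integral>\<^sup>+z. (\<integral>\<^sup>+t. F p z t \<partial>lborel) \<partial>\<nu>) \<partial>lborel)"
    by (rule P.Fubini'[symmetric]) (unfold F_def case_prod_beta', measurable)
  also have "\<dots> \<le> (\<integral>\<^sup>+p. G p * (c * ennreal (s/\<rho>) * S) \<partial>lborel)"
  proof (rule nn_integral_mono)
    fix p
    have "(\<integral>\<^sup>+z. (\<integral>\<^sup>+t. F p z t \<partial>lborel) \<partial>\<nu>) \<le> (\<integral>\<^sup>+z. (G p * c * ennreal (s/\<rho>)) * indicator (Q \<inter> {z. (y - p) - z \<in> K}) z \<partial>\<nu>)"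
    proof (rule nn_integral_mono)
      fix z
      have "(\<integral>\<^sup>+t. F p z t \<partial>lborel) = c * G p * J z * (\<integral>\<^sup>+t. I t * B ((y - p - z) - (t * \<rho>) *\<^sub>R e) \<partial>lborel)"
      proof -
        have "y - z - (t * \<rho>) *\<^sub>R e - p = (y - p - z) - (t * \<rho>) *\<^sub>R e" for t by (simp add: algebra_simps)
        then show ?thesis
          unfolding F_def by (subst nn_integral_cmult[symmetric], measurable) (simp only: mult_ac)
      qed
      also have "\<dots> \<le> c * G p * J z * (ennreal (s/\<rho>) * indicator K (y - p - z))"
        unfolding I_def B_def K_def by (rule mult_left_mono[OF line_time_in_capsule[OF e \<rho> s(1)]]) simp
      also have "\<dots> = (G p * c * ennreal (s/\<rho>)) * indicator (Q \<inter> {z. (y - p) - z \<in> K}) z"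
        unfolding J_def by (auto split: split_indicator simp: mult_ac)
      finally show "(\<integral>\<^sup>+t. F p z t \<partial>lborel) \<le> (G p * c * ennreal (s/\<rho>)) * indicator (Q \<inter> {z. (y - p) - z \<in> K}) z" .
    qed
    also have "\<dots> = (G p * c * ennreal (s/\<rho>)) * emeasure \<nu> (Q \<inter> {z. (y - p) - z \<in> K})"
      by (rule nn_integral_cmult_indicator) measurable
    also have "\<dots> \<le> (G p * c * ennreal (s/\<rho>)) * S"
      unfolding K_def by (rule mult_left_mono[OF S]) simp
    finally show "(\<integral>\<^sup>+z. (\<integral>\<^sup>+t. F p z t \<partial>lborel) \<partial>\<nu>) \<le> G p * (c * ennreal (s/\<rho>) * S)" by (simp only: mult_ac)
  qed
  also have "\<dots> = ennreal (sqrt (4*\<tau>) ^ DIM('a)) * (c * ennreal (s/\<rho>) * S)"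
  proof -
    have "nn_integral lborel G = ennreal (sqrt (4*\<tau>) ^ DIM('a))"
      unfolding G_def using \<tau> by (intro gaussian_integral(3)) simp
    then show ?thesis by (subst nn_integral_multc) simp_all
  qed
  finally have XV: "(\<integral>\<^sup>+z. J z * (\<integral>\<^sup>+t. I t * g (y - z - (t * \<rho>) *\<^sub>R e) \<partial>lborel) \<partial>\<nu>) * V \<le> ennreal (sqrt (4*\<tau>) ^ DIM('a)) * (c * ennreal (s/\<rho>) * S)" (is "?X * V \<le> _") .
  have u: "unit_ball_vol DIM('a) > 0" by simp
  have "?X = (?X * V) * ennreal (1 / (unit_ball_vol DIM('a) * (s/2) ^ DIM('a)))"
  proof -
    have "unit_ball_vol DIM('a) * (s/2) ^ DIM('a) * (1 / (unit_ball_vol DIM('a) * (s/2) ^ DIM('a))) = 1"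
      using less_imp_neq[OF u] s by (simp del: unit_ball_vol_pos)
    then have "V * ennreal (1 / (unit_ball_vol DIM('a) * (s/2) ^ DIM('a))) = 1"
      unfolding V_def using s by (subst ennreal_mult'[symmetric]) auto
    then show ?thesis by (simp only: mult.assoc mult_1_right)
  qed
  also have "\<dots> \<le> (ennreal (sqrt (4*\<tau>) ^ DIM('a)) * (c * ennreal (s/\<rho>) * S)) * ennreal (1 / (unit_ball_vol DIM('a) * (s/2) ^ DIM('a)))"
    by (rule mult_right_mono[OF XV]) simp
  also have "\<dots> = ennreal (exp (pi/8) * (sqrt (4*\<tau>) ^ DIM('a) / (s/2) ^ DIM('a)) / unit_ball_vol DIM('a) * (s/\<rho>)) * S"
  proof -
    define A where "A = sqrt (4*\<tau>) ^ DIM('a)"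
    define b where "b = 1 / (unit_ball_vol DIM('a) * (s/2) ^ DIM('a))"
    have nn: "A \<ge> 0" "b \<ge> 0" "s/\<rho> \<ge> 0" using \<tau> u s \<rho> by (auto simp: A_def b_def)
    have "(ennreal A * (c * ennreal (s/\<rho>) * S)) * ennreal b = (ennreal A * (c * (ennreal (s/\<rho>) * ennreal b))) * S"
      by (simp only: mult_ac)
    also have "ennreal A * (c * (ennreal (s/\<rho>) * ennreal b)) = ennreal (A * (exp (pi/8) * ((s/\<rho>) * b)))"
      using nn by (simp only: c_def ennreal_mult' exp_ge_zero mult_nonneg_nonneg)
    also have "A * (exp (pi/8) * ((s/\<rho>) * b)) = exp (pi/8) * (A / (s/2) ^ DIM('a)) / unit_ball_vol DIM('a) * (s/\<rho>)"
      by (simp add: b_def mult_ac)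
    finally show ?thesis by (simp only: A_def b_def)
  qed
  also have "sqrt (4*\<tau>) ^ DIM('a) / (s/2) ^ DIM('a) = (2 * sqrt (8*l)) ^ DIM('a)"
  proof -
    have "4*\<tau> = (8*l) * s\<^sup>2" using s by simp
    then have "sqrt (4*\<tau>) = sqrt (8*l) * s" using s by (simp only: real_sqrt_mult) simp
    then have "sqrt (4*\<tau>) / (s/2) = 2 * sqrt (8*l)" using s by simp
    then show ?thesis by (simp only: power_divide[symmetric])
  qed
  finally show ?thesis unfolding J_def I_def g_def .
qed

section \<open>The step between two scales\<close>

text \<open>
  The one-step estimate on a set \<open>Q\<close> that stays within distance \<open>D \<rho>\<close> of a point \<open>c\<close>.  The constant \<open>C\<close> may depend on \<open>l\<close>, the squared
  ratio of the Gaussian width to the scale; on the right \<open>l\<close> has grown by the factor \<open>16\<close>.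
\<close>

definition two_scale_bound :: "'a::euclidean_space measure \<Rightarrow> real \<Rightarrow> real \<Rightarrow> real \<Rightarrow> bool" where
  "two_scale_bound \<sigma> D l C \<longleftrightarrow> (\<forall>f (\<nu> :: 'a measure) Q c s \<rho> S.
    integrable \<sigma> f \<longrightarrow> sigma_finite_measure \<nu> \<longrightarrow> sets \<nu> = sets borel \<longrightarrow> Q \<in> sets borel \<longrightarrow>
    (\<forall>z\<in>Q. norm (z - c) \<le> D * \<rho>) \<longrightarrow> 1 \<le> s \<longrightarrow> s \<le> \<rho> \<longrightarrow> \<rho> \<le> s\<^sup>2 \<longrightarrow>
    (\<forall>q e. norm e = 1 \<longrightarrow> emeasure \<nu> (Q \<inter> {z. q - z \<in> capsule s \<rho> e}) \<le> S) \<longrightarrow>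
    (\<integral>\<^sup>+z. indicator Q z * local_energy \<sigma> f (l * s\<^sup>2) z \<partial>\<nu>) \<le> ennreal (C * (s/\<rho>)) * S * local_energy \<sigma> f (16 * l * \<rho>\<^sup>2) c)"

context sphere_carried
begin

text \<open>
  The convolution of a Gaussian of width \<open>sqrt b\<close> with a narrower one is dominated by a Gaussian of width \<open>sqrt (2 b)\<close>.
\<close>

lemma energy_smoothing:
  fixes c :: 'a
  assumes [measurable]: "f \<in> borel_measurable \<sigma>" and t: "\<tau> > 0" and b: "4 * \<tau> \<le> b"
  shows "(\<integral>\<^sup>+y. ennreal (gauss b (y - c)) * energy f (\<tau>/4) y \<partial>lborel)
    \<le> ennreal (sqrt \<tau> ^ DIM('a)) * energy f (2 * b) c"
proof -
  define D where "D = (\<lambda>y::'a. ennreal (gauss b (y - c)))"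
  define h where "h = (\<lambda>u::'a. ennreal (gauss (\<tau>/4) u))"
  define A where "A = (\<lambda>x. dens f x)"
  have [measurable]: "D \<in> borel_measurable borel" "h \<in> borel_measurable borel" "A \<in> borel_measurable borel"
    unfolding D_def h_def A_def by measurable
  have le: "energy f (\<tau>/4) y = (\<integral>\<^sup>+x. A x * h (x - y) \<partial>lborel)" for y
    unfolding local_energy_def A_def h_def by (intro nn_integral_cong) (simp add: ennreal_mult')
  have "(\<integral>\<^sup>+y. D y * energy f (\<tau>/4) y \<partial>lborel) = (\<integral>\<^sup>+y. (\<integral>\<^sup>+x. D y * (A x * h (x - y)) \<partial>lborel) \<partial>lborel)"
    unfolding le by (intro nn_integral_cong nn_integral_cmult[symmetric]) measurable
  also have "\<dots> = (\<integral>\<^sup>+x. (\<integral>\<^sup>+y. D y * (A x * h (x - y)) \<partial>lborel) \<partial>lborel)"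
    by (rule lborel_pair.Fubini'[symmetric]) (unfold case_prod_beta', measurable)
  also have "\<dots> \<le> (\<integral>\<^sup>+x. ennreal (sqrt \<tau> ^ DIM('a)) * ennreal ((cmod (ft f x))\<^sup>2 * gauss (2*b) (x - c)) \<partial>lborel)"
  proof (rule nn_integral_mono)
    fix x
    define w where "w = ennreal (gauss (2*b) (x - c))"
    have pt: "D y * h (x - y) \<le> w * ennreal (gauss \<tau> (y - x))" for y
    proof -
      have b0: "b > 0" using t b by linarith
      have "(norm (x - c))\<^sup>2 \<le> 2 * (norm (y - x))\<^sup>2 + 2 * (norm (y - c))\<^sup>2"
        using norm_add_sq_le[of "x - y" "y - c"] by (simp add: norm_minus_commute)
      then have "(norm (x - c))\<^sup>2 / (2*b) \<le> (norm (y - x))\<^sup>2 / b + (norm (y - c))\<^sup>2 / b"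
        using b0 by (simp add: field_simps)
      moreover have "(norm (y - x))\<^sup>2 / b \<le> (norm (y - x))\<^sup>2 / \<tau>"
        using t b by (intro divide_left_mono) auto
      moreover have "0 \<le> (norm (y - x))\<^sup>2 / \<tau>" using t by simp
      moreover have "(norm (y - x))\<^sup>2 / (\<tau>/4) = 4 * ((norm (y - x))\<^sup>2 / \<tau>)" by simp
      moreover have "A + T \<le> B + F" if "A \<le> Y + B" "Y \<le> T" "0 \<le> T" "F = 4 * T" for A B F T Y :: real
        using that by linarith
      ultimately have q: "(norm (x - c))\<^sup>2 / (2*b) + (norm (y - x))\<^sup>2 / \<tau> \<le> (norm (y - c))\<^sup>2 / b + (norm (y - x))\<^sup>2 / (\<tau>/4)"
        by blast
      have "-pi * (norm (y - c))\<^sup>2 / b + -pi * (norm (x - y))\<^sup>2 / (\<tau>/4) \<le> -pi * (norm (x - c))\<^sup>2 / (2*b) + -pi * (norm (y - x))\<^sup>2 / \<tau>"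
        using mult_left_mono[OF q, of pi] by (simp add: norm_minus_commute[of x y] distrib_left)
      then have "gauss b (y - c) * gauss (\<tau>/4) (x - y) \<le> gauss (2*b) (x - c) * gauss \<tau> (y - x)"
        by (simp only: mult_exp_exp exp_le_cancel_iff)
      then show ?thesis unfolding D_def h_def w_def
        by (simp only: ennreal_mult'[symmetric] exp_ge_zero ennreal_leI)
    qed
    have "(\<integral>\<^sup>+y. D y * (A x * h (x - y)) \<partial>lborel) \<le> (\<integral>\<^sup>+y. A x * w * ennreal (gauss \<tau> (y - x)) \<partial>lborel)"
    proof (rule nn_integral_mono)
      fix y
      have "A x * (D y * h (x - y)) \<le> A x * (w * ennreal (gauss \<tau> (y - x)))"
        by (rule mult_left_mono[OF pt]) simp
      then show "D y * (A x * h (x - y)) \<le> A x * w * ennreal (gauss \<tau> (y - x))" by (simp only: mult_ac)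
    qed
    also have "\<dots> = A x * w * ennreal (sqrt \<tau> ^ DIM('a))"
      by (subst nn_integral_cmult) (simp_all only: gaussian_integral(3)[OF t], measurable)
    also have "\<dots> = ennreal (sqrt \<tau> ^ DIM('a)) * ennreal ((cmod (ft f x))\<^sup>2 * gauss (2*b) (x - c))"
      unfolding A_def w_def by (simp add: ennreal_mult' mult_ac)
    finally show "(\<integral>\<^sup>+y. D y * (A x * h (x - y)) \<partial>lborel) \<le> ennreal (sqrt \<tau> ^ DIM('a)) * ennreal ((cmod (ft f x))\<^sup>2 * gauss (2*b) (x - c))" .
  qed
  also have "\<dots> = ennreal (sqrt \<tau> ^ DIM('a)) * energy f (2 * b) c"
    unfolding local_energy_def by (rule nn_integral_cmult) measurable
  finally show ?thesis unfolding D_def .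
qed

text \<open>
  The mass that \<open>\<bar>E f_v\<bar>\<^sup>2\<close> receives from \<open>\<nu>\<close> inside \<open>Q\<close> is controlled by the largest mass of a tube in direction \<open>v\<close>, times the
  energy of the wider packet near \<open>Q\<close>.  Half of the Gaussian around the tube is spent on the decay away from \<open>c\<close>, which
  works because \<open>\<tau>\<close> is at most of order \<open>\<rho>\<^sup>2\<close>.
\<close>

lemma packet_mass_le_tube_mass:
  fixes v c :: 'a and \<nu> :: "'a measure"
  assumes f: "integrable \<sigma> f" and \<nu>: "sigma_finite_measure \<nu>" "sets \<nu> = sets borel"
    and Q: "Q \<in> sets borel" and D: "D \<ge> 0" "\<And>z. z \<in> Q \<Longrightarrow> norm (z - c) \<le> D * \<rho>"
    and s: "1 \<le> s" "s \<le> \<rho>" "\<rho> \<le> s\<^sup>2" "\<tau> = 2 * l * s\<^sup>2" "l \<ge> 1"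
    and S: "\<And>q e. norm e = 1 \<Longrightarrow> emeasure \<nu> (Q \<inter> {z. q - z \<in> capsule s \<rho> e}) \<le> S"
    and v: "1/2 \<le> norm v"
  defines "K \<equiv> (4 * (2 * (real DIM('a) + 4) * 2 ^ DIM('a))\<^sup>2) * exp (pi * (D+1)\<^sup>2 / 4) * (exp (pi/8) * (2 * sqrt (8*l)) ^ DIM('a) / unit_ball_vol DIM('a))"
  shows "(\<integral>\<^sup>+z. indicator Q z * dens (packet \<tau> v f) z \<partial>\<nu>)
    \<le> ennreal (K * (s/\<rho>) * (1 / sqrt \<tau>) ^ DIM('a)) * S *
      (\<integral>\<^sup>+y. ennreal (gauss (8*l*\<rho>\<^sup>2) (y - c)) * dens (packet (\<tau>/2) v f) y \<partial>lborel)"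
proof -
  interpret \<nu>: sigma_finite_measure \<nu> by fact
  interpret P: pair_sigma_finite \<nu> "lborel :: 'a measure" ..
  note [measurable_cong] = \<nu>(2) and [measurable] = Q
  have [measurable]: "f \<in> borel_measurable \<sigma>" using f by auto
  have \<rho>: "\<rho> > 0" "s > 0" using s by auto
  have \<tau>: "\<tau> > 0" "\<rho> \<le> \<tau>" "\<tau> \<le> 2 * l * \<rho>\<^sup>2"
  proof -
    have "s\<^sup>2 > 0" using \<rho> by simp
    then show "\<tau> > 0" using s by simp
    have "1 * s\<^sup>2 \<le> \<tau>" unfolding s(4) using s by (intro mult_right_mono) auto
    then show "\<rho> \<le> \<tau>" using s(3) by linarith
    have "s\<^sup>2 \<le> \<rho>\<^sup>2" using s by (intro power_mono) auto
    then show "\<tau> \<le> 2 * l * \<rho>\<^sup>2" using s by simp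
  qed
  define e where "e = v /\<^sub>R norm v"
  have "norm v \<noteq> 0" using v by linarith
  then have e: "norm e = 1" by (simp add: e_def)
  define E where "E = (\<lambda>y. dens (packet (\<tau>/2) v f) y)"
  define g where "g = (\<lambda>u::'a. ennreal (gauss (2*\<tau>) u))"
  define W where "W = (\<lambda>y::'a. ennreal (gauss (8*l*\<rho>\<^sup>2) (y - c)))"
  define I where "I = (indicator {0..1} :: real \<Rightarrow> ennreal)"
  define J where "J = (indicator Q :: 'a \<Rightarrow> ennreal)"
  define a where "a = ennreal ((4 * (2 * (real DIM('a) + 4) * 2 ^ DIM('a))\<^sup>2) * (1 / sqrt \<tau>) ^ DIM('a))"
  define k where "k = ennreal (exp (pi * (D+1)\<^sup>2 / 4))"
  define b where "b = ennreal (exp (pi/8) * (2 * sqrt (8*l)) ^ DIM('a) / unit_ball_vol DIM('a) * (s/\<rho>))"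
  have [measurable]: "E \<in> borel_measurable borel" "g \<in> borel_measurable borel" "W \<in> borel_measurable borel"
      "I \<in> borel_measurable borel" "J \<in> borel_measurable borel"
    unfolding E_def g_def W_def I_def J_def by measurable
  define F where "F = (\<lambda>y z t. a * k * (E y * W y) * (J z * (I t * g (y - z - (t * \<rho>) *\<^sub>R e))))"
  have "(\<integral>\<^sup>+z. J z * dens (packet \<tau> v f) z \<partial>\<nu>) \<le> (\<integral>\<^sup>+z. (\<integral>\<^sup>+t. (\<integral>\<^sup>+y. F y z t \<partial>lborel) \<partial>lborel) \<partial>\<nu>)"
  proof (rule nn_integral_mono)
    fix z
    define L where "L = (\<lambda>t. energy (packet (\<tau>/2) v f) \<tau> (z + (t * \<rho>) *\<^sub>R e))"
    have [measurable]: "L \<in> borel_measurable borel" unfolding L_def by measurable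
    have "J z * dens (packet \<tau> v f) z \<le> J z * (a * (\<integral>\<^sup>+t. I t * L t \<partial>lborel))"
      unfolding a_def I_def L_def e_def using \<rho> by (intro mult_left_mono packet_le_line_average f \<tau> v) auto
    also have "\<dots> = (\<integral>\<^sup>+t. J z * a * (I t * L t) \<partial>lborel)"
      by (subst nn_integral_cmult, measurable) (simp only: mult_ac)
    also have "\<dots> \<le> (\<integral>\<^sup>+t. (\<integral>\<^sup>+y. F y z t \<partial>lborel) \<partial>lborel)"
    proof (rule nn_integral_mono)
      fix t :: real
      let ?u = "\<lambda>y. y - z - (t * \<rho>) *\<^sub>R e"
      \<comment> \<open>The point \<open>y\<close> is near \<open>c\<close> unless \<open>?u y\<close> is large; half of the Gaussian pays for the weight \<open>W\<close>.\<close>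
      have pt: "J z * (I t * ennreal (gauss \<tau> (?u y))) \<le> J z * (I t * (k * W y * g (?u y)))" for y
      proof (cases "z \<in> Q \<and> t \<in> {0..1}")
        case True
        have "norm (y - c) \<le> norm (?u y) + (D + 1) * \<rho>"
        proof -
          have "y - c = ?u y + ((z - c) + (t * \<rho>) *\<^sub>R e)" by simp
          then have "norm (y - c) \<le> norm (?u y) + (norm (z - c) + norm ((t * \<rho>) *\<^sub>R e))"
            by (metis norm_triangle_le add_left_mono norm_triangle_ineq)
          moreover have "norm ((t * \<rho>) *\<^sub>R e) \<le> 1 * \<rho>" using True \<rho> e by (simp add: mult_right_mono)
          moreover have "norm (z - c) \<le> D * \<rho>" using True D by simp
          ultimately show ?thesis by (simp add: distrib_right)
        qed
        then have "(norm (y - c))\<^sup>2 \<le> (norm (?u y) + (D + 1) * \<rho>)\<^sup>2" by (intro power_mono) auto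
        also have "\<dots> \<le> 2 * (norm (?u y))\<^sup>2 + 2 * ((D + 1) * \<rho>)\<^sup>2"
          using sum_squares_bound[of "norm (?u y)" "(D + 1) * \<rho>"] unfolding power2_sum by linarith
        finally have "(norm (y - c))\<^sup>2 / (8*l*\<rho>\<^sup>2) \<le> (2 * (norm (?u y))\<^sup>2 + 2 * ((D + 1) * \<rho>)\<^sup>2) / (8*l*\<rho>\<^sup>2)"
          using s by (intro divide_right_mono) auto
        also have "\<dots> = (norm (?u y))\<^sup>2 / (4*l*\<rho>\<^sup>2) + (D+1)\<^sup>2 / (4*l)"
        proof -
          have "(2 * A + 2 * (B * r)) / (8 * l * r) = A / (4 * l * r) + B / (4 * l)" if "r > 0" "l > 0" for A B r l :: real
            using that by (simp add: field_simps)
          then show ?thesis using s(5) \<rho>(1) unfolding power_mult_distrib by simp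
        qed
        also have "\<dots> \<le> (norm (?u y))\<^sup>2 / (2*\<tau>) + (D+1)\<^sup>2 / 4"
          using \<tau> s by (intro add_mono divide_left_mono) auto
        finally have q: "(norm (y - c))\<^sup>2 / (8*l*\<rho>\<^sup>2) + (norm (?u y))\<^sup>2 / (2*\<tau>) \<le> (norm (?u y))\<^sup>2 / \<tau> + (D+1)\<^sup>2 / 4"
          by (simp add: field_simps)
        have "-pi * (norm (?u y))\<^sup>2 / \<tau> \<le> pi * (D+1)\<^sup>2 / 4 + (-pi * (norm (y - c))\<^sup>2 / (8*l*\<rho>\<^sup>2) + -pi * (norm (?u y))\<^sup>2 / (2*\<tau>))"
          using mult_left_mono[OF q, of pi] by (simp add: distrib_left)
        then have "gauss \<tau> (?u y) \<le> exp (pi * (D+1)\<^sup>2 / 4) * (gauss (8*l*\<rho>\<^sup>2) (y - c) * gauss (2*\<tau>) (?u y))"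
          by (simp only: mult_exp_exp exp_le_cancel_iff)
        then have "ennreal (gauss \<tau> (?u y)) \<le> k * W y * g (?u y)"
          unfolding k_def W_def g_def by (simp only: ennreal_mult'[symmetric] exp_ge_zero mult_nonneg_nonneg ennreal_leI mult.assoc)
        then show ?thesis by (intro mult_left_mono) auto
      next
        case False then show ?thesis by (auto simp: J_def I_def)
      qed
      have L: "L t = (\<integral>\<^sup>+y. E y * ennreal (gauss \<tau> (?u y)) \<partial>lborel)"
        unfolding L_def local_energy_def E_def
        by (intro nn_integral_cong) (simp add: ennreal_mult' diff_diff_eq)
      have "J z * a * (I t * L t) = (\<integral>\<^sup>+y. J z * a * I t * (E y * ennreal (gauss \<tau> (?u y))) \<partial>lborel)"
        unfolding L by (subst nn_integral_cmult, measurable) (simp only: mult_ac)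
      also have "\<dots> \<le> (\<integral>\<^sup>+y. F y z t \<partial>lborel)"
      proof (rule nn_integral_mono)
        fix y
        have "(a * E y) * (J z * (I t * ennreal (gauss \<tau> (?u y)))) \<le> (a * E y) * (J z * (I t * (k * W y * g (?u y))))"
          by (rule mult_left_mono[OF pt]) simp
        then show "J z * a * I t * (E y * ennreal (gauss \<tau> (?u y))) \<le> F y z t"
          by (simp only: F_def mult_ac)
      qed
      finally show "J z * a * (I t * L t) \<le> (\<integral>\<^sup>+y. F y z t \<partial>lborel)" .
    qed
    finally show "J z * dens (packet \<tau> v f) z \<le> (\<integral>\<^sup>+t. (\<integral>\<^sup>+y. F y z t \<partial>lborel) \<partial>lborel)" .
  qed
  also have "\<dots> = (\<integral>\<^sup>+z. (\<integral>\<^sup>+y. (\<integral>\<^sup>+t. F y z t \<partial>lborel) \<partial>lborel) \<partial>\<nu>)"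
    by (intro nn_integral_cong lborel_pair.Fubini'[symmetric]) (unfold F_def case_prod_beta', measurable)
  also have "\<dots> = (\<integral>\<^sup>+y. (\<integral>\<^sup>+z. (\<integral>\<^sup>+t. F y z t \<partial>lborel) \<partial>\<nu>) \<partial>lborel)"
    by (rule P.Fubini'[symmetric]) (unfold F_def case_prod_beta', measurable)
  also have "\<dots> \<le> (\<integral>\<^sup>+y. (a * k * (b * S)) * (W y * E y) \<partial>lborel)"
  proof (rule nn_integral_mono)
    fix y
    have "(\<integral>\<^sup>+z. (\<integral>\<^sup>+t. F y z t \<partial>lborel) \<partial>\<nu>) = (\<integral>\<^sup>+z. a * k * (E y * W y) * (J z * (\<integral>\<^sup>+t. I t * g (y - z - (t * \<rho>) *\<^sub>R e) \<partial>lborel)) \<partial>\<nu>)"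
      unfolding F_def by (intro nn_integral_cong, subst nn_integral_cmult, measurable, subst nn_integral_cmult) auto
    also have "\<dots> = a * k * (E y * W y) * (\<integral>\<^sup>+z. J z * (\<integral>\<^sup>+t. I t * g (y - z - (t * \<rho>) *\<^sub>R e) \<partial>lborel) \<partial>\<nu>)"
      by (rule nn_integral_cmult) measurable
    also have "\<dots> \<le> a * k * (E y * W y) * (b * S)"
      unfolding J_def I_def g_def b_def
      by (rule mult_left_mono[OF gaussian_tube_le_capsules[OF \<nu> Q e \<rho>(2) s(2,4,5) S[OF e]]]) simp
    finally show "(\<integral>\<^sup>+z. (\<integral>\<^sup>+t. F y z t \<partial>lborel) \<partial>\<nu>) \<le> (a * k * (b * S)) * (W y * E y)"
      by (simp only: mult_ac)
  qed
  also have "\<dots> = (a * k * (b * S)) * (\<integral>\<^sup>+y. W y * E y \<partial>lborel)"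
    by (rule nn_integral_cmult) measurable
  also have "a * k * (b * S) = ennreal (K * (s/\<rho>) * (1 / sqrt \<tau>) ^ DIM('a)) * S"
  proof -
    have eq: "ennreal (A * t) * ennreal B * (ennreal (C * r) * S) = ennreal (A * B * C * r * t) * S"
      if "A \<ge> 0" "B \<ge> 0" "C \<ge> 0" "r \<ge> 0" "t \<ge> 0" for A B C r t :: real
    proof -
      have "ennreal (A * t) * ennreal B * (ennreal (C * r) * S) = ennreal (A * t * B * (C * r)) * S"
        using that by (simp only: ennreal_mult' mult_nonneg_nonneg mult.assoc)
      also have "A * t * B * (C * r) = A * B * C * r * t" by simp
      finally show ?thesis .
    qed
    show ?thesis unfolding a_def k_def b_def K_def
      by (rule eq) (use s \<tau> \<rho> in auto)
  qed
  finally show ?thesis unfolding J_def W_def E_def .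
qed

text \<open>
  Split the energy at scale \<open>s\<close> into packets, apply the tube bound to each of them, and resum the packets of half the
  parameter by the frame identity.  The powers of \<open>\<tau>\<close> cancel.  The lower bound on \<open>l\<close> makes \<open>\<tau> = 2 l s\<^sup>2\<close> large enough for the
  packets near the origin to be absorbed.
\<close>

lemma two_scale_step:
  assumes D: "D \<ge> 0"
  shows "\<exists>l0\<ge>1. \<forall>l\<ge>l0. \<exists>C>0. two_scale_bound \<sigma> D l C"
proof -
  obtain \<tau>0 where \<tau>0: "\<tau>0 \<ge> 1" and dom: "\<And>\<tau> f z. \<tau> \<ge> \<tau>0 \<Longrightarrow> integrable \<sigma> f \<Longrightarrow> energy f (\<tau>/2) z \<le>
    ennreal (2 * \<tau> ^ DIM('a)) * (\<integral>\<^sup>+v. indicator {v. 1/2 \<le> norm v} v * dens (packet \<tau> v f) z \<partial>lborel)"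
    using outer_packets_dominate by blast
  show ?thesis
  proof (rule exI[of _ \<tau>0], rule conjI[OF \<tau>0], intro allI impI)
    fix l :: real assume l: "\<tau>0 \<le> l"
    define K where "K = (4 * (2 * (real DIM('a) + 4) * 2 ^ DIM('a))\<^sup>2) * exp (pi * (D+1)\<^sup>2 / 4) * (exp (pi/8) * (2 * sqrt (8*l)) ^ DIM('a) / unit_ball_vol DIM('a))"
    have K: "K > 0" using l \<tau>0 by (auto simp: K_def intro!: mult_pos_pos divide_pos_pos zero_less_power)
    show "\<exists>C>0. two_scale_bound \<sigma> D l C"
      unfolding two_scale_bound_def
    proof (intro exI[of _ "2 * 2 ^ DIM('a) * K"] conjI allI impI)
      fix f :: "'a \<Rightarrow> complex" and \<nu> :: "'a measure" and Q :: "'a set" and c :: 'a and s \<rho> :: real and S :: ennreal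
      assume f: "integrable \<sigma> f" and \<nu>: "sigma_finite_measure \<nu>" "sets \<nu> = sets borel"
        and Q: "Q \<in> sets borel" and near: "\<forall>z\<in>Q. norm (z - c) \<le> D * \<rho>"
        and s: "1 \<le> s" "s \<le> \<rho>" "\<rho> \<le> s\<^sup>2"
        and S: "\<forall>q e. norm e = 1 \<longrightarrow> emeasure \<nu> (Q \<inter> {z. q - z \<in> capsule s \<rho> e}) \<le> S"
      interpret \<nu>: sigma_finite_measure \<nu> by fact
      interpret P: pair_sigma_finite \<nu> "lborel :: 'a measure" ..
      note [measurable_cong] = \<nu>(2) and [measurable] = Q
      have [measurable]: "f \<in> borel_measurable \<sigma>" using f by auto
      have [measurable]: "{v::'a. 1/2 \<le> norm v} \<in> sets borel" by auto
      define \<tau> where "\<tau> = 2 * l * s\<^sup>2"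
      have s2: "1 \<le> s\<^sup>2" "s\<^sup>2 \<le> \<rho>\<^sup>2" using s by (auto intro: power_mono)
      have l1: "l \<ge> 1" using l \<tau>0 by simp
      have \<tau>: "\<tau> > 0" "\<tau> \<ge> \<tau>0" "4 * \<tau> \<le> 8 * l * \<rho>\<^sup>2"
      proof -
        have "l * 1 \<le> \<tau>" unfolding \<tau>_def using l1 s2 by (intro mult_mono) auto
        then show "\<tau> > 0" "\<tau> \<ge> \<tau>0" using l l1 by linarith+
        show "4 * \<tau> \<le> 8 * l * \<rho>\<^sup>2" using s2 l1 by (simp add: \<tau>_def)
      qed
      define J where "J = (indicator Q :: 'a \<Rightarrow> ennreal)"
      define d where "d = (indicator {v::'a. 1/2 \<le> norm v} :: 'a \<Rightarrow> ennreal)"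
      define P where "P = (\<lambda>v z. dens (packet \<tau> v f) z)"
      define E where "E = (\<lambda>v y. dens (packet (\<tau>/2) v f) y)"
      define W where "W = (\<lambda>y::'a. ennreal (gauss (8*l*\<rho>\<^sup>2) (y - c)))"
      define a where "a = ennreal (2 * \<tau> ^ DIM('a))"
      define b where "b = ennreal (K * (s/\<rho>) * (1 / sqrt \<tau>) ^ DIM('a)) * S"
      have [measurable]: "J \<in> borel_measurable borel" "d \<in> borel_measurable borel" "W \<in> borel_measurable borel"
        unfolding J_def d_def W_def by measurable
      have "(\<integral>\<^sup>+z. J z * energy f (l * s\<^sup>2) z \<partial>\<nu>) \<le> (\<integral>\<^sup>+z. (\<integral>\<^sup>+v. a * (J z * (d v * P v z)) \<partial>lborel) \<partial>\<nu>)"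
      proof (rule nn_integral_mono)
        fix z
        have "J z * energy f (l * s\<^sup>2) z \<le> J z * (a * (\<integral>\<^sup>+v. d v * P v z \<partial>lborel))"
          using dom[OF \<tau>(2) f, of z] unfolding a_def d_def P_def by (intro mult_left_mono) (auto simp: \<tau>_def)
        also have "\<dots> = a * J z * (\<integral>\<^sup>+v. d v * P v z \<partial>lborel)" by (simp only: mult_ac)
        also have "\<dots> = (\<integral>\<^sup>+v. a * J z * (d v * P v z) \<partial>lborel)"
          unfolding P_def by (rule nn_integral_cmult[symmetric]) measurable
        finally show "J z * energy f (l * s\<^sup>2) z \<le> (\<integral>\<^sup>+v. a * (J z * (d v * P v z)) \<partial>lborel)" by (simp only: mult_ac)
      qed
      also have "\<dots> = (\<integral>\<^sup>+v. (\<integral>\<^sup>+z. a * (J z * (d v * P v z)) \<partial>\<nu>) \<partial>lborel)"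
        unfolding P_def by (rule P.Fubini'[symmetric]) (unfold case_prod_beta', measurable)
      also have "\<dots> \<le> (\<integral>\<^sup>+v. (\<integral>\<^sup>+y. a * b * (W y * E v y) \<partial>lborel) \<partial>lborel)"
      proof (rule nn_integral_mono)
        fix v
        have "(\<integral>\<^sup>+z. a * (J z * (d v * P v z)) \<partial>\<nu>) = (a * d v) * (\<integral>\<^sup>+z. J z * P v z \<partial>\<nu>)"
          unfolding P_def by (subst nn_integral_cmult[symmetric], measurable) (simp only: mult_ac)
        also have "\<dots> \<le> a * (b * (\<integral>\<^sup>+y. W y * E v y \<partial>lborel))"
        proof (cases "1/2 \<le> norm v")
          case True
          have "(\<integral>\<^sup>+z. J z * P v z \<partial>\<nu>) \<le> b * (\<integral>\<^sup>+y. W y * E v y \<partial>lborel)"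
            unfolding J_def P_def W_def E_def b_def K_def
            by (rule packet_mass_le_tube_mass[OF f \<nu> Q D _ s \<tau>_def l1 _ True]) (use near S in auto)
          then show ?thesis using True by (simp add: d_def mult_left_mono)
        qed (simp add: d_def)
        also have "\<dots> = (\<integral>\<^sup>+y. a * b * (W y * E v y) \<partial>lborel)"
          unfolding E_def by (subst nn_integral_cmult, measurable) (simp only: mult.assoc)
        finally show "(\<integral>\<^sup>+z. a * (J z * (d v * P v z)) \<partial>\<nu>) \<le> (\<integral>\<^sup>+y. a * b * (W y * E v y) \<partial>lborel)" .
      qed
      also have "\<dots> = (\<integral>\<^sup>+y. (\<integral>\<^sup>+v. a * b * (W y * E v y) \<partial>lborel) \<partial>lborel)"
        unfolding E_def by (rule lborel_pair.Fubini'[symmetric]) (unfold case_prod_beta', measurable)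
      also have "\<dots> = (\<integral>\<^sup>+y. a * b * ennreal ((2/\<tau>) ^ DIM('a)) * (W y * energy f (\<tau>/4) y) \<partial>lborel)"
      proof (rule nn_integral_cong)
        fix y
        have "energy f (\<tau>/4) y = ennreal ((\<tau>/2) ^ DIM('a)) * (\<integral>\<^sup>+v. E v y \<partial>lborel)"
          using frame_eq_energy[OF f, of "\<tau>/2" y] \<tau> unfolding E_def by simp
        then have "ennreal ((2/\<tau>) ^ DIM('a)) * energy f (\<tau>/4) y = ennreal ((2/\<tau>) ^ DIM('a) * (\<tau>/2) ^ DIM('a)) * (\<integral>\<^sup>+v. E v y \<partial>lborel)"
          using \<tau> by (simp add: ennreal_mult' mult.assoc)
        also have "(2/\<tau>) ^ DIM('a) * (\<tau>/2) ^ DIM('a) = 1" using \<tau> by (simp flip: power_mult_distrib)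
        finally have "(\<integral>\<^sup>+v. E v y \<partial>lborel) = ennreal ((2/\<tau>) ^ DIM('a)) * energy f (\<tau>/4) y" by simp
        moreover have "(\<integral>\<^sup>+v. a * b * (W y * E v y) \<partial>lborel) = a * b * W y * (\<integral>\<^sup>+v. E v y \<partial>lborel)"
          unfolding E_def by (subst nn_integral_cmult[symmetric], measurable) (simp only: mult_ac)
        ultimately show "(\<integral>\<^sup>+v. a * b * (W y * E v y) \<partial>lborel) = a * b * ennreal ((2/\<tau>) ^ DIM('a)) * (W y * energy f (\<tau>/4) y)"
          by (simp only: mult_ac)
      qed
      also have "\<dots> = a * b * ennreal ((2/\<tau>) ^ DIM('a)) * (\<integral>\<^sup>+y. W y * energy f (\<tau>/4) y \<partial>lborel)"
        by (rule nn_integral_cmult) measurable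
      also have "\<dots> \<le> a * b * ennreal ((2/\<tau>) ^ DIM('a)) * (ennreal (sqrt \<tau> ^ DIM('a)) * energy f (2 * (8*l*\<rho>\<^sup>2)) c)"
        unfolding W_def by (intro mult_left_mono energy_smoothing \<tau>) auto
      also have "\<dots> = ennreal (2 * 2 ^ DIM('a) * K * (s/\<rho>)) * S * energy f (16 * l * \<rho>\<^sup>2) c"
      proof -
        have eq: "ennreal x * (ennreal (y * r * t) * S) * ennreal u * (ennreal w * X) = ennreal (x * y * r * (t * u * w)) * S * X"
          if "x \<ge> 0" "y \<ge> 0" "r \<ge> 0" "t \<ge> 0" "u \<ge> 0" "w \<ge> 0" for x y r t u w :: real and X
        proof -
          have "ennreal x * (ennreal (y * r * t) * S) * ennreal u * (ennreal w * X) = (ennreal x * ennreal (y * r * t) * ennreal u * ennreal w) * S * X"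
            by (simp only: mult_ac)
          also have "ennreal x * ennreal (y * r * t) * ennreal u * ennreal w = ennreal (x * (y * r * t) * u * w)"
            using that by (simp only: ennreal_mult' mult_nonneg_nonneg)
          also have "x * (y * r * t) * u * w = x * y * r * (t * u * w)" by simp
          finally show ?thesis .
        qed
        have "a * b * ennreal ((2/\<tau>) ^ DIM('a)) * (ennreal (sqrt \<tau> ^ DIM('a)) * energy f (2 * (8*l*\<rho>\<^sup>2)) c)
          = ennreal ((2 * \<tau> ^ DIM('a)) * K * (s/\<rho>) * ((1 / sqrt \<tau>) ^ DIM('a) * (2/\<tau>) ^ DIM('a) * sqrt \<tau> ^ DIM('a))) * S * energy f (2 * (8*l*\<rho>\<^sup>2)) c"
          unfolding a_def b_def using \<tau> K s by (intro eq) auto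
        also have "(2 * \<tau> ^ DIM('a)) * K * (s/\<rho>) * ((1 / sqrt \<tau>) ^ DIM('a) * (2/\<tau>) ^ DIM('a) * sqrt \<tau> ^ DIM('a))
          = 2 * K * (s/\<rho>) * (\<tau> * (1 / sqrt \<tau>) * (2/\<tau>) * sqrt \<tau>) ^ DIM('a)"
          unfolding power_mult_distrib by (simp only: mult_ac)
        also have "\<tau> * (1 / sqrt \<tau>) * (2/\<tau>) * sqrt \<tau> = 2" using \<tau> by simp
        finally show ?thesis by (simp add: mult_ac)
      qed
      finally show "(\<integral>\<^sup>+z. indicator Q z * energy f (l * s\<^sup>2) z \<partial>\<nu>) \<le> ennreal (2 * 2 ^ DIM('a) * K * (s/\<rho>)) * S * energy f (16 * l * \<rho>\<^sup>2) c"
        unfolding J_def .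
    qed (use K in simp)
  qed
qed

end

section \<open>Surface measure, tubes and dyadic cubes\<close>

lemma sets_sphere_measure: "sets sphere_measure = sets (restrict_space borel (sphere 0 1))"
  by (simp add: sphere_measure_def)

lemma space_sphere_measure: "space sphere_measure = sphere 0 1"
  using sets_eq_imp_space_eq[OF sets_sphere_measure] by (simp add: space_restrict_space)

lemma measurable_radial_projection:
  "(\<lambda>x::real^'n. x /\<^sub>R norm x) \<in> restrict_space lborel (cball 0 1 - {0}) \<rightarrow>\<^sub>M restrict_space borel (sphere 0 1)"
proof (rule measurable_restrict_space2)
  show "(\<lambda>x::real^'n. x /\<^sub>R norm x) \<in> space (restrict_space lborel (cball 0 1 - {0})) \<rightarrow> sphere 0 1"
    by (auto simp: space_restrict_space)
  show "(\<lambda>x::real^'n. x /\<^sub>R norm x) \<in> borel_measurable (restrict_space lborel (cball 0 1 - {0}))"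
    by (intro measurable_restrict_space1) measurable
qed

lemma nn_integral_sphere_measure:
  fixes g :: "real^'n \<Rightarrow> ennreal"
  assumes [measurable]: "g \<in> borel_measurable borel"
  shows "(\<integral>\<^sup>+\<omega>. g \<omega> \<partial>sphere_measure) = of_nat CARD('n) * (\<integral>\<^sup>+x. g (x /\<^sub>R norm x) * indicator (cball 0 1 - {0}) x \<partial>lborel)"
proof -
  have g: "g \<in> borel_measurable (restrict_space borel (sphere 0 1))"
    by (intro measurable_restrict_space1) measurable
  have "(\<integral>\<^sup>+\<omega>. g \<omega> \<partial>sphere_measure) = of_nat CARD('n) * (\<integral>\<^sup>+x. g (x /\<^sub>R norm x) \<partial>restrict_space lborel (cball 0 1 - {0}))"
    unfolding sphere_measure_def
    by (subst nn_integral_scale_measure, simp add: g, subst nn_integral_distr[OF measurable_radial_projection])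
       (simp_all add: g)
  also have "(\<integral>\<^sup>+x. g (x /\<^sub>R norm x) \<partial>restrict_space lborel (cball 0 1 - {0})) = (\<integral>\<^sup>+x. g (x /\<^sub>R norm x) * indicator (cball 0 1 - {0}) x \<partial>lborel)"
    by (rule nn_integral_restrict_space) simp
  finally show ?thesis .
qed

lemma sphere_carried_sphere_measure: "sphere_carried (sphere_measure :: (real^'n) measure)"
proof (intro sphere_carried.intro sphere_carried_axioms.intro)
  have "emeasure (sphere_measure :: (real^'n) measure) (space sphere_measure) = (\<integral>\<^sup>+\<omega>. 1 \<partial>(sphere_measure :: (real^'n) measure))" by simp
  also have "\<dots> = of_nat CARD('n) * emeasure lborel (cball (0::real^'n) 1 - {0})"
    by (subst nn_integral_sphere_measure) simp_all
  also have "\<dots> \<le> of_nat CARD('n) * emeasure lborel (cball (0::real^'n) 1)"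
    by (intro mult_left_mono emeasure_mono) auto
  also have "\<dots> < \<top>"
    using emeasure_lborel_cball_finite[of "0::real^'n" 1]
    by (simp add: ennreal_mult_less_top ennreal_of_nat_eq_real_of_nat)
  finally show "finite_measure (sphere_measure :: (real^'n) measure)" by (intro finite_measureI) simp
  show "(\<lambda>\<omega>. \<omega>) \<in> (sphere_measure :: (real^'n) measure) \<rightarrow>\<^sub>M borel"
    unfolding measurable_cong_sets[OF sets_sphere_measure refl] by (intro measurable_restrict_space1) simp
  show "norm \<omega> = 1" if "\<omega> \<in> space sphere_measure" for \<omega> :: "real^'n"
    using that by (simp add: space_sphere_measure)
qed

text \<open>
  The bound says that caps of radius \<open>h = 1 / sqrt a\<close> have measure of order \<open>h^(d-1)\<close>.  In polar coordinates a point \<open>x = \<bar>x\<bar> \<omega>\<close> lies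
  within \<open>\<bar>\<omega> - \<omega>'\<bar> + h\<close> of \<open>t \<omega>'\<close> for all \<open>t\<close> in an interval of length \<open>h\<close> next to \<open>\<bar>x\<bar>\<close>.  So the cap Gaussian is at most \<open>1/h\<close>
  times an integral over \<open>t \<in> [0, 2]\<close> of Gaussians centred on the ray of \<open>\<omega>'\<close>, each of mass of order \<open>h^d\<close>.
\<close>

lemma gaussian_cap_bound:
  fixes \<omega>' :: "real^'n"
  assumes w: "norm \<omega>' = 1" and a: "a \<ge> 1"
  shows "(\<integral>\<^sup>+\<omega>. ennreal (exp (-pi * a * (norm (\<omega> - \<omega>'))\<^sup>2)) \<partial>sphere_measure)
    \<le> ennreal (real CARD('n) * (exp pi * sqrt a * (2 * sqrt (2/a) ^ CARD('n))))"
proof -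
  define G where "G = (\<lambda>t (x::real^'n). ennreal (gauss (2/a) (x - t *\<^sub>R \<omega>')))"
  define I where "I = (indicator {0..2} :: real \<Rightarrow> ennreal)"
  have [measurable]: "(\<lambda>x. G (fst x) (snd x)) \<in> borel_measurable (lborel \<Otimes>\<^sub>M lborel)" "I \<in> borel_measurable borel"
    unfolding G_def I_def by measurable
  have [measurable]: "(\<lambda>t. G t x) \<in> borel_measurable borel" "(\<lambda>x. G t x) \<in> borel_measurable borel" for t x
    unfolding G_def by measurable
  have pt: "ennreal (exp (-pi * a * (norm (x /\<^sub>R norm x - \<omega>'))\<^sup>2)) * indicator (cball 0 1 - {0}) x
      \<le> ennreal (exp pi * sqrt a) * (\<integral>\<^sup>+t. I t * G t x \<partial>lborel)" for x
  proof (cases "x \<in> cball 0 1 - {0}")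
    case True
    define \<omega> where "\<omega> = x /\<^sub>R norm x"
    define r where "r = norm x"
    have r: "0 < r" "r \<le> 1" "x = r *\<^sub>R \<omega>" using True by (auto simp: r_def \<omega>_def)
    define h where "h = 1 / sqrt a"
    have h: "0 < h" "h \<le> 1" "h\<^sup>2 = 1/a" using a by (auto simp: h_def power_divide)
    have "ennreal h * ennreal (exp (-pi * a * (norm (\<omega> - \<omega>'))\<^sup>2)) = (\<integral>\<^sup>+t. ennreal (exp (-pi * a * (norm (\<omega> - \<omega>'))\<^sup>2)) * indicator {r..r+h} t \<partial>lborel)"
      using h by (subst nn_integral_cmult_indicator) (auto simp: mult.commute)
    also have "\<dots> \<le> (\<integral>\<^sup>+t. ennreal (exp pi) * (I t * G t x) \<partial>lborel)"
    proof (rule nn_integral_mono)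
      fix t
      show "ennreal (exp (-pi * a * (norm (\<omega> - \<omega>'))\<^sup>2)) * indicator {r..r+h} t \<le> ennreal (exp pi) * (I t * G t x)"
      proof (cases "t \<in> {r..r+h}")
        case True
        then have t: "I t = 1" "\<bar>r - t\<bar> \<le> h" using r h by (auto simp: I_def)
        have "x - t *\<^sub>R \<omega>' = r *\<^sub>R (\<omega> - \<omega>') + (r - t) *\<^sub>R \<omega>'" using r(3) by (simp add: algebra_simps)
        then have "(norm (x - t *\<^sub>R \<omega>'))\<^sup>2 \<le> 2 * (norm (r *\<^sub>R (\<omega> - \<omega>')))\<^sup>2 + 2 * (norm ((r - t) *\<^sub>R \<omega>'))\<^sup>2"
          using norm_add_sq_le by metis
        also have "\<dots> = 2 * (r\<^sup>2 * (norm (\<omega> - \<omega>'))\<^sup>2) + 2 * \<bar>r - t\<bar>\<^sup>2" using w by (simp add: power_mult_distrib)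
        also have "\<dots> \<le> 2 * (1 * (norm (\<omega> - \<omega>'))\<^sup>2) + 2 * h\<^sup>2"
          using r t(2) by (intro add_mono mult_left_mono mult_right_mono power_mono power_le_one) auto
        finally have "(norm (x - t *\<^sub>R \<omega>'))\<^sup>2 / (2/a) \<le> (2 * (norm (\<omega> - \<omega>'))\<^sup>2 + 2 * (1/a)) / (2/a)"
          using a h(3) by (intro divide_right_mono) auto
        also have "\<dots> = a * (norm (\<omega> - \<omega>'))\<^sup>2 + 1" using a by (simp add: field_simps)
        finally have q: "(norm (x - t *\<^sub>R \<omega>'))\<^sup>2 / (2/a) \<le> a * (norm (\<omega> - \<omega>'))\<^sup>2 + 1" .
        have "-pi * a * (norm (\<omega> - \<omega>'))\<^sup>2 \<le> pi + -pi * (norm (x - t *\<^sub>R \<omega>'))\<^sup>2 / (2/a)"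
          using mult_left_mono[OF q, of pi] by (simp add: distrib_left mult.assoc)
        then have "exp (-pi * a * (norm (\<omega> - \<omega>'))\<^sup>2) \<le> exp pi * gauss (2/a) (x - t *\<^sub>R \<omega>')"
          by (simp only: mult_exp_exp exp_le_cancel_iff)
        then have "ennreal (exp (-pi * a * (norm (\<omega> - \<omega>'))\<^sup>2)) \<le> ennreal (exp pi) * G t x"
          unfolding G_def by (simp only: ennreal_mult'[symmetric] exp_ge_zero ennreal_leI)
        then show ?thesis using True t(1) by simp
      qed simp
    qed
    also have "\<dots> = ennreal (exp pi) * (\<integral>\<^sup>+t. I t * G t x \<partial>lborel)" by (rule nn_integral_cmult) measurable
    finally have "ennreal (sqrt a) * (ennreal h * ennreal (exp (-pi * a * (norm (\<omega> - \<omega>'))\<^sup>2))) \<le> ennreal (sqrt a) * (ennreal (exp pi) * (\<integral>\<^sup>+t. I t * G t x \<partial>lborel))"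
      by (rule mult_left_mono) simp
    moreover have "ennreal (sqrt a) * (ennreal h * X) = X" for X
    proof -
      have "ennreal (sqrt a) * ennreal h = 1" using a by (simp add: h_def flip: ennreal_mult')
      then show ?thesis by (simp flip: mult.assoc)
    qed
    moreover have "ennreal (sqrt a) * (ennreal (exp pi) * X) = ennreal (exp pi * sqrt a) * X" for X
    proof -
      have "ennreal (sqrt a) * (ennreal (exp pi) * X) = (ennreal (exp pi) * ennreal (sqrt a)) * X" by (simp only: mult_ac)
      then show ?thesis by (simp only: ennreal_mult'[symmetric] exp_ge_zero)
    qed
    ultimately show ?thesis using True by (simp add: \<omega>_def)
  qed simp
  have "(\<integral>\<^sup>+x. ennreal (exp (-pi * a * (norm (x /\<^sub>R norm x - \<omega>'))\<^sup>2)) * indicator (cball 0 1 - {0}) x \<partial>lborel)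
    \<le> (\<integral>\<^sup>+x. ennreal (exp pi * sqrt a) * (\<integral>\<^sup>+t. I t * G t x \<partial>lborel) \<partial>lborel)"
    by (rule nn_integral_mono) (rule pt)
  also have "\<dots> = ennreal (exp pi * sqrt a) * (\<integral>\<^sup>+x. (\<integral>\<^sup>+t. I t * G t x \<partial>lborel) \<partial>lborel)"
    unfolding G_def by (rule nn_integral_cmult) measurable
  also have "(\<integral>\<^sup>+x. (\<integral>\<^sup>+t. I t * G t x \<partial>lborel) \<partial>lborel) = (\<integral>\<^sup>+t. (\<integral>\<^sup>+x. I t * G t x \<partial>lborel) \<partial>lborel)"
    unfolding G_def by (rule lborel_pair.Fubini'[symmetric]) (unfold case_prod_beta', measurable)
  also have "\<dots> = (\<integral>\<^sup>+t. I t * ennreal (sqrt (2/a) ^ CARD('n)) \<partial>lborel)"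
  proof (rule nn_integral_cong)
    fix t
    have "(\<integral>\<^sup>+x. G t x \<partial>lborel) = ennreal (sqrt (2/a) ^ CARD('n))"
      unfolding G_def using gaussian_integral(3)[of "2/a" "t *\<^sub>R \<omega>'"] a by simp
    then show "(\<integral>\<^sup>+x. I t * G t x \<partial>lborel) = I t * ennreal (sqrt (2/a) ^ CARD('n))"
      by (subst nn_integral_cmult) simp_all
  qed
  also have "\<dots> = ennreal (2 * sqrt (2/a) ^ CARD('n))"
    by (subst nn_integral_multc) (simp_all add: I_def ennreal_mult')
  also have "ennreal (exp pi * sqrt a) * \<dots> = ennreal (exp pi * sqrt a * (2 * sqrt (2/a) ^ CARD('n)))"
    using a by (intro ennreal_mult'[symmetric]) simp
  finally have X: "(\<integral>\<^sup>+x. ennreal (exp (-pi * a * (norm (x /\<^sub>R norm x - \<omega>'))\<^sup>2)) * indicator (cball 0 1 - {0}) x \<partial>lborel)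
    \<le> ennreal (exp pi * sqrt a * (2 * sqrt (2/a) ^ CARD('n)))" .
  have "(\<integral>\<^sup>+\<omega>. ennreal (exp (-pi * a * (norm (\<omega> - \<omega>'))\<^sup>2)) \<partial>sphere_measure)
    = of_nat CARD('n) * (\<integral>\<^sup>+x. ennreal (exp (-pi * a * (norm (x /\<^sub>R norm x - \<omega>'))\<^sup>2)) * indicator (cball 0 1 - {0}) x \<partial>lborel)"
    by (rule nn_integral_sphere_measure) measurable
  also have "\<dots> \<le> of_nat CARD('n) * ennreal (exp pi * sqrt a * (2 * sqrt (2/a) ^ CARD('n)))"
    by (rule mult_left_mono[OF X]) simp
  also have "\<dots> = ennreal (real CARD('n) * (exp pi * sqrt a * (2 * sqrt (2/a) ^ CARD('n))))"
    by (simp add: ennreal_of_nat_eq_real_of_nat ennreal_mult')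
  finally show ?thesis .
qed

lemma local_energy_sphere_measure_le:
  fixes z :: "real^'n"
  assumes f: "integrable sphere_measure f" and a: "a \<ge> 1"
  shows "local_energy sphere_measure f a z
    \<le> ennreal (2 * real CARD('n) * exp pi * sqrt 2 ^ CARD('n) * sqrt a) * (\<integral>\<^sup>+\<omega>. ennreal ((cmod (f \<omega>))\<^sup>2) \<partial>sphere_measure)"
proof -
  interpret sphere_carried "sphere_measure :: (real^'n) measure" by (rule sphere_carried_sphere_measure)
  have "local_energy sphere_measure f a z
    \<le> ennreal (sqrt a ^ DIM(real^'n) * (real CARD('n) * (exp pi * sqrt a * (2 * sqrt (2/a) ^ CARD('n))))) * (\<integral>\<^sup>+\<omega>. ennreal ((cmod (f \<omega>))\<^sup>2) \<partial>sphere_measure)"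
    using a by (intro local_energy_le_norm f gaussian_cap_bound norm_point) auto
  also have "sqrt a ^ DIM(real^'n) * (real CARD('n) * (exp pi * sqrt a * (2 * sqrt (2/a) ^ CARD('n))))
    = 2 * real CARD('n) * exp pi * (sqrt a * sqrt (2/a)) ^ CARD('n) * sqrt a"
    unfolding power_mult_distrib by simp
  also have "sqrt a * sqrt (2/a) = sqrt 2" using a by (simp flip: real_sqrt_mult)
  finally show ?thesis .
qed

lemma extension_op_eq_sphere_ft: "extension_op f x = sphere_ft sphere_measure f x"
proof -
  have "exp (- 2 * of_real pi * \<i> * of_real (x \<bullet> \<omega>)) = cis (-2*pi*(x \<bullet> \<omega>))" for \<omega>
    by (simp add: cis_conv_exp mult_ac)
  then show ?thesis by (simp add: extension_op_def sphere_ft_def)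
qed

text \<open>
  A capsule of width \<open>s\<close> and length parameter \<open>\<rho>\<close> has total length \<open>\<rho> + s \<le> 2 \<rho>\<close>, so two consecutive boxes cover it.
\<close>

lemma capsule_subset_two_tubes:
  fixes q e :: "real^'n"
  assumes e: "norm e = 1" and s: "0 < s" "s \<le> \<rho>"
  obtains T1 T2 where "T1 \<in> tubes s \<rho>" "T2 \<in> tubes s \<rho>" "{z. q - z \<in> capsule s \<rho> e} \<subseteq> T1 \<union> T2"
proof -
  fix k :: 'n
  \<comment> \<open>The sign is that of \<open>z\<close> in \<open>q - z \<in> capsule s \<rho> e\<close>, which runs from \<open>q\<close> in direction \<open>-e\<close>.\<close>
  have "norm (axis k 1 :: real^'n) = norm (- e)" using e by simp
  then obtain U :: "real^'n \<Rightarrow> real^'n" where U: "orthogonal_transformation U" "U (axis k 1) = - e"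
    by (rule orthogonal_transformation_exists)
  have lin: "linear U" using U(1) by (rule orthogonal_transformation_linear)
  define l :: "real^'n" where "l = (\<chi> i. if i = k then \<rho> else s)"
  define o1 :: "real^'n" where "o1 = (\<chi> i. - (s/2))"
  define o2 :: "real^'n" where "o2 = (\<chi> i. if i = k then \<rho> - s/2 else - (s/2))"
  define T where "T = (\<lambda>o'. (\<lambda>x. (q + U o') + U x) ` cbox 0 l)"
  have T: "T o' \<in> tubes s \<rho>" for o'
    unfolding T_def tubes_def l_def using U(1) by blast
  have "{z. q - z \<in> capsule s \<rho> e} \<subseteq> T o1 \<union> T o2"
  proof
    fix z assume "z \<in> {z. q - z \<in> capsule s \<rho> e}"
    then obtain t where t: "0 \<le> t" "t \<le> 1" and n: "norm (q - z - (t * \<rho>) *\<^sub>R e) \<le> s/2" by (auto simp: capsule_def)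
    obtain b where b: "q - z - (t * \<rho>) *\<^sub>R e = U b"
      using orthogonal_transformation_surj[OF U(1)] by (metis surjD)
    have nb: "norm b \<le> s/2" using n unfolding b orthogonal_transformation_norm[OF U(1)] .
    have bi: "\<bar>b $ i\<bar> \<le> s/2" for i using component_le_norm_cart[of b i] nb by linarith
    define x where "x = (t * \<rho>) *\<^sub>R axis k 1 - b"
    have z: "z = q + U x"
    proof -
      have "U x = - ((t * \<rho>) *\<^sub>R e) - U b" unfolding x_def linear_diff[OF lin] linear_cmul[OF lin] U(2) by simp
      then show ?thesis unfolding b[symmetric] by simp
    qed
    define m where "m = t * \<rho>"
    have x: "x $ i = (if i = k then m else 0) - b $ i" for i by (simp add: x_def axis_def m_def)
    have t\<rho>: "0 \<le> m" "m \<le> \<rho>" unfolding m_def using t s mult_right_mono[of t 1 \<rho>] by auto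
    have mem: "z \<in> T o'" if "x - o' \<in> cbox 0 l" for o'
    proof -
      have "z = (q + U o') + U (x - o')" unfolding z linear_diff[OF lin] by simp
      then show ?thesis using that by (auto simp: T_def)
    qed
    show "z \<in> T o1 \<union> T o2"
    proof (cases "x $ k \<le> \<rho> - s/2")
      case True
      have "x - o1 \<in> cbox 0 l"
        unfolding mem_box_cart
      proof
        fix i show "0 $ i \<le> (x - o1) $ i \<and> (x - o1) $ i \<le> l $ i"
          using bi[of i] t\<rho> True s by (auto simp: x o1_def l_def abs_le_iff)
      qed
      then show ?thesis using mem by blast
    next
      case False
      have "x - o2 \<in> cbox 0 l"
        unfolding mem_box_cart
      proof
        fix i show "0 $ i \<le> (x - o2) $ i \<and> (x - o2) $ i \<le> l $ i"
          using bi[of i] t\<rho> False s by (auto simp: x o2_def l_def abs_le_iff)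
      qed
      then show ?thesis using mem by blast
    qed
  qed
  then show thesis using that T by blast
qed

lemma tube_compact:
  assumes "T \<in> tubes s l" shows "compact (T :: (real^'n) set)"
proof -
  obtain a k and U :: "real^'n \<Rightarrow> real^'n" where U: "orthogonal_transformation U" and T: "T = (\<lambda>x. a + U x) ` cbox 0 (\<chi> i. if i = k then l else s)"
    using assms unfolding tubes_def by blast
  have "continuous_on A (\<lambda>x. a + U x)" for A
    by (intro continuous_intros linear_continuous_on linear_conv_bounded_linear[THEN iffD1] orthogonal_transformation_linear U)
  then show ?thesis unfolding T by (intro compact_continuous_image compact_cbox)
qed

definition grid_cube :: "real \<Rightarrow> ('n \<Rightarrow> int) \<Rightarrow> (real^'n) set" where
  "grid_cube s k = {x. \<forall>i. s * of_int (k i) \<le> x $ i \<and> x $ i < s * (of_int (k i) + 1)}"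

lemma dyadic_cubes_eq: "dyadic_cubes s = range (grid_cube s)"
  by (auto simp: dyadic_cubes_def grid_cube_def)

lemma grid_cube_borel [measurable]: "grid_cube s k \<in> sets borel"
proof -
  have "grid_cube s k = {x \<in> space borel. \<forall>i. s * of_int (k i) \<le> x $ i \<and> x $ i < s * (of_int (k i) + 1)}" by (simp add: grid_cube_def)
  also have "\<dots> \<in> sets borel" by measurable
  finally show ?thesis .
qed

lemma mem_grid_cube:
  assumes s: "s > 0" shows "x \<in> grid_cube s k \<longleftrightarrow> k = (\<lambda>i. \<lfloor>x $ i / s\<rfloor>)"
proof -
  have "(s * of_int (k i) \<le> x $ i \<and> x $ i < s * (of_int (k i) + 1)) \<longleftrightarrow> k i = \<lfloor>x $ i / s\<rfloor>" for i
  proof -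
    have "(s * of_int (k i) \<le> x $ i \<and> x $ i < s * (of_int (k i) + 1)) \<longleftrightarrow> of_int (k i) \<le> x $ i / s \<and> x $ i / s < of_int (k i) + 1"
      using s by (simp add: field_simps)
    also have "\<dots> \<longleftrightarrow> \<lfloor>x $ i / s\<rfloor> = k i" by (simp add: floor_eq_iff)
    finally show ?thesis by auto
  qed
  then show ?thesis by (auto simp: grid_cube_def fun_eq_iff)
qed

lemma grid_cube_diameter:
  fixes x y :: "real^'n"
  assumes s: "s > 0" and "x \<in> grid_cube s k" "y \<in> grid_cube s k"
  shows "norm (x - y) \<le> real CARD('n) * s"
proof -
  have "norm (x - y) \<le> (\<Sum>i\<in>UNIV. \<bar>(x - y) $ i\<bar>)" by (rule norm_le_l1_cart)
  also have "\<dots> \<le> (\<Sum>i\<in>(UNIV::'n set). s)"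
  proof (rule sum_mono)
    fix i
    have "s * of_int (k i) \<le> x $ i" "x $ i < s * of_int (k i) + s" "s * of_int (k i) \<le> y $ i" "y $ i < s * of_int (k i) + s"
      using assms by (auto simp: grid_cube_def distrib_left)
    then show "\<bar>(x - y) $ i\<bar> \<le> s" by simp
  qed
  finally show ?thesis by simp
qed

text \<open>
  Every point lies in exactly one cube of the grid.
\<close>

lemma nn_integral_grid_cubes:
  fixes \<nu> :: "(real^'n) measure"
  assumes s: "s > 0" and \<nu>: "sets \<nu> = sets borel" and g[measurable]: "g \<in> borel_measurable borel"
  shows "(\<integral>\<^sup>+z. g z \<partial>\<nu>) = (\<integral>\<^sup>+k. (\<integral>\<^sup>+z. indicator (grid_cube s k) z * g z \<partial>\<nu>) \<partial>count_space UNIV)"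
proof -
  note [measurable_cong] = \<nu>
  have "(\<integral>\<^sup>+k. indicator (grid_cube s k) z * g z \<partial>count_space UNIV) = g z" for z
  proof -
    have "(\<integral>\<^sup>+k. indicator (grid_cube s k) z * g z \<partial>count_space UNIV) = (\<integral>\<^sup>+k. g z * indicator {\<lambda>i. \<lfloor>z $ i / s\<rfloor>} k \<partial>count_space UNIV)"
      by (intro nn_integral_cong) (auto simp: mem_grid_cube[OF s] split: split_indicator)
    then show ?thesis by (simp add: nn_integral_cmult)
  qed
  then have "(\<integral>\<^sup>+z. g z \<partial>\<nu>) = (\<integral>\<^sup>+z. (\<integral>\<^sup>+k. indicator (grid_cube s k) z * g z \<partial>count_space UNIV) \<partial>\<nu>)" by simp
  also have "\<dots> = (\<integral>\<^sup>+k. (\<integral>\<^sup>+z. indicator (grid_cube s k) z * g z \<partial>\<nu>) \<partial>count_space UNIV)"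
    by (rule nn_integral_count_space_nn_integral) (auto intro: countableI_type)
  finally show ?thesis .
qed

section \<open>Summation over cubes and iteration over scales\<close>

text \<open>
  The supremum in the estimate, as a function of the two consecutive scales.
\<close>

definition tube_sup :: "(real^'n \<Rightarrow> real) \<Rightarrow> real \<Rightarrow> real \<Rightarrow> real" where
  "tube_sup w s \<rho> = Sup {rel_mass w Q T | Q T. Q \<in> dyadic_cubes \<rho> \<and> mass w Q \<noteq> 0 \<and> T \<in> tubes s \<rho>}"

text \<open>
  The weight as a Borel measure.  It is the image of a measure on the Lebesgue sets, since the weight is only assumed to
  be Lebesgue measurable.
\<close>

definition weight_measure :: "(real^'n \<Rightarrow> real) \<Rightarrow> (real^'n) measure" where
  "weight_measure w = distr (density lebesgue (\<lambda>x. ennreal (w x))) borel (\<lambda>x. x)"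

lemma sets_weight_measure [simp]: "sets (weight_measure w) = sets borel"
  by (simp add: weight_measure_def)

lemma measurable_id_density_lebesgue: "(\<lambda>x. x) \<in> density lebesgue h \<rightarrow>\<^sub>M borel"
  by (simp add: measurable_completion)

lemma nn_integral_weight_measure:
  assumes w: "w \<in> borel_measurable lebesgue" and g: "g \<in> borel_measurable borel"
  shows "(\<integral>\<^sup>+x. g x \<partial>weight_measure w) = (\<integral>\<^sup>+x. ennreal (w x) * g x \<partial>lebesgue)"
proof -
  have [measurable]: "w \<in> borel_measurable lebesgue" "g \<in> borel_measurable lebesgue"
    using w g by (auto intro: measurable_completion)
  show ?thesis unfolding weight_measure_def
    by (subst nn_integral_distr[OF measurable_id_density_lebesgue]) (simp_all add: g nn_integral_density)
qed

lemma emeasure_weight_measure: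
  assumes w: "integrable lebesgue w" "\<And>x. 0 \<le> w x" and A: "A \<in> sets borel"
  shows "emeasure (weight_measure w) A = ennreal (mass w A)"
proof -
  have A': "A \<in> sets lebesgue" using A by (simp add: sets_completionI_sets)
  have i: "integrable lebesgue (\<lambda>x. indicator A x *\<^sub>R w x)"
    by (rule integrable_mult_indicator[OF A' w(1)])
  have "emeasure (weight_measure w) A = (\<integral>\<^sup>+x. indicator A x \<partial>weight_measure w)"
    using A by simp
  also have "\<dots> = (\<integral>\<^sup>+x. ennreal (w x) * indicator A x \<partial>lebesgue)"
    using w A by (intro nn_integral_weight_measure) auto
  also have "\<dots> = (\<integral>\<^sup>+x. ennreal (indicator A x *\<^sub>R w x) \<partial>lebesgue)"
    by (intro nn_integral_cong) (auto split: split_indicator)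
  also have "\<dots> = ennreal (mass w A)"
    unfolding mass_def set_lebesgue_integral_def using w by (intro nn_integral_eq_integral i) auto
  finally show ?thesis .
qed

lemma mass_mono:
  assumes w: "integrable lebesgue w" "\<And>x. 0 \<le> w x" and AB: "A \<in> sets borel" "B \<in> sets borel" "A \<subseteq> B"
  shows "mass w A \<le> mass w B"
proof -
  have "emeasure (weight_measure w) A \<le> emeasure (weight_measure w) B" using AB by (intro emeasure_mono) auto
  moreover have "0 \<le> mass w B" unfolding mass_def set_lebesgue_integral_def using w by (intro integral_nonneg_AE) auto
  ultimately show ?thesis using w AB by (simp add: emeasure_weight_measure)
qed

lemma mass_nonneg: "(\<And>x. 0 \<le> w x) \<Longrightarrow> 0 \<le> mass w A"
  unfolding mass_def set_lebesgue_integral_def by (intro integral_nonneg_AE) auto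

lemma tube_borel: "T \<in> tubes s \<rho> \<Longrightarrow> (T :: (real^'n) set) \<in> sets borel"
  by (intro borel_closed compact_imp_closed tube_compact)

lemma cube_borel: "Q \<in> dyadic_cubes \<rho> \<Longrightarrow> (Q :: (real^'n) set) \<in> sets borel"
  by (auto simp: dyadic_cubes_eq)

lemma tubes_nonempty: "\<exists>T. T \<in> (tubes s \<rho> :: (real^'n) set set)"
  unfolding tubes_def using orthogonal_transformation_id by blast

lemma
  fixes w :: "real^'n \<Rightarrow> real"
  assumes w: "integrable lebesgue w" "\<And>x. 0 \<le> w x"
  shows rel_mass_le_tube_sup: "Q \<in> dyadic_cubes \<rho> \<Longrightarrow> mass w Q \<noteq> 0 \<Longrightarrow> T \<in> tubes s \<rho> \<Longrightarrow> rel_mass w Q T \<le> tube_sup w s \<rho>"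
    and mass_tube_le: "Q \<in> dyadic_cubes \<rho> \<Longrightarrow> mass w Q \<noteq> 0 \<Longrightarrow> T \<in> tubes s \<rho> \<Longrightarrow> mass w (T \<inter> Q) \<le> tube_sup w s \<rho> * mass w Q"
    and tube_sup_nonneg: "Q \<in> dyadic_cubes \<rho> \<Longrightarrow> mass w Q \<noteq> 0 \<Longrightarrow> 0 \<le> tube_sup w s \<rho>"
proof -
  have bdd: "bdd_above {rel_mass w Q T | Q T. Q \<in> dyadic_cubes \<rho> \<and> mass w Q \<noteq> 0 \<and> T \<in> tubes s \<rho>}"
  proof (rule bdd_aboveI)
    fix x assume "x \<in> {rel_mass w Q T | Q T. Q \<in> dyadic_cubes \<rho> \<and> mass w Q \<noteq> 0 \<and> T \<in> tubes s \<rho>}"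
    then obtain Q T where x: "x = rel_mass w Q T" and Q: "Q \<in> dyadic_cubes \<rho>" "mass w Q \<noteq> 0" and T: "T \<in> tubes s \<rho>" by blast
    have "mass w (T \<inter> Q) \<le> mass w Q" using w Q T by (intro mass_mono) (auto intro: tube_borel cube_borel)
    then show "x \<le> 1" unfolding x rel_mass_def using Q mass_nonneg[of w Q, OF w(2)] by (simp add: divide_le_eq)
  qed
  show 1: "rel_mass w Q T \<le> tube_sup w s \<rho>" if "Q \<in> dyadic_cubes \<rho>" "mass w Q \<noteq> 0" "T \<in> tubes s \<rho>" for Q T
    unfolding tube_sup_def by (rule cSup_upper[OF _ bdd]) (use that in blast)
  show "mass w (T \<inter> Q) \<le> tube_sup w s \<rho> * mass w Q" if "Q \<in> dyadic_cubes \<rho>" "mass w Q \<noteq> 0" "T \<in> tubes s \<rho>" for Q T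
  proof -
    have "mass w Q > 0" using that mass_nonneg[of w Q, OF w(2)] by simp
    then show ?thesis using 1[OF that] by (simp add: rel_mass_def pos_divide_le_eq)
  qed
  show "0 \<le> tube_sup w s \<rho>" if "Q \<in> dyadic_cubes \<rho>" "mass w Q \<noteq> 0" for Q
  proof -
    obtain T where T: "T \<in> (tubes s \<rho> :: (real^'n) set set)" using tubes_nonempty by blast
    have "0 \<le> rel_mass w Q T" unfolding rel_mass_def using mass_nonneg[of w, OF w(2)] by (intro divide_nonneg_nonneg) auto
    then show ?thesis using 1[OF that T] by linarith
  qed
qed

lemma exists_heavy_cube:
  fixes w :: "real^'n \<Rightarrow> real"
  assumes w: "integrable lebesgue w" "\<And>x. 0 \<le> w x" and A: "mass w A \<noteq> 0" "A \<in> sets borel" and \<rho>: "\<rho> > 0"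
  shows "\<exists>Q\<in>dyadic_cubes \<rho>. mass w Q \<noteq> 0"
proof (rule ccontr)
  assume "\<not> ?thesis"
  then have z: "mass w (grid_cube \<rho> k) = 0" for k by (auto simp: dyadic_cubes_eq)
  have "emeasure (weight_measure w) UNIV = (\<integral>\<^sup>+x. 1 \<partial>weight_measure w)" by (simp add: weight_measure_def)
  also have "\<dots> = (\<integral>\<^sup>+k. (\<integral>\<^sup>+z. indicator (grid_cube \<rho> k) z * 1 \<partial>weight_measure w) \<partial>count_space UNIV)"
    by (rule nn_integral_grid_cubes[OF \<rho>]) auto
  also have "\<dots> = 0" by (simp add: emeasure_weight_measure[OF w] z)
  finally have "emeasure (weight_measure w) UNIV = 0" .
  then have "emeasure (weight_measure w) A = 0"
    using emeasure_mono[of A UNIV "weight_measure w"] by simp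
  then have "mass w A = 0" using mass_nonneg[of w A, OF w(2)] by (simp add: emeasure_weight_measure[OF w A(2)])
  with A show False by simp
qed

text \<open>
  The one-step estimate summed over all cubes of side \<open>\<rho>\<close>.
\<close>

definition multiscale_bound :: "'n::finite itself \<Rightarrow> real \<Rightarrow> real \<Rightarrow> bool" where
  "multiscale_bound _ l C \<longleftrightarrow> (\<forall>(f :: real^'n \<Rightarrow> complex) w s \<rho>.
    integrable sphere_measure f \<longrightarrow> integrable lebesgue w \<longrightarrow> (\<forall>x. 0 \<le> w x) \<longrightarrow> 1 \<le> s \<longrightarrow> s \<le> \<rho> \<longrightarrow> \<rho> \<le> s\<^sup>2 \<longrightarrow>
    (\<integral>\<^sup>+z. local_energy sphere_measure f (l * s\<^sup>2) z \<partial>weight_measure w)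
      \<le> ennreal (C * (s/\<rho>)) * ennreal (tube_sup w s \<rho>) * (\<integral>\<^sup>+z. local_energy sphere_measure f (16 * l * \<rho>\<^sup>2) z \<partial>weight_measure w))"

text \<open>
  On a cube \<open>Q\<close> of positive mass the two-scale step holds for every point \<open>c\<close> of \<open>Q\<close>; averaging it over \<open>c\<close> with respect to the
  weight turns the factor \<open>w Q\<close> into the integral of the energy at the next scale over \<open>Q\<close>.
\<close>

lemma multiscale_step: "\<exists>l0\<ge>1. \<forall>l\<ge>l0. \<exists>C>0. multiscale_bound TYPE('n::finite) l C"
proof -
  interpret sphere_carried "sphere_measure :: (real^'n) measure" by (rule sphere_carried_sphere_measure)
  obtain l0 where l0: "l0 \<ge> 1" and step: "\<forall>l\<ge>l0. \<exists>C>0. two_scale_bound (sphere_measure :: (real^'n) measure) (real CARD('n)) l C"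
    using two_scale_step[of "real CARD('n)"] by auto
  show ?thesis
  proof (rule exI[of _ l0], rule conjI[OF l0], intro allI impI)
    fix l assume l: "l0 \<le> l"
    obtain C where C: "C > 0" and est: "two_scale_bound (sphere_measure :: (real^'n) measure) (real CARD('n)) l C"
      using step l by blast
    show "\<exists>C>0. multiscale_bound TYPE('n::finite) l C"
      unfolding multiscale_bound_def
    proof (rule exI[of _ "2 * C"], rule conjI, use C in simp, intro allI impI)
      fix f :: "real^'n \<Rightarrow> complex" and w :: "real^'n \<Rightarrow> real" and s \<rho> :: real
      assume f: "integrable sphere_measure f" and w: "integrable lebesgue w" "\<forall>x. 0 \<le> w x" and s: "1 \<le> s" "s \<le> \<rho>" "\<rho> \<le> s\<^sup>2"
      define \<nu> where "\<nu> = weight_measure w"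
      define P where "P = local_energy sphere_measure f (l * s\<^sup>2)"
      define P' where "P' = local_energy sphere_measure f (16 * l * \<rho>\<^sup>2)"
      define A where "A = ennreal (2 * C * (s/\<rho>)) * ennreal (tube_sup w s \<rho>)"
      have \<nu>: "sets \<nu> = sets borel" by (simp add: \<nu>_def)
      note [measurable_cong] = \<nu>
      have w0: "0 \<le> w x" for x using w by simp
      have em: "emeasure \<nu> A = ennreal (mass w A)" if "A \<in> sets borel" for A
        unfolding \<nu>_def by (rule emeasure_weight_measure[OF w(1) w0 that])
      have fin: "finite_measure \<nu>"
        by (rule finite_measureI) (simp add: em sets_eq_imp_space_eq[OF \<nu>])
      then have sf: "sigma_finite_measure \<nu>" by (rule finite_measure.axioms(1))
      have [measurable]: "f \<in> borel_measurable sphere_measure" using f by auto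
      have [measurable]: "P \<in> borel_measurable borel" "P' \<in> borel_measurable borel" unfolding P_def P'_def by measurable
      have \<rho>: "\<rho> > 0" using s by linarith
      have cube: "(\<integral>\<^sup>+z. indicator Q z * P z \<partial>\<nu>) \<le> A * (\<integral>\<^sup>+z. indicator Q z * P' z \<partial>\<nu>)"
        if Q: "Q = grid_cube \<rho> k" for Q k
      proof (cases "mass w Q = 0")
        case True
        have [measurable]: "Q \<in> sets borel" by (simp add: Q)
        have "emeasure \<nu> Q = 0" using True em[of Q] by simp
        then have "AE z in \<nu>. z \<notin> Q" by (intro AE_not_in) (simp add: null_sets_def \<nu>)
        then have "(\<integral>\<^sup>+z. indicator Q z * P z \<partial>\<nu>) = (\<integral>\<^sup>+z. 0 \<partial>\<nu>)" by (intro nn_integral_cong_AE) auto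
        then show ?thesis by simp
      next
        case False
        have Qd: "Q \<in> dyadic_cubes \<rho>" by (simp add: Q dyadic_cubes_eq)
        have Qb[measurable]: "Q \<in> sets borel" by (simp add: Q)
        have m: "mass w Q > 0" using False mass_nonneg[of w Q, OF w0] by simp
        have S0: "0 \<le> tube_sup w s \<rho>" by (rule tube_sup_nonneg[OF w(1) w0 Qd False])
        define X where "X = (\<integral>\<^sup>+z. indicator Q z * P z \<partial>\<nu>)"
        have cap: "emeasure \<nu> (Q \<inter> {z. q - z \<in> capsule s \<rho> e}) \<le> ennreal (2 * (tube_sup w s \<rho> * mass w Q))" if e: "norm e = 1" for q e
        proof -
          obtain T1 T2 where T: "T1 \<in> tubes s \<rho>" "T2 \<in> tubes s \<rho>" "{z. q - z \<in> capsule s \<rho> e} \<subseteq> T1 \<union> T2"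
            using capsule_subset_two_tubes[OF e, of s \<rho> q] s by auto
          have [measurable]: "T1 \<in> sets borel" "T2 \<in> sets borel" using T by (auto intro: tube_borel)
          have "emeasure \<nu> (Q \<inter> {z. q - z \<in> capsule s \<rho> e}) \<le> emeasure \<nu> ((T1 \<inter> Q) \<union> (T2 \<inter> Q))"
            using T(3) by (intro emeasure_mono) (auto simp: \<nu>)
          also have "\<dots> \<le> emeasure \<nu> (T1 \<inter> Q) + emeasure \<nu> (T2 \<inter> Q)"
            by (rule emeasure_subadditive) (simp_all add: \<nu>)
          also have "\<dots> = ennreal (mass w (T1 \<inter> Q) + mass w (T2 \<inter> Q))"
            by (simp add: em mass_nonneg[of w, OF w0])
          also have "\<dots> \<le> ennreal (2 * (tube_sup w s \<rho> * mass w Q))"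
            using mass_tube_le[OF w(1) w0 Qd False T(1)] mass_tube_le[OF w(1) w0 Qd False T(2)] by (intro ennreal_leI) linarith
          finally show ?thesis .
        qed
        have main: "X \<le> A * ennreal (mass w Q) * P' c" if c: "c \<in> Q" for c
        proof -
          have "X \<le> ennreal (C * (s/\<rho>)) * ennreal (2 * (tube_sup w s \<rho> * mass w Q)) * P' c"
            unfolding X_def P_def P'_def
          proof (rule est[unfolded two_scale_bound_def, rule_format, OF f sf \<nu> Qb _ s])
            show "norm (z - c) \<le> real CARD('n) * \<rho>" if "z \<in> Q" for z
              using that c unfolding Q by (rule grid_cube_diameter[OF \<rho>])
          qed (rule cap)
          also have "ennreal (C * (s/\<rho>)) * ennreal (2 * (tube_sup w s \<rho> * mass w Q)) = A * ennreal (mass w Q)"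
          proof -
            have "ennreal (C * (s/\<rho>)) * ennreal (2 * (tube_sup w s \<rho> * mass w Q)) = ennreal (C * (s/\<rho>) * (2 * (tube_sup w s \<rho> * mass w Q)))"
              using C s \<rho> by (intro ennreal_mult'[symmetric]) auto
            also have "C * (s/\<rho>) * (2 * (tube_sup w s \<rho> * mass w Q)) = 2 * C * (s/\<rho>) * tube_sup w s \<rho> * mass w Q" by simp
            also have "ennreal \<dots> = A * ennreal (mass w Q)"
              unfolding A_def using C s \<rho> S0 by (simp only: ennreal_mult' mult_nonneg_nonneg divide_nonneg_pos zero_le_numeral less_imp_le order_trans[OF zero_le_one])
            finally show ?thesis .
          qed
          finally show ?thesis .
        qed
        have "X * ennreal (mass w Q) = (\<integral>\<^sup>+c. X * indicator Q c \<partial>\<nu>)"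
          by (subst nn_integral_cmult_indicator) (simp_all add: \<nu> em)
        also have "\<dots> \<le> (\<integral>\<^sup>+c. A * ennreal (mass w Q) * (indicator Q c * P' c) \<partial>\<nu>)"
          using main by (intro nn_integral_mono) (auto split: split_indicator)
        also have "\<dots> = A * ennreal (mass w Q) * (\<integral>\<^sup>+c. indicator Q c * P' c \<partial>\<nu>)"
          by (rule nn_integral_cmult) measurable
        finally have le: "X * ennreal (mass w Q) \<le> A * ennreal (mass w Q) * (\<integral>\<^sup>+c. indicator Q c * P' c \<partial>\<nu>)" .
        have inv: "Y * ennreal (mass w Q) * ennreal (1 / mass w Q) = Y" for Y
        proof -
          have "ennreal (mass w Q) * ennreal (1 / mass w Q) = 1" using m by (simp flip: ennreal_mult')
          then show ?thesis by (simp only: mult.assoc mult_1_right)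
        qed
        have "X * ennreal (mass w Q) * ennreal (1 / mass w Q) \<le> A * ennreal (mass w Q) * (\<integral>\<^sup>+c. indicator Q c * P' c \<partial>\<nu>) * ennreal (1 / mass w Q)"
          by (rule mult_right_mono[OF le]) simp
        also have "\<dots> = A * (\<integral>\<^sup>+c. indicator Q c * P' c \<partial>\<nu>) * ennreal (mass w Q) * ennreal (1 / mass w Q)"
          by (simp only: mult_ac)
        finally show ?thesis unfolding inv X_def .
      qed
      have "(\<integral>\<^sup>+z. P z \<partial>\<nu>) = (\<integral>\<^sup>+k. (\<integral>\<^sup>+z. indicator (grid_cube \<rho> k) z * P z \<partial>\<nu>) \<partial>count_space UNIV)"
        by (rule nn_integral_grid_cubes[OF \<rho> \<nu>]) measurable
      also have "\<dots> \<le> (\<integral>\<^sup>+k. A * (\<integral>\<^sup>+z. indicator (grid_cube \<rho> k) z * P' z \<partial>\<nu>) \<partial>count_space UNIV)"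
        by (intro nn_integral_mono cube[OF refl])
      also have "\<dots> = A * (\<integral>\<^sup>+k. (\<integral>\<^sup>+z. indicator (grid_cube \<rho> k) z * P' z \<partial>\<nu>) \<partial>count_space UNIV)"
        by (rule nn_integral_cmult) simp
      also have "(\<integral>\<^sup>+k. (\<integral>\<^sup>+z. indicator (grid_cube \<rho> k) z * P' z \<partial>\<nu>) \<partial>count_space UNIV) = (\<integral>\<^sup>+z. P' z \<partial>\<nu>)"
        by (rule nn_integral_grid_cubes[OF \<rho> \<nu>, symmetric]) measurable
      finally show "(\<integral>\<^sup>+z. local_energy sphere_measure f (l * s\<^sup>2) z \<partial>weight_measure w)
        \<le> ennreal (2 * C * (s/\<rho>)) * ennreal (tube_sup w s \<rho>) * (\<integral>\<^sup>+z. local_energy sphere_measure f (16 * l * \<rho>\<^sup>2) z \<partial>weight_measure w)"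
        unfolding A_def P_def P'_def \<nu>_def .
    qed
  qed
qed

text \<open>
  Iterating the step, the factors \<open>r i / r (i+1)\<close> telescope.
\<close>

lemma multiscale_chain:
  fixes r :: "nat \<Rightarrow> real" and f :: "real^'n \<Rightarrow> complex"
  assumes l0: "l0 \<ge> 1" and C: "\<And>l. l \<ge> l0 \<Longrightarrow> C l > (0::real)"
    and step: "\<And>l s \<rho>. l \<ge> l0 \<Longrightarrow> 1 \<le> s \<Longrightarrow> s \<le> \<rho> \<Longrightarrow> \<rho> \<le> s\<^sup>2 \<Longrightarrow>
      (\<integral>\<^sup>+z. local_energy sphere_measure f (l * s\<^sup>2) z \<partial>weight_measure w)
      \<le> ennreal (C l * (s/\<rho>)) * ennreal (tube_sup w s \<rho>) * (\<integral>\<^sup>+z. local_energy sphere_measure f (16 * l * \<rho>\<^sup>2) z \<partial>weight_measure w)"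
    and r0: "1 \<le> r 0" and r: "\<And>j. j < M \<Longrightarrow> r j < r (Suc j) \<and> r (Suc j) \<le> (r j)\<^sup>2"
    and nn: "\<And>j. j < M \<Longrightarrow> 0 \<le> tube_sup w (r j) (r (Suc j))"
  shows "j \<le> M \<Longrightarrow> 1 \<le> r j \<and> (\<integral>\<^sup>+z. local_energy sphere_measure f (l0 * (r 0)\<^sup>2) z \<partial>weight_measure w)
    \<le> ennreal ((\<Prod>i<j. C (16^i * l0)) * (r 0 / r j) * (\<Prod>i<j. tube_sup w (r i) (r (Suc i)))) *
      (\<integral>\<^sup>+z. local_energy sphere_measure f (16^j * l0 * (r j)\<^sup>2) z \<partial>weight_measure w)"
proof (induction j)
  case 0
  then show ?case using r0 by simp
next
  case (Suc j)
  then have jM: "j < M" "j \<le> M" by auto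
  define X where "X = (\<lambda>i. \<integral>\<^sup>+z. local_energy sphere_measure f (16^i * l0 * (r i)\<^sup>2) z \<partial>weight_measure w)"
  define p where "p = (\<Prod>i<j. C (16^i * l0))"
  define q where "q = (\<Prod>i<j. tube_sup w (r i) (r (Suc i)))"
  have ih: "1 \<le> r j" "X 0 \<le> ennreal (p * (r 0 / r j) * q) * X j"
    using Suc.IH[OF jM(2)] by (simp_all add: X_def p_def q_def)
  have rj: "r j < r (Suc j)" "r (Suc j) \<le> (r j)\<^sup>2" using r[OF jM(1)] by auto
  have l: "16^i * l0 \<ge> l0" for i using l0 one_le_power[of "16::real" i] mult_right_mono[of 1 "16^i" l0] by simp
  have p0: "p \<ge> 0" unfolding p_def by (intro prod_nonneg less_imp_le C l)
  have q0: "q \<ge> 0" unfolding q_def using jM by (intro prod_nonneg nn) auto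
  have C0: "C (16^j * l0) > 0" by (intro C l)
  have "X j \<le> ennreal (C (16^j * l0) * (r j / r (Suc j))) * ennreal (tube_sup w (r j) (r (Suc j))) * X (Suc j)"
    using step[of "16^j * l0" "r j" "r (Suc j)"] l[of j] ih(1) rj by (simp add: X_def mult.assoc)
  then have "X 0 \<le> ennreal (p * (r 0 / r j) * q) * (ennreal (C (16^j * l0) * (r j / r (Suc j))) * ennreal (tube_sup w (r j) (r (Suc j))) * X (Suc j))"
    by (intro order_trans[OF ih(2)] mult_left_mono) auto
  also have "\<dots> = ennreal ((p * (r 0 / r j) * q) * ((C (16^j * l0) * (r j / r (Suc j))) * tube_sup w (r j) (r (Suc j)))) * X (Suc j)"
  proof -
    have "ennreal a * (ennreal b * ennreal t * Y) = ennreal (a * (b * t)) * Y" if "a \<ge> 0" "b \<ge> 0" for a b t Y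
      using that by (simp only: ennreal_mult' mult.assoc)
    moreover have "p * (r 0 / r j) * q \<ge> 0" "C (16^j * l0) * (r j / r (Suc j)) \<ge> 0"
      using p0 q0 C0 r0 ih(1) rj by (auto intro!: mult_nonneg_nonneg divide_nonneg_nonneg)
    ultimately show ?thesis by blast
  qed
  also have "(p * (r 0 / r j) * q) * ((C (16^j * l0) * (r j / r (Suc j))) * tube_sup w (r j) (r (Suc j)))
    = (\<Prod>i<Suc j. C (16^i * l0)) * (r 0 / r (Suc j)) * (\<Prod>i<Suc j. tube_sup w (r i) (r (Suc i)))"
    using ih(1) by (simp add: p_def q_def)
  finally show ?case using ih(1) rj by (simp add: X_def)
qed


lemma L2_sphere_integrable:
  assumes f: "f \<in> L2_sphere"
  shows "integrable sphere_measure f"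
    and "(\<integral>\<^sup>+\<omega>. ennreal ((cmod (f \<omega>))\<^sup>2) \<partial>sphere_measure) = ennreal ((L2_norm_sphere f)\<^sup>2)"
proof -
  interpret sphere_carried "sphere_measure :: (real^'n) measure" by (rule sphere_carried_sphere_measure)
  have f': "f \<in> borel_measurable sphere_measure" "integrable sphere_measure (\<lambda>\<omega>. (cmod (f \<omega>))\<^sup>2)"
    using f by (auto simp: L2_sphere_def)
  have "integrable sphere_measure (\<lambda>\<omega>. cmod (f \<omega>))"
    by (rule square_integrable_imp_integrable) (use f' in auto)
  then show "integrable sphere_measure f" using f' by (simp add: integrable_norm_iff)
  have "(L2_norm_sphere f)\<^sup>2 = (\<integral>\<omega>. (cmod (f \<omega>))\<^sup>2 \<partial>sphere_measure)"
    unfolding L2_norm_sphere_def by (simp add: integral_nonneg_AE)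
  then show "(\<integral>\<^sup>+\<omega>. ennreal ((cmod (f \<omega>))\<^sup>2) \<partial>sphere_measure) = ennreal ((L2_norm_sphere f)\<^sup>2)"
    using nn_integral_eq_integral[OF f'(2)] by simp
qed

text \<open>
  Combine the pointwise bound at the bottom scale, the chain of steps and the Schur bound at the top scale.  The factor
  \<open>r 0 / r M\<close> of the chain meets \<open>sqrt a = sqrt (16^M l0) r M\<close> from the Schur bound, and \<open>r 0\<close> remains.
\<close>

lemma weighted_extension_estimate:
  fixes r :: "nat \<Rightarrow> real" and f :: "real^'n \<Rightarrow> complex" and w :: "real^'n \<Rightarrow> real"
  assumes l0: "l0 \<ge> 1" and C: "\<And>l. l \<ge> l0 \<Longrightarrow> C l > (0::real) \<and> multiscale_bound TYPE('n) l (C l)"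
    and r0: "1 \<le> r 0" and r: "\<And>j. j < M \<Longrightarrow> r j < r (Suc j) \<and> r (Suc j) \<le> (r j)\<^sup>2"
    and w: "integrable lebesgue w" "\<And>x. 0 \<le> w x" and A: "A \<in> sets borel" "\<And>x. x \<notin> A \<Longrightarrow> w x = 0" "mass w A \<noteq> 0"
    and f: "f \<in> L2_sphere"
  defines "B \<equiv> 2 * real CARD('n) * exp pi * sqrt 2 ^ CARD('n)"
  shows "inverse (mass w A) * (LINT x:A|lebesgue. (cmod (extension_op f x))\<^sup>2 * w x)
    \<le> (exp (2*pi) * (\<Prod>i<M. C (16^i * l0)) * B * sqrt (16^M * l0)) * r 0 *
      (\<Prod>j<M. tube_sup w (r j) (r (Suc j))) * (L2_norm_sphere f)\<^sup>2"
proof -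
  interpret sphere_carried "sphere_measure :: (real^'n) measure" by (rule sphere_carried_sphere_measure)
  note fi = L2_sphere_integrable[OF f]
  have [measurable]: "f \<in> borel_measurable sphere_measure" using fi(1) by auto
  define \<nu> where "\<nu> = weight_measure w"
  have \<nu>: "sets \<nu> = sets borel" by (simp add: \<nu>_def)
  note [measurable_cong] = \<nu>
  define P where "P = (\<Prod>i<M. C (16^i * l0))"
  define S where "S = (\<Prod>j<M. tube_sup w (r j) (r (Suc j)))"
  define N where "N = (L2_norm_sphere f)\<^sup>2"
  define m where "m = mass w A"
  have m: "m > 0" using A(3) mass_nonneg[of w A, OF w(2)] by (simp add: m_def)
  have rpos: "1 \<le> r j" if "j \<le> M" for j
    using that
  proof (induction j)
    case (Suc j)
    then show ?case using r[of j] by simp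
  qed (use r0 in simp)
  have nn: "0 \<le> tube_sup w (r j) (r (Suc j))" if "j < M" for j
  proof -
    have "r (Suc j) > 0" using rpos[of "Suc j"] that by simp
    then obtain Q where "Q \<in> dyadic_cubes (r (Suc j))" "mass w Q \<noteq> 0"
      using exists_heavy_cube[OF w A(3,1)] by blast
    then show ?thesis by (rule tube_sup_nonneg[OF w])
  qed
  have l: "16^i * l0 \<ge> l0" for i using l0 one_le_power[of "16::real" i] mult_right_mono[of 1 "16^i" l0] by simp
  have P0: "P \<ge> 0" unfolding P_def using C l by (intro prod_nonneg) (auto simp: less_imp_le)
  have S0: "S \<ge> 0" unfolding S_def by (intro prod_nonneg nn) auto
  have B0: "B \<ge> 0" by (simp add: B_def)
  have step: "(\<integral>\<^sup>+z. local_energy sphere_measure f (l * s\<^sup>2) z \<partial>weight_measure w)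
      \<le> ennreal (C l * (s/\<rho>)) * ennreal (tube_sup w s \<rho>) * (\<integral>\<^sup>+z. local_energy sphere_measure f (16 * l * \<rho>\<^sup>2) z \<partial>weight_measure w)"
    if "l \<ge> l0" "1 \<le> s" "s \<le> \<rho>" "\<rho> \<le> s\<^sup>2" for l s \<rho>
    using C[OF that(1)] fi(1) w that unfolding multiscale_bound_def by blast
  have chain: "(\<integral>\<^sup>+z. local_energy sphere_measure f (l0 * (r 0)\<^sup>2) z \<partial>\<nu>)
    \<le> ennreal (P * (r 0 / r M) * S) * (\<integral>\<^sup>+z. local_energy sphere_measure f (16^M * l0 * (r M)\<^sup>2) z \<partial>\<nu>)"
    using multiscale_chain[OF l0 conjunct1[OF C] step r0 r nn, of M] unfolding \<nu>_def P_def S_def by blast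
  have tot: "emeasure \<nu> UNIV = ennreal m"
  proof -
    have "mass w UNIV = mass w A"
      unfolding mass_def set_lebesgue_integral_def
      by (intro Bochner_Integration.integral_cong) (auto simp: A(2) split: split_indicator)
    then show ?thesis unfolding \<nu>_def m_def using emeasure_weight_measure[OF w, of UNIV] by simp
  qed
  have top: "(\<integral>\<^sup>+z. local_energy sphere_measure f (16^M * l0 * (r M)\<^sup>2) z \<partial>\<nu>) \<le> ennreal (B * (sqrt (16^M * l0) * r M) * N * m)"
  proof -
    have "1 \<le> 16^M * l0" using l[of M] l0 by linarith
    moreover have "1 \<le> (r M)\<^sup>2" using rpos[of M] by (simp add: one_le_power)
    ultimately have big: "1 * 1 \<le> (16^M * l0) * (r M)\<^sup>2"
      by (intro mult_mono) auto
    have "sqrt (16^M * l0 * (r M)\<^sup>2) = sqrt (16^M * l0) * r M"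
      using rpos[of M] by (simp add: real_sqrt_mult)
    then have le: "local_energy sphere_measure f (16^M * l0 * (r M)\<^sup>2) z \<le> ennreal (B * (sqrt (16^M * l0) * r M) * N)" for z
      using local_energy_sphere_measure_le[OF fi(1), of "16^M * l0 * (r M)\<^sup>2" z] big B0 rpos[of M] l0
      unfolding fi(2) B_def[symmetric] N_def[symmetric] by (simp add: ennreal_mult')
    have "(\<integral>\<^sup>+z. local_energy sphere_measure f (16^M * l0 * (r M)\<^sup>2) z \<partial>\<nu>) \<le> (\<integral>\<^sup>+z. ennreal (B * (sqrt (16^M * l0) * r M) * N) \<partial>\<nu>)"
      by (intro nn_integral_mono le)
    also have "\<dots> = ennreal (B * (sqrt (16^M * l0) * r M) * N) * ennreal m"
      using tot sets_eq_imp_space_eq[OF \<nu>] by simp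
    also have "\<dots> = ennreal (B * (sqrt (16^M * l0) * r M) * N * m)"
      using m by (intro ennreal_mult''[symmetric]) simp
    finally show ?thesis .
  qed
  have bottom: "(\<integral>\<^sup>+z. ennreal ((cmod (sphere_ft sphere_measure f z))\<^sup>2) \<partial>\<nu>) \<le> ennreal (exp (2*pi)) * (\<integral>\<^sup>+z. local_energy sphere_measure f (l0 * (r 0)\<^sup>2) z \<partial>\<nu>)"
  proof -
    have big: "1 * 1 \<le> l0 * (r 0)\<^sup>2" using l0 r0 by (intro mult_mono) (auto simp: one_le_power)
    have "(\<integral>\<^sup>+z. ennreal ((cmod (sphere_ft sphere_measure f z))\<^sup>2) \<partial>\<nu>) \<le> (\<integral>\<^sup>+z. ennreal (exp (2*pi)) * local_energy sphere_measure f (l0 * (r 0)\<^sup>2) z \<partial>\<nu>)"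
    proof (rule nn_integral_mono)
      fix z
      show "ennreal ((cmod (sphere_ft sphere_measure f z))\<^sup>2) \<le> ennreal (exp (2*pi)) * local_energy sphere_measure f (l0 * (r 0)\<^sup>2) z"
        by (rule order_trans[OF pointwise_le_energy[OF fi(1)]], intro mult_left_mono local_energy_mono) (use big in auto)
    qed
    also have "\<dots> = ennreal (exp (2*pi)) * (\<integral>\<^sup>+z. local_energy sphere_measure f (l0 * (r 0)\<^sup>2) z \<partial>\<nu>)"
      by (rule nn_integral_cmult) measurable
    finally show ?thesis .
  qed
  define T where "T = exp (2*pi) * ((P * (r 0 / r M) * S) * (B * (sqrt (16^M * l0) * r M) * N * m))"
  have a0: "P * (r 0 / r M) * S \<ge> 0" "B * (sqrt (16^M * l0) * r M) * N * m \<ge> 0"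
    using P0 S0 B0 m r0 l0 rpos[of M] by (auto simp: N_def intro!: mult_nonneg_nonneg divide_nonneg_nonneg)
  have "(\<integral>\<^sup>+z. ennreal ((cmod (sphere_ft sphere_measure f z))\<^sup>2) \<partial>\<nu>) \<le> ennreal (exp (2*pi)) * (ennreal (P * (r 0 / r M) * S) * ennreal (B * (sqrt (16^M * l0) * r M) * N * m))"
    by (rule order_trans[OF bottom], intro mult_left_mono order_trans[OF chain] mult_left_mono top) auto
  also have "\<dots> = ennreal T"
    unfolding T_def using a0 by (simp only: ennreal_mult' exp_ge_zero)
  finally have total: "(\<integral>\<^sup>+z. ennreal ((cmod (sphere_ft sphere_measure f z))\<^sup>2) \<partial>\<nu>) \<le> ennreal T" .
  have "(LINT x:A|lebesgue. (cmod (extension_op f x))\<^sup>2 * w x) \<le> T"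
    unfolding set_lebesgue_integral_def
  proof (rule integral_real_bounded)
    show "0 \<le> T" unfolding T_def by (intro mult_nonneg_nonneg a0 exp_ge_zero)
    have "(\<integral>\<^sup>+x. ennreal (indicator A x *\<^sub>R ((cmod (extension_op f x))\<^sup>2 * w x)) \<partial>lebesgue) \<le> (\<integral>\<^sup>+x. ennreal (w x) * ennreal ((cmod (sphere_ft sphere_measure f x))\<^sup>2) \<partial>lebesgue)"
      unfolding extension_op_eq_sphere_ft using w
      by (intro nn_integral_mono) (auto split: split_indicator simp: ennreal_mult' mult.commute)
    also have "\<dots> = (\<integral>\<^sup>+z. ennreal ((cmod (sphere_ft sphere_measure f z))\<^sup>2) \<partial>\<nu>)"
      unfolding \<nu>_def by (rule nn_integral_weight_measure[symmetric]) (use w in auto)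
    finally show "(\<integral>\<^sup>+x. ennreal (indicator A x *\<^sub>R ((cmod (extension_op f x))\<^sup>2 * w x)) \<partial>lebesgue) \<le> ennreal T"
      using total by (rule order_trans)
  qed
  then have "inverse m * (LINT x:A|lebesgue. (cmod (extension_op f x))\<^sup>2 * w x) \<le> inverse m * T"
    using m by (intro mult_left_mono) auto
  also have "inverse m * T = exp (2*pi) * P * B * sqrt (16^M * l0) * r 0 * S * N"
    using m rpos[of M] by (simp add: T_def)
  finally show ?thesis by (simp only: m_def P_def S_def N_def)
qed

theorem proposition1p2:
  assumes "CARD('n::finite) \<ge> 2"
  shows "\<exists>C>0. \<forall>\<delta>::real. 0 < \<delta> \<and> \<delta> < 1/2 \<longrightarrow> (\<forall>M::nat. \<exists>C'>0.
    \<forall>(R::real) (r :: nat \<Rightarrow> real) (a :: real ^ 'n) (w :: real ^ 'n \<Rightarrow> real) (f :: real ^ 'n \<Rightarrow> complex).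
      R > 0 \<and> r 0 = R powr \<delta> \<and> r M = R \<and>
      (\<forall>j<M. r j < r (Suc j) \<and> r (Suc j) \<le> (r j)\<^sup>2) \<and>
      (\<forall>x. 0 \<le> w x) \<and> (\<forall>x. x \<notin> ball a R \<longrightarrow> w x = 0) \<and>
      integrable lebesgue w \<and> mass w (ball a R) \<noteq> 0 \<and>
      f \<in> L2_sphere
      \<longrightarrow>
      inverse (mass w (ball a R)) * (LINT x:ball a R|lebesgue. (cmod (extension_op f x))\<^sup>2 * w x)
        \<le> C' * R powr (C * \<delta>) *
          (\<Prod>j<M. Sup {rel_mass w Q T | Q T.
                        Q \<in> dyadic_cubes (r (Suc j)) \<and> mass w Q \<noteq> 0 \<and>
                        T \<in> tubes (r j) (r (Suc j))}) *
          (L2_norm_sphere f)\<^sup>2)"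
proof -
  obtain l0 where l0: "l0 \<ge> 1" and ex: "\<forall>l\<ge>l0. \<exists>C>0. multiscale_bound TYPE('n) l C"
    using multiscale_step by blast
  define K where "K = (\<lambda>l. SOME C. C > 0 \<and> multiscale_bound TYPE('n) l C)"
  have K: "K l > 0 \<and> multiscale_bound TYPE('n) l (K l)" if "l \<ge> l0" for l
  proof -
    have "\<exists>C. C > 0 \<and> multiscale_bound TYPE('n) l C" using ex that by blast
    then show ?thesis unfolding K_def by (rule someI_ex)
  qed
  define B where "B = 2 * real CARD('n) * exp pi * sqrt 2 ^ CARD('n)"
  define D where "D = (\<lambda>M. exp (2*pi) * (\<Prod>i<M. K (16^i * l0)) * B * sqrt (16^M * l0))"
  have D: "D M > 0" for M
  proof -
    have "l0 \<le> 16^i * l0" for i using l0 one_le_power[of "16::real" i] mult_right_mono[of 1 "16^i" l0] by simp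
    then have "(\<Prod>i<M. K (16^i * l0)) > 0" using K by (intro prod_pos) auto
    then show ?thesis unfolding D_def B_def using l0 by (intro mult_pos_pos) auto
  qed
  show ?thesis
    unfolding tube_sup_def[symmetric]
  proof (rule exI[of _ 1], intro conjI zero_less_one allI impI)
    fix \<delta> :: real and M :: nat
    assume \<delta>: "0 < \<delta> \<and> \<delta> < 1/2"
    show "\<exists>C'>0. \<forall>(R::real) (r :: nat \<Rightarrow> real) (a :: real ^ 'n) (w :: real ^ 'n \<Rightarrow> real) (f :: real ^ 'n \<Rightarrow> complex).
      R > 0 \<and> r 0 = R powr \<delta> \<and> r M = R \<and>
      (\<forall>j<M. r j < r (Suc j) \<and> r (Suc j) \<le> (r j)\<^sup>2) \<and>
      (\<forall>x. 0 \<le> w x) \<and> (\<forall>x. x \<notin> ball a R \<longrightarrow> w x = 0) \<and>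
      integrable lebesgue w \<and> mass w (ball a R) \<noteq> 0 \<and>
      f \<in> L2_sphere
      \<longrightarrow>
      inverse (mass w (ball a R)) * (LINT x:ball a R|lebesgue. (cmod (extension_op f x))\<^sup>2 * w x)
        \<le> C' * R powr (1 * \<delta>) *
          (\<Prod>j<M. tube_sup w (r j) (r (Suc j))) *
          (L2_norm_sphere f)\<^sup>2"
    proof (rule exI[of _ "D M"], rule conjI[OF D], intro allI impI, elim conjE)
      fix R :: real and r :: "nat \<Rightarrow> real" and a :: "real ^ 'n" and w :: "real ^ 'n \<Rightarrow> real" and f :: "real ^ 'n \<Rightarrow> complex"
      assume R: "R > 0" "r 0 = R powr \<delta>" "r M = R" and r: "\<forall>j<M. r j < r (Suc j) \<and> r (Suc j) \<le> (r j)\<^sup>2"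
        and w: "\<forall>x. 0 \<le> w x" "\<forall>x. x \<notin> ball a R \<longrightarrow> w x = 0" "integrable lebesgue w" "mass w (ball a R) \<noteq> 0"
        and f: "f \<in> L2_sphere"
      have mono: "r 0 \<le> r j" if "j \<le> M" for j
        using that
      proof (induction j)
        case (Suc j)
        then have "r 0 \<le> r j" "r j < r (Suc j)" using r by auto
        then show ?case by linarith
      qed simp
      \<comment> \<open>For \<open>M = 0\<close> the hypotheses force \<open>R = R powr \<delta>\<close>, hence \<open>R = 1\<close>; otherwise \<open>R powr \<delta> < R\<close>.\<close>
      have R1: "1 \<le> R"
      proof (rule ccontr)
        assume "\<not> 1 \<le> R"
        then have "R powr 1 < R powr \<delta>" using R(1) \<delta> by (intro powr_less_mono') auto
        then show False using mono[of M] R by simp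
      qed
      have r0: "1 \<le> r 0" unfolding R(2) using R1 \<delta> by (intro ge_one_powr_ge_zero) auto
      show "inverse (mass w (ball a R)) * (LINT x:ball a R|lebesgue. (cmod (extension_op f x))\<^sup>2 * w x)
        \<le> D M * R powr (1 * \<delta>) *
          (\<Prod>j<M. tube_sup w (r j) (r (Suc j))) *
          (L2_norm_sphere f)\<^sup>2"
        unfolding D_def B_def mult_1_left R(2)[symmetric]
        by (rule weighted_extension_estimate[where C = K and r = r, OF l0 K r0]) (use r w f in auto)
    qed
  qed
qed

end
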